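(* Let $d\ge 1$, let $R_d=\mathbb{Z}[x_1^{\pm1},\dots,x_d^{\pm1}]$, and let $f\in R_d$ be irreducible and atoral. Then the principal algebraic $\mathbb{Z}^d$-action $\alpha_f$ on $X_f$ is exponentially recurrent with respect to the normalized Haar measure $\mu_f$ on $X_f$.
   Context: $R_d$ is the ring of Laurent polynomials with integer coefficients in $d$ commuting variables; write $f=\sum_{\mathbf{n}\in\mathbb{Z}^d}f_{\mathbf{n}}\mathbf{x}^{\mathbf{n}}$ with $\mathbf{x}^{\mathbf{n}}=x_1^{n_1}\cdots x_d^{n_d}$. The units of $R_d$ are the elements $\pm\mathbf{x}^{\mathbf{n}}$; an element is irreducible if it is neither a unit nor a product of two non-units of $R_d$. For $\mathbf{n}\in\mathbb{Z}^d$ put $\|\mathbf{n}\|=\max_{1\le j\le d}|n_j|$. Atorality. With $\mathbb{T}=\mathbb{R}/\mathbb{Z}$, the unitary variety of $f\in R_d$ is $$\mathsf{U}(f)=\{(t_1,\dots,t_d)\in\mathbb{T}^d: f(e^{2\pi i t_1},\dots,e^{2\pi i t_d})=0\}.$$ Under the identification of $\mathbb{T}^d$ with $\{z\in\mathbb{C}:|z|=1\}^d$, this is a real semialgebraic set, hence a finite disjoint union of cells, and its dimension $\dim\mathsf{U}(f)$ is the maximal dimension of these cells (independent of the cell decomposition). The polynomial $f$ is atoral if $\dim\mathsf{U}(f)\le d-2$; this includes the possibility $\mathsf{U}(f)=\varnothing$ (for every $d\ge 1$). Principal actions. An algebraic $\mathbb{Z}^d$-action is an action of $\mathbb{Z}^d$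 by continuous automorphisms of a compact metrizable abelian group; it automatically preserves the normalized Haar measure. On the compact abelian group $\mathbb{T}^{\mathbb{Z}^d}$ of all $t=(t_{\mathbf{n}})_{\mathbf{n}\in\mathbb{Z}^d}$ with $t_{\mathbf{n}}\in\mathbb{T}$, the shift action $\sigma$ is $(\sigma^{\mathbf{m}}t)_{\mathbf{n}}=t_{\mathbf{n}+\mathbf{m}}$. For $f\in R_d$, $$X_f=\Bigl\{t\in\mathbb{T}^{\mathbb{Z}^d}:\ \sum_{\mathbf{n}\in\mathbb{Z}^d}f_{\mathbf{n}}\,t_{\mathbf{m}+\mathbf{n}}=0\ \text{in }\mathbb{T}\text{ for all }\mathbf{m}\in\mathbb{Z}^d\Bigr\},$$ a closed shift-invariant subgroup, and $\alpha_f$ is the restriction of $\sigma$ to $X_f$. The pair $(X_f,\alpha_f)$ is the principal algebraic $\mathbb{Z}^d$-action corresponding to $f$. Exponential recurrence. For an integer $R\ge1$ let $B_R=\{\mathbf{n}\in\mathbb{Z}^d:\|\mathbf{n}\|\le R\}$, and let $|B_R|$ be its cardinality. An algebraic $\mathbb{Z}^d$-action $\alpha$ on $X$ with normalized Haar measure $\mu$ is exponentially recurrent if for every proper closed subset $K$ of $X$ there are constants $c>0$ and $0<\theta<1$ such that for all integers $R\ge 1$ $$\mu\Bigl(\bigcap_{\mathbf{n}\in B_R}\alpha^{\mathbf{n}}K\Bigr)\le c\,\theta^{|B_R|}.$$ *)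

theory Defs
  imports
    "HOL-Analysis.Analysis"
    "HOL-Probability.Probability"
    "HOL-Computational_Algebra.Factorial_Ring"
    "HOL-Library.Poly_Mapping"
    "HOL-Library.Function_Algebras"
begin

section \<open>The circle group of reals modulo integers\<close>

quotient_type add_circle = real / "\<lambda>x y :: real. x - y \<in> \<int>"
  morphisms rep_circle to_circle
proof (rule equivpI)
  show "reflp (\<lambda>x y :: real. x - y \<in> \<int>)"
    by (auto intro: reflpI)
  show "symp (\<lambda>x y :: real. x - y \<in> \<int>)"
    by (metis (no_types, lifting) Ints_minus minus_diff_eq sympI)
  show "transp (\<lambda>x y :: real. x - y \<in> \<int>)"
    by (rule transpI) (metis (no_types, lifting) Ints_add diff_add_cancel add_diff_eq)
qed

instantiation add_circle :: ab_group_add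
begin

lift_definition zero_add_circle :: add_circle is "0" .

lift_definition plus_add_circle :: "add_circle \<Rightarrow> add_circle \<Rightarrow> add_circle" is "(+)"
  by (metis (no_types, lifting) Ints_add add_diff_add)

lift_definition uminus_add_circle :: "add_circle \<Rightarrow> add_circle" is "uminus"
  by (metis (no_types, lifting) Ints_minus minus_diff_eq minus_diff_minus)

lift_definition minus_add_circle :: "add_circle \<Rightarrow> add_circle \<Rightarrow> add_circle" is "(-)"
  by (simp add: diff_diff_eq2 algebra_simps)
    (metis (no_types, opaque_lifting) Ints_diff add_diff_eq diff_diff_eq2 diff_add_eq)

instance
  by standard (transfer; simp)+

end

text \<open>The topology is the quotient topology.\<close>

instantiation add_circle :: topological_space
begin

definition open_add_circle :: "add_circle set \<Rightarrow> bool"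
  where "open_add_circle U \<longleftrightarrow> open (to_circle -` U)"

instance
proof
  show "open (UNIV :: add_circle set)"
    by (simp add: open_add_circle_def)
  show "open (S \<inter> T)" if "open S" "open T" for S T :: "add_circle set"
    using that by (simp add: open_add_circle_def open_Int)
  show "open (\<Union>K)" if "\<forall>S\<in>K. open S" for K :: "add_circle set set"
    using that by (auto simp: open_add_circle_def vimage_Union)
qed

end

text \<open>Multiplication of an element of the circle group by an integer.\<close>

lift_definition zmult :: "int \<Rightarrow> add_circle \<Rightarrow> add_circle" is "\<lambda>k x. of_int k * x"
  by (metis Ints_mult Ints_of_int right_diff_distrib)

text \<open>The character sending the class of \<open>t\<close> to \<open>exp (2 \<pi> \<i> t)\<close>.\<close>

lift_definition circle_exp :: "add_circle \<Rightarrow> complex" is "\<lambda>t. cis (2 * pi * t)"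
proof -
  fix x y :: real
  assume "x - y \<in> \<int>"
  then have "cis (2 * pi * (x - y)) = 1"
    by (auto simp: cis_multiple_2pi)
  then show "cis (2 * pi * x) = cis (2 * pi * y)"
    by (simp add: cis_divide[symmetric] right_diff_distrib)
qed

section \<open>Laurent polynomials with integer coefficients\<close>

text \<open>
  The group ring of \<open>\<int>\<^sup>d\<close>, with \<open>d = CARD('d)\<close>: finitely supported functions on exponent
  vectors, multiplied by convolution.
\<close>

type_synonym 'd laurent = "(int ^ 'd) \<Rightarrow>\<^sub>0 int"

definition laurent_eval :: "'d::finite laurent \<Rightarrow> complex ^ 'd \<Rightarrow> complex"
  where "laurent_eval f z =
    (\<Sum>n\<in>Poly_Mapping.keys f. of_int (Poly_Mapping.lookup f n) * (\<Prod>j\<in>UNIV. (z $ j) powi (n $ j)))"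

section \<open>Semialgebraic sets and their dimension\<close>

inductive semialgebraic :: "'a::euclidean_space set \<Rightarrow> bool"
  where
    positivity: "real_polynomial_function p \<Longrightarrow> semialgebraic {x. p x > 0}"
  | complement: "semialgebraic A \<Longrightarrow> semialgebraic (- A)"
  | intersection: "semialgebraic A \<Longrightarrow> semialgebraic B \<Longrightarrow> semialgebraic (A \<inter> B)"

text \<open>
  The open unit cube in the coordinate directions belonging to \<open>B\<close>. Letting \<open>B\<close> range over the
  sets of \<open>k\<close> basis vectors realizes \<open>(0,1)\<^sup>k\<close> inside the ambient space.
\<close>

definition open_cube :: "'a::euclidean_space set \<Rightarrow> 'a set"
  where "open_cube B = {x. \<forall>b\<in>Basis. if b \<in> B then 0 < x \<bullet> b \<and> x \<bullet> b < 1 else x \<bullet> b = 0}"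

text \<open>
  A \<open>k\<close>-dimensional cell is a semialgebraic set that is semialgebraically homeomorphic to
  \<open>(0,1)\<^sup>k\<close>, a map being semialgebraic if its graph is.
\<close>

definition semialgebraic_cell :: "nat \<Rightarrow> 'a::euclidean_space set \<Rightarrow> bool"
  where "semialgebraic_cell k C \<longleftrightarrow>
    semialgebraic C \<and>
    (\<exists>B \<subseteq> (Basis :: 'a set). card B = k \<and>
      (\<exists>h h'. homeomorphism (open_cube B) C h h' \<and>
              semialgebraic ((\<lambda>x. (x, h x)) ` open_cube B)))"

text \<open>
  \<open>has_semialgebraic_dim S k\<close>: the nonempty set \<open>S\<close> has a finite partition into cells whose
  maximal dimension is \<open>k\<close>. Every nonempty semialgebraic set has such a partition, and \<open>k\<close> does
  not depend on it.
\<close>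

definition has_semialgebraic_dim :: "'a::euclidean_space set \<Rightarrow> nat \<Rightarrow> bool"
  where "has_semialgebraic_dim S k \<longleftrightarrow>
    (\<exists>\<C> \<delta>. finite \<C> \<and> \<C> \<noteq> {} \<and> disjoint \<C> \<and> \<Union>\<C> = S \<and>
      (\<forall>C\<in>\<C>. semialgebraic_cell (\<delta> C) C) \<and> k = Max (\<delta> ` \<C>))"

section \<open>Atoral polynomials\<close>

definition torus_embed :: "add_circle ^ 'd \<Rightarrow> complex ^ 'd::finite"
  where "torus_embed t = (\<chi> j. circle_exp (t $ j))"

definition unitary_variety :: "'d::finite laurent \<Rightarrow> (add_circle ^ 'd) set"
  where "unitary_variety f = {t. laurent_eval f (torus_embed t) = 0}"

text \<open>
  The inequality \<open>dim \<le> d - 2\<close> is written additively to avoid truncated subtraction, and the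
  empty set satisfies it for every \<open>d\<close>.
\<close>

definition atoral :: "'d::finite laurent \<Rightarrow> bool"
  where "atoral f \<longleftrightarrow>
    unitary_variety f = {} \<or>
    (\<exists>k. has_semialgebraic_dim (torus_embed ` unitary_variety f) k \<and> k + 2 \<le> CARD('d))"

section \<open>Algebraic actions\<close>

definition compact_metrizable_group :: "'a::{ab_group_add, topological_space} set \<Rightarrow> bool"
  where "compact_metrizable_group X \<longleftrightarrow>
    0 \<in> X \<and> (\<forall>x\<in>X. \<forall>y\<in>X. x + y \<in> X) \<and> (\<forall>x\<in>X. - x \<in> X) \<and>
    continuous_on (X \<times> X) (\<lambda>(x, y). x + y) \<and> continuous_on X uminus \<and>
    compact X \<and> metrizable_space (top_of_set X)"

text \<open>
  Each \<open>\<alpha> n\<close> is automatically a homeomorphic automorphism, as it has the continuous inverse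
  \<open>\<alpha> (- n)\<close> on \<open>X\<close>.
\<close>

definition algebraic_action ::
    "'a::{ab_group_add, topological_space} set \<Rightarrow> (int ^ 'd::finite \<Rightarrow> 'a \<Rightarrow> 'a) \<Rightarrow> bool"
  where "algebraic_action X \<alpha> \<longleftrightarrow>
    compact_metrizable_group X \<and>
    (\<forall>n. \<alpha> n ` X \<subseteq> X \<and> continuous_on X (\<alpha> n) \<and>
         (\<forall>x\<in>X. \<forall>y\<in>X. \<alpha> n (x + y) = \<alpha> n x + \<alpha> n y)) \<and>
    (\<forall>x\<in>X. \<alpha> 0 x = x) \<and>
    (\<forall>m n. \<forall>x\<in>X. \<alpha> (m + n) x = \<alpha> m (\<alpha> n x))"

definition normalized_haar ::
    "'a::{ab_group_add, topological_space} set \<Rightarrow> 'a measure \<Rightarrow> bool"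
  where "normalized_haar X \<mu> \<longleftrightarrow>
    prob_space \<mu> \<and> space \<mu> = X \<and> sets \<mu> = sets (restrict_space borel X) \<and>
    (\<forall>x\<in>X. \<forall>A\<in>sets \<mu>. emeasure \<mu> ((+) x ` A) = emeasure \<mu> A)"

definition supnorm :: "int ^ 'd::finite \<Rightarrow> int"
  where "supnorm n = Max (range (\<lambda>j. \<bar>n $ j\<bar>))"

definition index_box :: "nat \<Rightarrow> (int ^ 'd::finite) set"
  where "index_box R = {n. supnorm n \<le> int R}"

definition exponentially_recurrent ::
    "'a::{ab_group_add, topological_space} set \<Rightarrow> (int ^ 'd::finite \<Rightarrow> 'a \<Rightarrow> 'a) \<Rightarrow>
     'a measure \<Rightarrow> bool"
  where "exponentially_recurrent X \<alpha> \<mu> \<longleftrightarrow>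
    algebraic_action X \<alpha> \<and> normalized_haar X \<mu> \<and>
    (\<forall>K. closedin (top_of_set X) K \<and> K \<noteq> X \<longrightarrow>
      (\<exists>c \<theta> :: real. c > 0 \<and> 0 < \<theta> \<and> \<theta> < 1 \<and>
        (\<forall>R\<ge>1. measure \<mu> (\<Inter>n\<in>index_box R. \<alpha> n ` K) \<le> c * \<theta> ^ card (index_box R :: (int ^ 'd) set))))"

section \<open>Principal algebraic actions\<close>

definition shift :: "int ^ 'd \<Rightarrow> (int ^ 'd \<Rightarrow> add_circle) \<Rightarrow> (int ^ 'd::finite \<Rightarrow> add_circle)"
  where "shift m t = (\<lambda>n. t (n + m))"

definition principal_group :: "'d::finite laurent \<Rightarrow> (int ^ 'd \<Rightarrow> add_circle) set"
  where "principal_group f = {t. \<forall>m. (\<Sum>n\<in>Poly_Mapping.keys f. zmult (Poly_Mapping.lookup f n) (t (m + n))) = 0}"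

definition principal_action ::
    "'d::finite laurent \<Rightarrow> int ^ 'd \<Rightarrow> (int ^ 'd \<Rightarrow> add_circle) \<Rightarrow> (int ^ 'd \<Rightarrow> add_circle)"
  where "principal_action f m = restrict (shift m) (principal_group f)"

section \<open>The principal action is an algebraic action\<close>

lemma continuous_to_circle: "continuous_on UNIV to_circle"
  by (simp add: continuous_on_open_vimage open_add_circle_def)

lemma surj_to_circle: "range to_circle = UNIV"
  by (metis Quotient3_abs_rep[OF Quotient3_add_circle] surjI)

lemma circle_exp_to_circle: "circle_exp (to_circle t) = cis (2 * pi * t)"
  by (rule circle_exp.abs_eq)

lemma continuous_circle_exp: "continuous_on UNIV circle_exp"
proof -
  have "open (circle_exp -` U)" if "open U" for U
  proof -
    have "to_circle -` (circle_exp -` U) = (\<lambda>t. cis (2 * pi * t)) -` U"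
      by (auto simp: circle_exp_to_circle)
    moreover have "open ((\<lambda>t::real. cis (2 * pi * t)) -` U)"
      by (rule open_vimage[OF that]) (intro continuous_intros)
    ultimately show ?thesis by (simp add: open_add_circle_def)
  qed
  then show ?thesis by (simp add: continuous_on_open_vimage)
qed

lemma inj_circle_exp: "inj circle_exp"
proof (rule injI, transfer)
  fix x y :: real
  assume "cis (2 * pi * x) = cis (2 * pi * y)"
  then have "cis (2 * pi * (x - y)) = 1"
    by (simp add: right_diff_distrib cis_divide[symmetric])
  then have "cos (2 * pi * (x - y)) = 1"
    by (metis cis.simps(1) one_complex.simps(1))
  then obtain n :: int where "2 * pi * (x - y) = of_int n * 2 * pi"
    using cos_one_2pi_int by blast
  then have "(2 * pi) * (x - y) = (2 * pi) * of_int n" by (simp add: mult_ac)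
  then have "x - y = of_int n" by simp
  then show "x - y \<in> \<int>" by simp
qed

lemma compact_circle: "compact (UNIV :: add_circle set)"
proof -
  have "to_circle x \<in> to_circle ` {0..1}" for x
  proof -
    have "to_circle x = to_circle (frac x)"
      by (simp add: add_circle.abs_eq_iff frac_def)
    then show ?thesis
      by (metis atLeastAtMost_iff frac_ge_0 frac_lt_1 imageI less_le)
  qed
  then have "range to_circle \<subseteq> to_circle ` {0..1}"
    by blast
  then have "UNIV = to_circle ` {0..1}"
    unfolding surj_to_circle by blast
  moreover have "compact (to_circle ` {0..1})"
    by (intro compact_continuous_image continuous_on_subset[OF continuous_to_circle]) auto
  ultimately show ?thesis by simp
qed

lemma circle_homeo: obtains g where "homeomorphism UNIV (range circle_exp) circle_exp g"
  using homeomorphism_compact[OF compact_circle continuous_circle_exp refl inj_circle_exp] by blast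

lemma metrizable_circle: "metrizable_space (euclidean :: add_circle topology)"
proof -
  obtain g where "homeomorphism UNIV (range circle_exp) circle_exp g"
    by (rule circle_homeo)
  then have "homeomorphic_maps euclidean (top_of_set (range circle_exp)) circle_exp g"
    by (auto simp: homeomorphic_maps_def homeomorphism_def continuous_map_in_subtopology)
  then have "(euclidean :: add_circle topology) homeomorphic_space top_of_set (range circle_exp)"
    unfolding homeomorphic_space_def by blast
  then show ?thesis
    using homeomorphic_metrizable_space metrizable_space_subtopology[OF metrizable_space_euclidean]
    by blast
qed

lemma circle_exp_add: "circle_exp (x + y) = circle_exp x * circle_exp y"
  by transfer (simp add: cis_mult distrib_left)

lemma circle_exp_minus: "circle_exp (- x) = cnj (circle_exp x)"
  by transfer (simp add: cis_cnj)

lemma continuous_circleI: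
  assumes "continuous_on S (\<lambda>x. circle_exp (f x))"
  shows "continuous_on S f"
proof -
  obtain g where g: "homeomorphism UNIV (range circle_exp) circle_exp g"
    by (rule circle_homeo)
  have inv: "g (circle_exp y) = y" for y
    using homeomorphism_apply1[OF g, of y] by simp
  have "continuous_on S (\<lambda>x. g (circle_exp (f x)))"
    by (rule continuous_on_compose2[OF homeomorphism_cont2[OF g] assms]) blast
  then show ?thesis
    unfolding inv .
qed

lemma continuous_circle_comp:
  assumes "continuous_on S f"
  shows "continuous_on S (\<lambda>x. circle_exp (f x))"
  by (rule continuous_on_compose2[OF continuous_circle_exp assms subset_UNIV])

lemma continuous_circle_add:
  fixes f g :: "'a::topological_space \<Rightarrow> add_circle"
  assumes "continuous_on S f" "continuous_on S g"
  shows "continuous_on S (\<lambda>x. f x + g x)"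
  by (rule continuous_circleI, unfold circle_exp_add)
    (rule continuous_on_mult[OF assms[THEN continuous_circle_comp]])

lemma continuous_circle_minus:
  fixes f :: "'a::topological_space \<Rightarrow> add_circle"
  assumes "continuous_on S f"
  shows "continuous_on S (\<lambda>x. - f x)"
  by (rule continuous_circleI, unfold circle_exp_minus)
    (rule continuous_on_cnj[OF assms[THEN continuous_circle_comp]])

lemma circle_exp_zmult: "circle_exp (zmult k x) = circle_exp x powi k"
  by transfer (simp add: cis_power_int mult.left_commute)

lemma circle_exp_0: "circle_exp 0 = 1"
  by transfer simp

lemma circle_exp_sum: "circle_exp (\<Sum>x\<in>A. f x) = (\<Prod>x\<in>A. circle_exp (f x))"
  by (induction A rule: infinite_finite_induct)
     (simp_all add: circle_exp_add circle_exp_0)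

lemma circle_exp_nz: "circle_exp x \<noteq> 0" by transfer simp

lemma circle_exp_eq_1: "circle_exp x = 1 \<longleftrightarrow> x = 0"
  using inj_eq[OF inj_circle_exp, of x 0] circle_exp_sum[of id "{}"] by simp

lemma zmult_add: "zmult k (x + y) = zmult k x + zmult k y"
  by transfer (simp add: distrib_left)

lemma zmult_minus: "zmult k (- x) = - zmult k x"
  by transfer simp

lemma zmult_0: "zmult k 0 = 0"
  by transfer simp

lemma closed_principal_group: "closed (principal_group f)"
proof -
  have eq: "principal_group f = (\<Inter>m. {t. (\<Prod>n\<in>Poly_Mapping.keys f. circle_exp (t (m + n)) powi Poly_Mapping.lookup f n) = 1})"
    by (auto simp: principal_group_def circle_exp_eq_1[symmetric] circle_exp_sum circle_exp_zmult)
  show ?thesis unfolding eq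
    by (intro closed_INT ballI closed_Collect_eq continuous_intros continuous_on_prod continuous_on_power_int
       continuous_circle_comp continuous_on_product_coordinates) (auto simp: circle_exp_nz)
qed

lemma compact_principal_group: "compact (principal_group f)"
proof -
  have "compact (UNIV :: (int ^ 'a \<Rightarrow> add_circle) set)"
    using compact_space_product_topology[of "\<lambda>_. euclidean :: add_circle topology" "UNIV :: (int ^ 'a) set"]
      compact_circle
    unfolding euclidean_product_topology by (simp add: compact_space_def)
  then show ?thesis
    using compact_Int_closed[OF _ closed_principal_group[of f], of UNIV] by simp
qed

lemma metrizable_seq: "metrizable_space (euclidean :: (int ^ 'd::finite \<Rightarrow> add_circle) topology)"
  unfolding euclidean_product_topology[symmetric]
  by (auto simp: metrizable_space_product_topology metrizable_circle)

lemma algebraic_action_principal: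
  "algebraic_action (principal_group f) (principal_action f)"
proof -
  let ?X = "principal_group f"
  have sh: "shift m t \<in> ?X" if t: "t \<in> ?X" for m t
  proof -
    have "(\<Sum>n\<in>Poly_Mapping.keys f. zmult (Poly_Mapping.lookup f n) (t ((k + m) + n))) = 0" for k
      using t unfolding principal_group_def by blast
    moreover have "(k + m) + n = (k + n) + m" for k n
      by (simp add: add_ac)
    ultimately show ?thesis
      unfolding principal_group_def shift_def by simp
  qed
  have act: "principal_action f m t = shift m t" if "t \<in> ?X" for m t
    using that by (simp add: principal_action_def)
  have zero: "0 \<in> ?X"
    by (simp add: principal_group_def zmult_0)
  have plus: "x + y \<in> ?X" if "x \<in> ?X" "y \<in> ?X" for x y
    using that by (simp add: principal_group_def zmult_add sum.distrib)
  have minus: "- x \<in> ?X" if "x \<in> ?X" for x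
    using that by (simp add: principal_group_def zmult_minus sum_negf)
  have coord: "continuous_on S (\<lambda>x. h x n)" if "continuous_on S h"
    for S :: "'b::topological_space set" and h :: "'b \<Rightarrow> int ^ 'a \<Rightarrow> add_circle" and n
    by (rule continuous_on_product_then_coordinatewise[OF that])
  have "continuous_on (?X \<times> ?X) (\<lambda>z. fst z + snd z)"
  proof (rule continuous_on_coordinatewise_then_product)
    show "continuous_on (?X \<times> ?X) (\<lambda>z. (fst z + snd z) n)" for n
      unfolding plus_fun_def
      by (rule continuous_circle_add[OF coord[OF continuous_on_fst[OF continuous_on_id]]
            coord[OF continuous_on_snd[OF continuous_on_id]]])
  qed
  then have cplus: "continuous_on (?X \<times> ?X) (\<lambda>(x, y). x + y)"
    unfolding case_prod_beta .
  have cminus: "continuous_on ?X uminus"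
  proof (rule continuous_on_coordinatewise_then_product)
    show "continuous_on ?X (\<lambda>x. (- x) n)" for n
      unfolding fun_Compl_def by (rule continuous_circle_minus[OF coord[OF continuous_on_id]])
  qed
  have group: "compact_metrizable_group ?X"
    unfolding compact_metrizable_group_def
    by (intro conjI ballI zero plus minus cplus cminus compact_principal_group
        metrizable_space_subtopology[OF metrizable_seq])
  have "continuous_on ?X (shift m)" for m
    unfolding shift_def
    by (rule continuous_on_coordinatewise_then_product, rule coord[OF continuous_on_id])
  then have cont: "continuous_on ?X (principal_action f m)" for m
    by (subst continuous_on_cong[OF refl act])
  have hom: "principal_action f m (x + y) = principal_action f m x + principal_action f m y"
    if "x \<in> ?X" "y \<in> ?X" for m x y
    by (simp add: act that plus) (simp add: shift_def plus_fun_def)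
  have id: "principal_action f 0 x = x" if "x \<in> ?X" for x
    by (simp add: act that shift_def)
  have comp: "principal_action f (m + n) x = principal_action f m (principal_action f n x)"
    if "x \<in> ?X" for m n x
    by (simp add: act sh that) (simp add: shift_def add_ac)
  have "principal_action f m ` ?X \<subseteq> ?X" for m
    by (rule image_subsetI) (simp add: act sh)
  then show ?thesis
    unfolding algebraic_action_def by (intro conjI allI ballI group cont hom id comp)
qed

end

theory Submission
  imports Defs
begin

text \<open>
  There is a Laurent polynomial \<open>g\<close>, not divisible by \<open>f\<close>, with \<open>\<bar>g\<bar>\<^sup>2 \<le> C \<bar>f\<bar>\<close> on the torus. If
  \<open>f\<close> has no zero there, then \<open>g = 1\<close> works. If \<open>f\<close> does not divide its adjoint \<open>f\<^sup>*\<close>, then \<open>g = f\<^sup>*\<close> works, since \<open>\<bar>f\<^sup>*\<bar> = \<bar>f\<bar>\<close>. Otherwise \<open>f\<close> is,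
  up to a monomial, real on the torus; since its zero set has codimension at least two, it does not
  change sign, so \<open>\<bar>\<partial>\<^sub>j f\<bar>\<^sup>2 \<le> C \<bar>f\<bar>\<close>, and some \<open>\<partial>\<^sub>j f\<close> is not divisible by \<open>f\<close>.

  For large \<open>q\<close> the quotient \<open>w = g\<^sup>q/f\<close> has absolutely summable Fourier coefficients, and every
  integer configuration \<open>v\<close> of finite support gives a point \<open>w \<cdot> v\<close> modulo \<open>1\<close> of \<open>X\<^sub>f\<close> that decays
  summably. As \<open>f\<close> is prime, \<open>g\<^sup>q\<close> acts surjectively on \<open>X\<^sub>f\<close>, which makes these points dense. Hence
  finitely many local perturbations suffice to move any point of \<open>X\<^sub>f\<close> into the complement of \<open>K\<close>.
  Applying them independently along a sparse lattice in \<open>B\<^sub>R\<close> and averaging over all choices, the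
  invariance of Haar measure bounds the measure in question by \<open>(1 - 1/N)\<close> to a power proportional
  to \<open>\<bar>B\<^sub>R\<bar>\<close>.
\<close>

text \<open>When \<open>f\<close> has zeros on the torus, \<open>1/f\<close> has no absolutely
  summable Fourier expansion, and a power \<open>G\<close> of \<open>g\<close> is needed to tame it.
  The price is that \<open>w\<close> applied to the integer configurations in question yields only
  points of the form \<open>G\<close> times a point of the group, so nothing is gained unless
  \<open>G\<close> maps the group onto itself; this is why \<open>f\<close> must not divide
  \<open>G\<close>. Irreducibility has to be upgraded here: primality carries non-divisibility from
  \<open>g\<close> to its powers, and it makes a homomorphism on the ideal generated by
  \<open>f\<close> and \<open>G\<close> well defined. Factorization into primes is proved for that
  purpose, one variable at a time. The entries of these configurations are bounded by the sum of the
  absolute coefficients of \<open>f\<close>, because real lifts of circle elements can be chosen in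
  the unit interval. Hence one finite alphabet on one finite box serves all points of the group, and
  the resulting rate does not depend on the point. Absolute summability of \<open>w\<close> makes
  the joint effect of all other lattice points small, no matter how many there are.\<close>

abbreviation (input) keys where "keys \<equiv> Poly_Mapping.keys"
abbreviation (input) lookup where "lookup \<equiv> Poly_Mapping.lookup"
abbreviation (input) single where "single \<equiv> Poly_Mapping.single"

section \<open>Coefficients of products in the group ring\<close>

lemma lookup_times:
  fixes a b :: "'a::ab_group_add \<Rightarrow>\<^sub>0 'b::comm_ring_1"
  shows "lookup (a * b) n =
    (\<Sum>k\<in>keys a. lookup a k * lookup b (n - k))"
proof -
  have "(\<Sum>q. lookup b q when n = l + q) = lookup b (n - l)" for l
  proof -
    have "n = l + q \<longleftrightarrow> q = n - l" for q by (auto simp: algebra_simps)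
    then show ?thesis by simp
  qed
  then have "lookup (a * b) n =
      (\<Sum>l. lookup a l * lookup b (n - l))"
    by (simp add: lookup_mult)
  also have "\<dots> = (\<Sum>k\<in>keys a. lookup a k * lookup b (n - k))"
    by (rule Sum_any.expand_superset) (auto simp: in_keys_iff)
  finally show ?thesis .
qed

lemma lookup_single_times:
  fixes b :: "'a::ab_group_add \<Rightarrow>\<^sub>0 'b::comm_ring_1"
  shows "lookup (single m c * b) n = c * lookup b (n - m)"
  by (cases "c = 0") (simp_all add: lookup_times)

lemma single_inverse:
  "single m 1 * single (- m) 1 = (1 :: 'a::ab_group_add \<Rightarrow>\<^sub>0 'b::comm_ring_1)"
  by (simp only: mult_single add.right_inverse mult_1 single_one)

section \<open>Leading terms of Laurent polynomials\<close>

text \<open>Avoiding finitely many hyperplanes amounts to avoiding the roots of finitely many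
  polynomials, by choosing the coefficient vector on the moment curve.\<close>

lemma separating_functional:
  fixes E :: "(int ^ 'd::finite) set"
  assumes "finite E"
  obtains c :: "int ^ 'd" where "inj_on (\<lambda>n. \<Sum>i\<in>UNIV. c $ i * n $ i) E"
proof -
  obtain \<iota> :: "'d \<Rightarrow> nat" where \<iota>: "inj \<iota>"
    using finite_imp_inj_to_nat_seg[of "UNIV :: 'd set"] by auto
  define p where "p = (\<lambda>n :: int ^ 'd. \<Sum>i\<in>UNIV. monom (n $ i) (\<iota> i))"
  have p: "p n \<noteq> 0" if n0: "n \<noteq> 0" for n
  proof -
    obtain i where i: "n $ i \<noteq> 0" using n0 by (metis vec_eq_iff zero_index)
    have "coeff (p n) (\<iota> i) = (\<Sum>k\<in>UNIV. if k = i then n $ i else 0)"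
      unfolding p_def coeff_sum using \<iota> by (intro sum.cong) (auto simp: inj_eq)
    also have "\<dots> = n $ i" by simp
    finally show ?thesis using i by (metis coeff_0)
  qed
  define D where "D = (\<lambda>(m, n). m - n) ` (E \<times> E) - {0}"
  have fD: "finite D" unfolding D_def using assms by simp
  define P where "P = (\<Prod>n\<in>D. p n)"
  have "P \<noteq> 0" unfolding P_def using fD p by (auto simp: D_def)
  then have "finite {x. poly P x = 0}" by (rule poly_roots_finite)
  then obtain B where B: "poly P B \<noteq> 0"
    by (metis (mono_tags, lifting) UNIV_eq_I infinite_UNIV_int mem_Collect_eq)
  have nz: "poly (p n) B \<noteq> 0" if "n \<in> D" for n
    using B fD that unfolding P_def by (auto simp: poly_prod prod_zero_iff)
  have pv: "poly (p n) B = (\<Sum>i\<in>UNIV. B ^ \<iota> i * n $ i)" for n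
    unfolding p_def by (simp add: poly_sum poly_monom mult.commute)
  have "inj_on (\<lambda>n. \<Sum>i\<in>UNIV. (\<chi> i. B ^ \<iota> i) $ i * n $ i) E"
  proof (rule inj_onI, rule ccontr)
    fix m n assume mn: "m \<in> E" "n \<in> E" "m \<noteq> n"
      "(\<Sum>i\<in>UNIV. (\<chi> i. B ^ \<iota> i) $ i * m $ i) = (\<Sum>i\<in>UNIV. (\<chi> i. B ^ \<iota> i) $ i * n $ i)"
    then have "m - n \<in> D" unfolding D_def by auto
    from nz[OF this] mn(4) show False
      unfolding pv by (simp add: right_diff_distrib sum_subtractf)
  qed
  then show ?thesis by (rule that)
qed

text \<open>The factor \<open>2 * B + 1\<close> exceeds every difference of values of
  \<open>w\<close> on \<open>E\<close>. Thus \<open>u\<close> decides, and \<open>w\<close> only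
  breaks ties.\<close>

lemma separating_functional_refining:
  fixes E :: "(int ^ 'd::finite) set" and u :: "int ^ 'd \<Rightarrow> int"
  assumes "finite E" and u: "\<And>m n. u (m + n) = u m + u n"
  obtains v :: "int ^ 'd \<Rightarrow> int" where "\<And>m n. v (m + n) = v m + v n" "inj_on v E"
    "\<And>m n. m \<in> E \<Longrightarrow> n \<in> E \<Longrightarrow> v m \<le> v n \<Longrightarrow> u m \<le> u n"
proof -
  obtain c :: "int ^ 'd" where c: "inj_on (\<lambda>n. \<Sum>i\<in>UNIV. c $ i * n $ i) E"
    using separating_functional[OF assms(1)] .
  define w where "w = (\<lambda>n. \<Sum>i\<in>UNIV. c $ i * n $ i)"
  define B where "B = (\<Sum>n\<in>E. \<bar>w n\<bar>)"
  have wB: "\<bar>w n\<bar> \<le> B" if "n \<in> E" for n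
    unfolding B_def using member_le_sum[of n E "\<lambda>n. \<bar>w n\<bar>"] that assms(1) by auto
  define v where "v = (\<lambda>n. (2 * B + 1) * u n + w n)"
  have le: "u m \<le> u n" if "m \<in> E" "n \<in> E" "v m \<le> v n" for m n
  proof (rule ccontr)
    assume "\<not> u m \<le> u n"
    then have "u n + 1 \<le> u m" by simp
    moreover have "0 \<le> B" unfolding B_def by (simp add: sum_nonneg)
    ultimately have "(2 * B + 1) * (u n + 1) \<le> (2 * B + 1) * u m"
      by (intro mult_left_mono) auto
    with that(3) wB[OF that(1)] wB[OF that(2)] show False
      unfolding v_def by (simp add: algebra_simps)
  qed
  have "inj_on v E"
  proof (rule inj_onI)
    fix m n assume mn: "m \<in> E" "n \<in> E" "v m = v n"
    then have "u m = u n" using le[of m n] le[of n m] by simp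
    with mn show "m = n" using c unfolding v_def w_def by (auto dest: inj_onD)
  qed
  moreover have "v (m + n) = v m + v n" for m n
    unfolding v_def w_def u by (simp add: algebra_simps sum.distrib)
  ultimately show ?thesis using that le by blast
qed

lemma maximizer:
  fixes v :: "'a \<Rightarrow> int"
  assumes "finite A" "A \<noteq> {}"
  obtains m where "m \<in> A" "\<And>n. n \<in> A \<Longrightarrow> v n \<le> v m"
proof -
  have "Max (v ` A) \<in> v ` A" using assms by (intro Max_in) auto
  then obtain m where "m \<in> A" "Max (v ` A) = v m" by auto
  then show ?thesis using that assms by (metis Max_ge finite_imageI imageI)
qed

text \<open>Every additive functional is refined by one that has a unique maximum on both supports, so
  that the product of the two extreme terms cannot cancel.\<close>

lemma leading_term:
  fixes a b :: "'d::finite laurent" and u :: "int ^ 'd \<Rightarrow> int"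
  assumes "a \<noteq> 0" "b \<noteq> 0" and u: "\<And>m n. u (m + n) = u m + u n"
  obtains m n where "m \<in> keys a" "n \<in> keys b"
    "\<And>k. k \<in> keys a \<Longrightarrow> u k \<le> u m" "\<And>k. k \<in> keys b \<Longrightarrow> u k \<le> u n"
    "m + n \<in> keys (a * b)"
proof -
  let ?E = "keys a \<union> keys b"
  have "finite ?E" by simp
  obtain v :: "int ^ 'd \<Rightarrow> int" where v: "\<And>m n. v (m + n) = v m + v n" "inj_on v ?E"
    "\<And>m n. m \<in> ?E \<Longrightarrow> n \<in> ?E \<Longrightarrow> v m \<le> v n \<Longrightarrow> u m \<le> u n"
    by (rule separating_functional_refining[OF \<open>finite ?E\<close> u]) blast
  obtain m where m: "m \<in> keys a" "\<And>n. n \<in> keys a \<Longrightarrow> v n \<le> v m"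
    using maximizer[of "keys a" v] assms(1) by auto
  obtain n where n: "n \<in> keys b" "\<And>k. k \<in> keys b \<Longrightarrow> v k \<le> v n"
    using maximizer[of "keys b" v] assms(2) by auto
  \<comment> \<open>Another pair of exponents with sum \<open>m + n\<close> would need
    \<open>v k \<ge> v m\<close>, against the uniqueness of the maximum of \<open>v\<close>.\<close>
  have "lookup b (m + n - k) = 0" if "k \<in> keys a" "k \<noteq> m" for k
  proof (rule ccontr)
    assume "lookup b (m + n - k) \<noteq> 0"
    then have "v (m + n - k) \<le> v n" using n by (simp add: in_keys_iff)
    moreover have "v (m + n) = v (m + n - k) + v k" using v(1)[of "m + n - k" k] by simp
    ultimately have "v m \<le> v k" by (simp add: v(1))
    then have "v m = v k" using m(2)[OF that(1)] by simp
    then show False using that m(1) v(2) by (auto dest: inj_onD)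
  qed
  then have "lookup (a * b) (m + n) =
      (\<Sum>k\<in>{m}. lookup a k * lookup b (m + n - k))"
    unfolding lookup_times using m(1) by (intro sum.mono_neutral_right) auto
  also have "\<dots> \<noteq> 0" using m(1) n(1) by (simp add: in_keys_iff)
  finally have "m + n \<in> keys (a * b)" by (simp add: in_keys_iff)
  moreover have "u k \<le> u m" if "k \<in> keys a" for k
    using v(3)[of k m] m that by auto
  moreover have "u k \<le> u n" if "k \<in> keys b" for k
    using v(3)[of k n] n that by auto
  ultimately show ?thesis using that m(1) n(1) by blast
qed

lemma laurent_mult_eq_0:
  fixes a b :: "'d::finite laurent"
  shows "a * b = 0 \<longleftrightarrow> a = 0 \<or> b = 0"
proof -
  have "a * b \<noteq> 0" if "a \<noteq> 0" "b \<noteq> 0"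
    using leading_term[OF that, of "\<lambda>_. 0"] by (metis add_0 empty_iff keys_zero)
  then show ?thesis by auto
qed

lemma laurent_cancel:
  fixes a b c :: "'d::finite laurent"
  assumes "c \<noteq> 0" "c * a = c * b"
  shows "a = b"
proof -
  have "c * (a - b) = 0" using assms(2) by (simp add: algebra_simps)
  then show ?thesis using assms(1) by (simp add: laurent_mult_eq_0)
qed

section \<open>Laurent polynomials in some of the variables\<close>

definition exponents_in :: "'d set \<Rightarrow> (int ^ 'd::finite) set"
  where "exponents_in T = {n. \<forall>j. j \<notin> T \<longrightarrow> n $ j = 0}"

definition laurent_in :: "'d set \<Rightarrow> 'd::finite laurent set"
  where "laurent_in T = {e. keys e \<subseteq> exponents_in T}"

text \<open>The canonical representative of a coset of \<open>exponents_in T\<close>. The monomials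
  with these exponents form a basis of the whole ring over the subring
  \<open>laurent_in T\<close>.\<close>

definition drop_coords :: "'d set \<Rightarrow> int ^ 'd \<Rightarrow> int ^ 'd::finite"
  where "drop_coords T n = (\<chi> j. if j \<in> T then 0 else n $ j)"

text \<open>The coefficient of \<open>x\<^sup>\<mu>\<close> when the variables outside \<open>T\<close> are the indeterminates and
  those in \<open>T\<close> belong to the coefficient ring.\<close>

definition coeff_in :: "'d set \<Rightarrow> int ^ 'd \<Rightarrow> 'd::finite laurent \<Rightarrow> 'd laurent"
  where "coeff_in T \<mu> e =
    Abs_poly_mapping (\<lambda>n. if n \<in> exponents_in T then lookup e (n + \<mu>) else 0)"

lemma lookup_coeff_in:
  "lookup (coeff_in T \<mu> e) n =
    (if n \<in> exponents_in T then lookup e (n + \<mu>) else 0)"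
proof -
  have "{n. (if n \<in> exponents_in T then lookup e (n + \<mu>) else 0) \<noteq> 0}
      \<subseteq> (\<lambda>n. n - \<mu>) ` keys e"
    by (auto simp: in_keys_iff image_iff split: if_splits intro!: bexI[of _ "_ + \<mu>"])
  then have "finite {n. (if n \<in> exponents_in T then lookup e (n + \<mu>) else 0) \<noteq> 0}"
    by (rule finite_subset) simp
  then show ?thesis unfolding coeff_in_def by simp
qed

lemma coeff_in_laurent_in: "coeff_in T \<mu> e \<in> laurent_in T"
  by (auto simp: laurent_in_def in_keys_iff lookup_coeff_in split: if_splits)

lemma exponents_in_diff: "k \<in> exponents_in T \<Longrightarrow> n - k \<in> exponents_in T \<longleftrightarrow> n \<in> exponents_in T"
  by (auto simp: exponents_in_def)

lemma coeff_in_0: "coeff_in T \<mu> 0 = 0"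
  by (rule poly_mapping_eqI) (simp add: lookup_coeff_in)

lemma coeff_in_add: "coeff_in T \<mu> (a + b) = coeff_in T \<mu> a + coeff_in T \<mu> b"
  by (rule poly_mapping_eqI) (simp add: lookup_coeff_in lookup_add)

lemma coeff_in_minus: "coeff_in T \<mu> (a - b) = coeff_in T \<mu> a - coeff_in T \<mu> b"
  by (rule poly_mapping_eqI) (simp add: lookup_coeff_in lookup_minus)

lemma coeff_in_sum: "coeff_in T \<mu> (\<Sum>i\<in>I. a i) = (\<Sum>i\<in>I. coeff_in T \<mu> (a i))"
  by (induction I rule: infinite_finite_induct) (simp_all add: coeff_in_0 coeff_in_add)

lemma coeff_in_times:
  assumes "p \<in> laurent_in T"
  shows "coeff_in T \<mu> (p * e) = p * coeff_in T \<mu> e"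
proof (rule poly_mapping_eqI)
  fix n
  have "n - k \<in> exponents_in T \<longleftrightarrow> n \<in> exponents_in T" if "k \<in> keys p" for k
    using assms that by (intro exponents_in_diff) (auto simp: laurent_in_def)
  then show "lookup (coeff_in T \<mu> (p * e)) n = lookup (p * coeff_in T \<mu> e) n"
    by (auto simp: lookup_coeff_in lookup_times diff_add_eq intro!: sum.neutral)
qed

lemma coeff_in_single_times:
  "coeff_in T \<mu> (single \<nu> 1 * e) = coeff_in T (\<mu> - \<nu>) e"
  by (rule poly_mapping_eqI) (simp add: lookup_coeff_in lookup_single_times add_diff_eq)

lemma coeff_in_nonzeroD:
  assumes "coeff_in T \<mu> e \<noteq> 0" "drop_coords T \<mu> = \<mu>"
  shows "\<mu> \<in> drop_coords T ` keys e"
proof -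
  obtain n where n: "n \<in> exponents_in T" "lookup e (n + \<mu>) \<noteq> 0"
    using assms(1) by (metis lookup_coeff_in lookup_zero poly_mapping_eqI)
  have "drop_coords T (n + \<mu>) = \<mu>"
    using n(1) assms(2) by (auto simp: drop_coords_def exponents_in_def vec_eq_iff split: if_splits)
  then show ?thesis using n(2) by (metis image_eqI in_keys_iff)
qed

lemma coeff_in_decomposition:
  "e = (\<Sum>\<mu>\<in>drop_coords T ` keys e. single \<mu> 1 * coeff_in T \<mu> e)"
proof (rule poly_mapping_eqI)
  fix n
  have *: "n - \<mu> \<in> exponents_in T \<longleftrightarrow> \<mu> = drop_coords T n" if "\<mu> \<in> drop_coords T ` keys e" for \<mu>
    using that by (auto simp: exponents_in_def drop_coords_def vec_eq_iff)
  have "(\<Sum>\<mu>\<in>drop_coords T ` keys e.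
      lookup (single \<mu> 1 * coeff_in T \<mu> e) n) =
    (\<Sum>\<mu>\<in>drop_coords T ` keys e. if \<mu> = drop_coords T n then lookup e n else 0)"
    by (intro sum.cong) (simp_all add: lookup_single_times lookup_coeff_in *)
  also have "\<dots> = lookup e n"
    by (auto simp: sum.delta not_in_keys_iff_lookup_eq_zero image_iff)
  finally show "lookup e n = lookup
      (\<Sum>\<mu>\<in>drop_coords T ` keys e. single \<mu> 1 * coeff_in T \<mu> e) n"
    by (simp add: lookup_sum)
qed

lemma coeff_in_mult:
  "coeff_in T \<mu> (a * b) =
    (\<Sum>\<nu>\<in>drop_coords T ` keys a. coeff_in T \<nu> a * coeff_in T (\<mu> - \<nu>) b)"
proof -
  have "a * b = (\<Sum>\<nu>\<in>drop_coords T ` keys a.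
      coeff_in T \<nu> a * (single \<nu> 1 * b))"
    by (subst coeff_in_decomposition[of a T]) (simp add: sum_distrib_right mult.assoc mult.left_commute)
  then show ?thesis
    by (simp add: coeff_in_sum coeff_in_times[OF coeff_in_laurent_in] coeff_in_single_times)
qed

lemma dvd_iff_coeff_in:
  assumes "p \<in> laurent_in T"
  shows "p dvd e \<longleftrightarrow> (\<forall>\<mu>\<in>drop_coords T ` keys e. p dvd coeff_in T \<mu> e)"
proof
  assume "p dvd e"
  then show "\<forall>\<mu>\<in>drop_coords T ` keys e. p dvd coeff_in T \<mu> e"
    by (auto elim!: dvdE simp: coeff_in_times[OF assms])
next
  assume "\<forall>\<mu>\<in>drop_coords T ` keys e. p dvd coeff_in T \<mu> e"
  then show "p dvd e"
    by (subst coeff_in_decomposition[of e T]) (auto intro: dvd_sum)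
qed

text \<open>Gauss's argument: among the coefficients not divisible by \<open>p\<close>, take the
  extreme one of each factor with respect to a separating functional. In the corresponding
  coefficient of the product, every other summand is divisible by \<open>p\<close>, so the product
  of the two extreme coefficients would be divisible as well.\<close>

lemma prime_elem_in_extension:
  fixes p :: "'d::finite laurent"
  assumes p: "p \<in> laurent_in T" "p \<noteq> 0" "\<not> p dvd 1"
    and prime: "\<And>a b. a \<in> laurent_in T \<Longrightarrow> b \<in> laurent_in T \<Longrightarrow> p dvd a * b \<Longrightarrow> p dvd a \<or> p dvd b"
  shows "prime_elem p"
proof -
  have "p dvd a \<or> p dvd b" if ab: "p dvd a * b" for a b
  proof (rule ccontr)
    assume neg: "\<not> (p dvd a \<or> p dvd b)"
    define bad where "bad = (\<lambda>e. {\<mu>\<in>drop_coords T ` keys e. \<not> p dvd coeff_in T \<mu> e})"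
    have fin: "finite (bad e)" for e unfolding bad_def by simp
    have "bad e \<noteq> {}" if "\<not> p dvd e" for e
    proof -
      have "\<not> (\<forall>\<mu>\<in>drop_coords T ` keys e. p dvd coeff_in T \<mu> e)"
        using that dvd_iff_coeff_in[OF p(1), of e] by simp
      then show ?thesis unfolding bad_def by blast
    qed
    with neg have ne: "bad a \<noteq> {}" "bad b \<noteq> {}" by simp_all
    have drop: "drop_coords T \<mu> = \<mu>" if "\<mu> \<in> drop_coords T ` keys e" for \<mu> e
      using that by (auto simp: drop_coords_def vec_eq_iff)
    have fE: "finite (bad a \<union> bad b)" using fin by simp
    obtain v :: "int ^ 'd \<Rightarrow> int" where v: "\<And>m n. v (m + n) = v m + v n" "inj_on v (bad a \<union> bad b)"
      by (rule separating_functional_refining[OF fE, of "\<lambda>_. 0"]) auto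
    obtain m where m: "m \<in> bad a" "\<And>n. n \<in> bad a \<Longrightarrow> v n \<le> v m"
      using maximizer[OF fin ne(1)] by blast
    obtain n where n: "n \<in> bad b" "\<And>k. k \<in> bad b \<Longrightarrow> v k \<le> v n"
      using maximizer[OF fin ne(2)] by blast
    have mn: "drop_coords T m = m" "drop_coords T n = n"
      using m(1) n(1) drop unfolding bad_def by blast+
    let ?K = "drop_coords T ` keys a"
    \<comment> \<open>If neither factor is divisible by \<open>p\<close>, both indices are bad;
      maximality of \<open>m\<close> and \<open>n\<close> then forces \<open>v \<nu> = v m\<close>,
      hence \<open>\<nu> = m\<close>.\<close>
    have small: "p dvd coeff_in T \<nu> a * coeff_in T (m + n - \<nu>) b" if \<nu>: "\<nu> \<in> ?K - {m}" for \<nu>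
    proof (cases "p dvd coeff_in T \<nu> a \<or> p dvd coeff_in T (m + n - \<nu>) b")
      case False
      have "drop_coords T (m + n - \<nu>) = m + n - \<nu>"
        using mn drop[of \<nu> a] \<nu> by (auto simp: drop_coords_def vec_eq_iff split: if_splits)
      moreover have "coeff_in T (m + n - \<nu>) b \<noteq> 0" using False by auto
      ultimately have "m + n - \<nu> \<in> drop_coords T ` keys b"
        by (intro coeff_in_nonzeroD)
      then have "m + n - \<nu> \<in> bad b" "\<nu> \<in> bad a"
        using False \<nu> unfolding bad_def by blast+
      then have le: "v (m + n - \<nu>) \<le> v n" "v \<nu> \<le> v m" using m n by auto
      have "v (m + n) = v (m + n - \<nu>) + v \<nu>" using v(1)[of "m + n - \<nu>" \<nu>] by simp
      then have "v \<nu> = v m" using le by (simp add: v(1))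
      then show ?thesis using \<nu> \<open>\<nu> \<in> bad a\<close> m(1) v(2) by (auto dest: inj_onD)
    qed auto
    have mK: "m \<in> ?K" using m(1) unfolding bad_def by simp
    have "coeff_in T (m + n) (a * b) = coeff_in T m a * coeff_in T n b
        + (\<Sum>\<nu>\<in>?K - {m}. coeff_in T \<nu> a * coeff_in T (m + n - \<nu>) b)"
      unfolding coeff_in_mult using mK by (subst sum.remove[of _ m]) auto
    moreover have "p dvd coeff_in T (m + n) (a * b)"
      using ab by (auto elim!: dvdE simp: coeff_in_times[OF p(1)])
    moreover have "p dvd (\<Sum>\<nu>\<in>?K - {m}. coeff_in T \<nu> a * coeff_in T (m + n - \<nu>) b)"
      by (rule dvd_sum) (rule small)
    ultimately have "p dvd coeff_in T m a * coeff_in T n b" by (simp add: dvd_add_left_iff)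
    then show False
      using prime[OF coeff_in_laurent_in coeff_in_laurent_in] m(1) n(1) unfolding bad_def by blast
  qed
  then show ?thesis using p by (simp add: prime_elem_def)
qed

section \<open>Unique factorization\<close>

inductive prime_factorable :: "'d::finite laurent \<Rightarrow> bool" where
  unit: "u dvd 1 \<Longrightarrow> prime_factorable u"
| prime: "prime_elem p \<Longrightarrow> prime_factorable e \<Longrightarrow> prime_factorable (p * e)"

text \<open>Each prime factor of \<open>s\<close> divides \<open>q\<close> or \<open>h\<close> and
  is cancelled there; those taken from \<open>h\<close> make up \<open>s1\<close>. This turns the
  outcome \<open>s * f = q * h\<close> of a pseudo-division into a genuine factorization of
  \<open>f\<close>.\<close>

lemma prime_factorable_split:
  assumes "prime_factorable s" "s * f = q * h"
  shows "\<exists>q1 h1 s1. h = s1 * h1 \<and> f = q1 * h1 \<and> prime_factorable s1"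
  using assms
proof (induction arbitrary: q h rule: prime_factorable.induct)
  case (unit u)
  then obtain u' where u': "u * u' = 1" by (metis dvdE)
  have "f = (u * u') * f" unfolding u' by simp
  also have "\<dots> = u' * q * h" using unit(2) by (metis mult.assoc mult.commute)
  finally show ?case
    by (intro exI[of _ "u' * q"] exI[of _ h] exI[of _ 1]) (simp add: prime_factorable.unit)
next
  case (prime p s)
  have p0: "p \<noteq> 0" using prime(1) by (simp add: prime_elem_def)
  have "p dvd q * h" by (metis prime.prems dvd_triv_left mult.assoc)
  then consider "p dvd q" | "p dvd h" using prime(1) by (auto simp: prime_elem_def)
  then show ?case
  proof cases
    case 1
    then obtain q' where q: "q = p * q'" by (metis dvdE)
    have "p * (s * f) = p * (q' * h)" using prime.prems q by (simp add: mult.assoc)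
    then show ?thesis using prime.IH laurent_cancel[OF p0] by blast
  next
    case 2
    then obtain h' where h: "h = p * h'" by (metis dvdE)
    have "p * (s * f) = p * (q * h')" using prime.prems h by (simp add: mult.assoc mult.left_commute)
    then have "s * f = q * h'" by (rule laurent_cancel[OF p0])
    then obtain q1 h1 s1 where "h' = s1 * h1" "f = q1 * h1" "prime_factorable s1"
      using prime.IH by blast
    then show ?thesis
      using h prime(1) by (metis mult.assoc prime_factorable.prime)
  qed
qed

text \<open>The cofactor of \<open>p\<close> in \<open>f\<close> must be a unit, so \<open>f\<close>
  and \<open>p\<close> have the same multiples.\<close>

lemma irreducible_dvd_primeD:
  fixes f :: "'d::finite laurent"
  assumes "irreducible f" "prime_elem p" "p dvd f"
  shows "prime_elem f"
proof -
  obtain k where k: "f = p * k" using assms(3) by (auto elim: dvdE)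
  have "k dvd 1" using assms k by (auto simp: irreducible_def prime_elem_def)
  then obtain k' where "k * k' = 1" by (metis dvdE)
  then have "p = f * k'" using k by (metis mult.assoc mult_1_right)
  have "f dvd x \<longleftrightarrow> p dvd x" for x
    using k \<open>p = f * k'\<close> by (metis dvd_triv_left dvd_trans)
  then show ?thesis using assms(1,2) by (auto simp: prime_elem_def irreducible_def)
qed

text \<open>No prime factor of \<open>s\<close> can divide \<open>f\<close>, since \<open>f\<close>
  would then be associated to it and prime itself. So every prime factor divides the cofactor of
  \<open>f\<close> and cancels. The assumption that \<open>f\<close> is not prime suits the indirect
  proof in \<open>irreducible_imp_prime_step\<close>.\<close>

lemma irreducible_dvd_prime_factorable_times:
  assumes "prime_factorable s" "irreducible f" "\<not> prime_elem f" "f dvd s * a"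
  shows "f dvd a"
  using assms(1,4)
proof (induction rule: prime_factorable.induct)
  case (unit u)
  then obtain u' where u': "u * u' = 1" by (metis dvdE)
  have "f dvd u' * (u * a)" using unit(2) by simp
  also have "u' * (u * a) = a" using u' by (metis mult.assoc mult.commute mult_1_left)
  finally show ?case .
next
  case (prime p s)
  then obtain c where c: "p * s * a = f * c" by (auto elim: dvdE)
  then have "p dvd f * c" by (metis dvd_triv_left mult.assoc)
  moreover have "\<not> p dvd f" using irreducible_dvd_primeD assms prime(1) by blast
  ultimately have "p dvd c" using prime(1) by (auto simp: prime_elem_def)
  then obtain c' where c': "c = p * c'" by (auto elim: dvdE)
  have "p * (s * a) = p * (f * c')" using c c' by (simp add: mult.assoc mult.left_commute)
  moreover have "p \<noteq> 0" using prime(1) by (simp add: prime_elem_def)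
  ultimately have "s * a = f * c'" using laurent_cancel by blast
  then show ?case using prime.IH by simp
qed

section \<open>Subrings of Laurent polynomials in some variables, and division with respect to one
  further variable\<close>

lemma laurent_in_add: "a \<in> laurent_in T \<Longrightarrow> b \<in> laurent_in T \<Longrightarrow> a + b \<in> laurent_in T"
  using keys_add[of a b] by (auto simp: laurent_in_def)

lemma laurent_in_minus: "a \<in> laurent_in T \<Longrightarrow> b \<in> laurent_in T \<Longrightarrow> a - b \<in> laurent_in T"
  using keys_diff[of a b] by (auto simp: laurent_in_def)

lemma laurent_in_mult: "a \<in> laurent_in T \<Longrightarrow> b \<in> laurent_in T \<Longrightarrow> a * b \<in> laurent_in T"
  using keys_mult[of a b] by (fastforce simp: laurent_in_def exponents_in_def)

lemma laurent_in_single: "m \<in> exponents_in T \<Longrightarrow> single m c \<in> laurent_in T"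
  by (auto simp: laurent_in_def)

lemma laurent_in_1: "1 \<in> laurent_in T"
  by (simp add: laurent_in_def exponents_in_def flip: single_one)

lemma laurent_in_0: "0 \<in> laurent_in T"
  by (simp add: laurent_in_def)

lemma laurent_in_mono: "T \<subseteq> T' \<Longrightarrow> a \<in> laurent_in T \<Longrightarrow> a \<in> laurent_in T'"
  by (force simp: laurent_in_def exponents_in_def)

text \<open>The interval has \<open>k\<close> elements, so \<open>k = 0\<close> forces \<open>e = 0\<close>.\<close>

definition spread :: "'d::finite \<Rightarrow> int \<Rightarrow> nat \<Rightarrow> 'd laurent \<Rightarrow> bool"
  where "spread j a k e \<longleftrightarrow> (\<forall>n\<in>keys e. a \<le> n $ j \<and> n $ j < a + int k)"

lemma spread_exists: "\<exists>a k. spread j a k e"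
proof -
  let ?A = "(\<lambda>n. n $ j) ` keys e"
  have "spread j (Min (insert 0 ?A)) (nat (Max (insert 0 ?A) - Min (insert 0 ?A)) + 1) e"
    unfolding spread_def
  proof
    fix n assume "n \<in> keys e"
    then have "Min (insert 0 ?A) \<le> n $ j" "n $ j \<le> Max (insert 0 ?A)"
      by (intro Min_le Max_ge; simp)+
    then show "Min (insert 0 ?A) \<le> n $ j \<and>
        n $ j < Min (insert 0 ?A) + int (nat (Max (insert 0 ?A) - Min (insert 0 ?A)) + 1)" by simp
  qed
  then show ?thesis by blast
qed

lemma spread_diff: "spread j a k e \<Longrightarrow> spread j a k e' \<Longrightarrow> spread j a k (e - e')"
  using keys_diff[of e e'] by (auto simp: spread_def)

lemma spread_mult_const:
  assumes "s \<in> laurent_in T" "j \<notin> T" "spread j a k e"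
  shows "spread j a k (s * e)"
  unfolding spread_def
proof
  fix n assume "n \<in> keys (s * e)"
  then obtain m m' where "n = m + m'" "m \<in> keys s" "m' \<in> keys e"
    using keys_mult[of s e] by auto
  moreover have "m $ j = 0" using calculation assms by (auto simp: laurent_in_def exponents_in_def)
  ultimately show "a \<le> n $ j \<and> n $ j < a + int k" using assms(3) by (auto simp: spread_def)
qed

lemma spread_mult_single:
  assumes "spread j a k e"
  shows "spread j (a + m $ j) k (single m 1 * e)"
  unfolding spread_def
proof
  fix n assume "n \<in> keys (single m 1 * e)"
  then have "n - m \<in> keys e" by (simp add: in_keys_iff lookup_single_times)
  then show "a + m $ j \<le> n $ j \<and> n $ j < a + m $ j + int k" using assms by (auto simp: spread_def)
qed

lemma spread_mono: "spread j a k e \<Longrightarrow> a' \<le> a \<Longrightarrow> a + int k \<le> a' + int k' \<Longrightarrow> spread j a' k' e"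
  by (force simp: spread_def)

lemma spread_drop_top:
  assumes e: "e \<in> laurent_in (insert j T)" "j \<notin> T" "spread j a (Suc k) e"
    and top: "coeff_in T (axis j (a + int k)) e = 0"
  shows "spread j a k e"
  unfolding spread_def
proof
  fix n assume n: "n \<in> keys e"
  have "n $ j \<noteq> a + int k"
  proof
    assume nj: "n $ j = a + int k"
    have "n - axis j (a + int k) \<in> exponents_in T"
      using e(1) n nj by (auto simp: laurent_in_def exponents_in_def axis_def)
    then have "lookup e n = 0"
      using arg_cong[OF top, of "\<lambda>p. lookup p (n - axis j (a + int k))"]
      by (simp add: lookup_coeff_in)
    then show False using n by (simp add: in_keys_iff)
  qed
  then show "a \<le> n $ j \<and> n $ j < a + int k" using e(3) n by (force simp: spread_def)
qed

text \<open>The leading coefficient of \<open>h\<close> need not be invertible, so \<open>e\<close>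
  is multiplied by it before a multiple of \<open>h\<close> is subtracted to kill the top
  coefficient. The product of these multipliers is \<open>s\<close>, which does not involve the
  variable \<open>j\<close>.\<close>

lemma pseudo_division:
  assumes jT: "j \<notin> T" and h: "h \<in> laurent_in (insert j T)" "spread j b (Suc kh) h"
      "coeff_in T (axis j (b + int kh)) h \<noteq> 0"
  shows "e \<in> laurent_in (insert j T) \<Longrightarrow> spread j a k e \<Longrightarrow>
    \<exists>s q a'. s \<in> laurent_in T \<and> s \<noteq> 0 \<and> q \<in> laurent_in (insert j T) \<and> spread j a' kh (s * e - q * h)"
proof (induction k arbitrary: e)
  case 0
  then have "spread j a kh e" by (auto simp: spread_def)
  then show ?case
    by (intro exI[of _ 1] exI[of _ 0] exI[of _ a]) (simp add: laurent_in_1 laurent_in_0)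
next
  case (Suc k)
  show ?case
  proof (cases "Suc k \<le> kh")
    case True
    then have "spread j a kh e" using Suc.prems(2) by (rule_tac spread_mono) auto
    then show ?thesis
      by (intro exI[of _ 1] exI[of _ 0] exI[of _ a]) (simp add: laurent_in_1 laurent_in_0)
  next
    case False
    define lh where "lh = coeff_in T (axis j (b + int kh)) h"
    define le where "le = coeff_in T (axis j (a + int k)) e"
    \<comment> \<open>This monomial moves the top exponent \<open>b + int kh\<close> of
      \<open>h\<close> to the top exponent \<open>a + int k\<close> of \<open>e\<close>.\<close>
    define x :: "'a laurent" where "x = single (axis j (a + int k - b - int kh)) 1"
    have T: "lh \<in> laurent_in T" "le \<in> laurent_in T"
      unfolding lh_def le_def by (rule coeff_in_laurent_in)+
    have T': "lh \<in> laurent_in (insert j T)" "le \<in> laurent_in (insert j T)"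
      by (rule laurent_in_mono[of T]; auto simp: T)+
    have x: "x \<in> laurent_in (insert j T)"
      unfolding x_def by (rule laurent_in_single) (auto simp: exponents_in_def axis_def)
    define e' where "e' = lh * e - le * (x * h)"
    have in': "e' \<in> laurent_in (insert j T)"
      unfolding e'_def by (intro laurent_in_minus laurent_in_mult T' x h(1) Suc.prems(1))
    have "spread j (b + axis j (a + int k - b - int kh) $ j) (Suc kh) (x * h)"
      unfolding x_def by (rule spread_mult_single[OF h(2)])
    then have xh: "spread j a (Suc k) (x * h)"
      by (rule spread_mono) (use False in \<open>auto simp: axis_def\<close>)
    have "spread j a (Suc k) e'"
      unfolding e'_def
      by (rule spread_diff[OF spread_mult_const[OF T(1) jT Suc.prems(2)] spread_mult_const[OF T(2) jT xh]])
    moreover have "coeff_in T (axis j (a + int k)) e' = 0"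
    proof -
      have "axis j (a + int k) - axis j (a + int k - b - int kh) = (axis j (b + int kh) :: int ^ 'a)"
        by (auto simp: axis_def vec_eq_iff)
      then show ?thesis
        unfolding e'_def coeff_in_minus coeff_in_times[OF T(1)] coeff_in_times[OF T(2)] x_def
          coeff_in_single_times
        by (simp add: lh_def le_def mult.commute)
    qed
    ultimately have "spread j a k e'" using spread_drop_top[OF in' jT] by blast
    from Suc.IH[OF in' this] obtain s q a' where IH: "s \<in> laurent_in T" "s \<noteq> 0"
      "q \<in> laurent_in (insert j T)" "spread j a' kh (s * e' - q * h)" by blast
    have "s * e' - q * h = (s * lh) * e - (s * le * x + q) * h"
      unfolding e'_def by (simp add: algebra_simps)
    moreover have "s * lh \<noteq> 0" using IH(2) h(3) by (simp add: lh_def laurent_mult_eq_0)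
    moreover have "s \<in> laurent_in (insert j T)" by (rule laurent_in_mono[OF _ IH(1)]) auto
    ultimately show ?thesis
      using IH by (metis T(1) T'(2) x laurent_in_add laurent_in_mult)
  qed
qed

text \<open>Gauss's lemma: a nonzero element of minimal \<open>j\<close>-width in the ideal generated by \<open>f\<close> and
  \<open>a\<close> divides both of them up to factors not involving \<open>j\<close>.\<close>

lemma irreducible_imp_prime_step:
  assumes H: "\<And>e. e \<in> laurent_in T \<Longrightarrow> e \<noteq> 0 \<Longrightarrow> prime_factorable e"
    and jT: "j \<notin> T" and f: "f \<in> laurent_in (insert j T)" "irreducible f"
  shows "prime_elem f"
proof (rule ccontr)
  assume np: "\<not> prime_elem f"
  let ?B = "laurent_in (insert j T)"
  have f0: "f \<noteq> 0" "\<not> f dvd 1" using f(2) by (auto simp: irreducible_def)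
  have rel: "f dvd b" if ab: "a \<in> ?B" "b \<in> ?B" "f dvd a * b" "\<not> f dvd a" for a b
  proof -
    define I where "I = {u * f + v * a | u v. u \<in> ?B \<and> v \<in> ?B}"
    have IB: "I \<subseteq> ?B" unfolding I_def using f(1) ab(1) by (auto intro!: laurent_in_add laurent_in_mult)
    have fI: "f \<in> I" unfolding I_def
      by (rule CollectI) (rule exI[of _ 1], rule exI[of _ 0], simp add: laurent_in_0 laurent_in_1)
    have aI: "a \<in> I" unfolding I_def
      by (rule CollectI) (rule exI[of _ 0], rule exI[of _ 1], simp add: laurent_in_0 laurent_in_1)
    have closed: "s * e - q * e' \<in> I" if st: "e \<in> I" "e' \<in> I" "s \<in> ?B" "q \<in> ?B" for s q e e'
    proof -
      obtain u v u' v' where uv: "e = u * f + v * a" "e' = u' * f + v' * a" "u \<in> ?B" "v \<in> ?B" "u' \<in> ?B" "v' \<in> ?B"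
        using st unfolding I_def by blast
      have "s * e - q * e' = (s * u - q * u') * f + (s * v - q * v') * a"
        unfolding uv by (simp add: algebra_simps)
      moreover have "s * u - q * u' \<in> ?B" "s * v - q * v' \<in> ?B"
        by (intro laurent_in_minus laurent_in_mult uv st)+
      ultimately show ?thesis unfolding I_def by blast
    qed
    \<comment> \<open>An element \<open>h\<close> of least spread in \<open>I\<close> plays the role
      of a greatest common divisor of \<open>f\<close> and \<open>a\<close> over the fraction field
      of \<open>laurent_in T\<close>.\<close>
    define P where "P = (\<lambda>k. \<exists>h\<in>I. \<exists>b. h \<noteq> 0 \<and> spread j b k h)"
    have "\<exists>k. P k" using spread_exists[of j f] fI f0 unfolding P_def by blast
    then obtain k where k: "P k" "\<And>k'. k' < k \<Longrightarrow> \<not> P k'" by (metis LeastI not_less_Least)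
    then obtain h c where h: "h \<in> I" "h \<noteq> 0" "spread j c k h" unfolding P_def by blast
    have "k \<noteq> 0"
    proof
      assume "k = 0"
      then have "n \<notin> keys h" for n using h(3) by (auto simp: spread_def)
      then show False using h(2) by (metis all_not_in_conv keys_eq_empty)
    qed
    then obtain kh where kh: "k = Suc kh" by (cases k) auto
    have top: "coeff_in T (axis j (c + int kh)) h \<noteq> 0"
      using spread_drop_top[of h j T c kh] h IB k(2)[of kh] jT unfolding P_def kh by blast
    \<comment> \<open>The remainder of the pseudo-division by \<open>h\<close> lies in
      \<open>I\<close> and has smaller spread than \<open>h\<close>, so it vanishes.\<close>
    have div: "\<exists>s q. prime_factorable s \<and> s * e = q * h" if e: "e \<in> I" for e
    proof -
      obtain a' k' where "spread j a' k' e" using spread_exists[of j e] by blast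
      moreover have "e \<in> ?B" "h \<in> ?B" using e h IB by auto
      ultimately obtain s q a' where sq: "s \<in> laurent_in T" "s \<noteq> 0" "q \<in> ?B" "spread j a' kh (s * e - q * h)"
        using pseudo_division[OF jT _ h(3)[unfolded kh] top] by blast
      have "s \<in> ?B" by (rule laurent_in_mono[OF _ sq(1)]) auto
      then have "s * e - q * h \<in> I" using closed e h(1) sq(3) by blast
      then have "s * e - q * h = 0" using k(2)[of kh] sq(4) unfolding P_def kh by blast
      then show ?thesis using H[OF sq(1,2)] by auto
    qed
    obtain s q where sq: "prime_factorable s" "s * f = q * h" using div[OF fI] by blast
    obtain q1 h1 s1 where split: "h = s1 * h1" "f = q1 * h1" "prime_factorable s1"
      using prime_factorable_split[OF sq] by blast
    \<comment> \<open>If \<open>q1\<close> is a unit, then \<open>f\<close> divides \<open>h\<close>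
      and thus a prime-factorable multiple of \<open>a\<close>, which contradicts
      \<open>\<not> f dvd a\<close>. If \<open>h1\<close> is a unit, then \<open>s1\<close> is up to
      a unit equal to \<open>h\<close>, a combination of \<open>f\<close> and \<open>a\<close>, so
      that \<open>f\<close> divides \<open>s1 * b\<close>.\<close>
    have "q1 dvd 1 \<or> h1 dvd 1" using f(2) split(2) by (auto simp: irreducible_def)
    then show "f dvd b"
    proof
      assume "q1 dvd 1"
      then obtain q2 where q2: "q1 * q2 = 1" by (metis dvdE)
      have "q2 * f = (q1 * q2) * h1" by (subst split(2)) (simp only: mult_ac)
      then have "h1 = q2 * f" using q2 by simp
      then have "f dvd h" using split(1) by simp
      obtain s' q' where "prime_factorable s'" "s' * a = q' * h" using div[OF aI] by blast
      then have "f dvd a"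
        using irreducible_dvd_prime_factorable_times[OF _ f(2) np] \<open>f dvd h\<close> by (metis dvd_mult)
      then show ?thesis using ab(4) by simp
    next
      assume "h1 dvd 1"
      then obtain h2 where h2: "h1 * h2 = 1" by (metis dvdE)
      have "h2 * h = (h1 * h2) * s1" by (subst split(1)) (simp only: mult_ac)
      then have "s1 = h2 * h" using h2 by simp
      moreover obtain u v where "h = u * f + v * a" using h(1) unfolding I_def by blast
      ultimately have "s1 * b = f * (h2 * u * b) + (a * b) * (h2 * v)" by (simp add: algebra_simps)
      then have "f dvd s1 * b" using ab(3) by (metis dvd_add dvd_mult2 dvd_triv_left)
      then show ?thesis
        using irreducible_dvd_prime_factorable_times[OF split(3) f(2) np] by blast
    qed
  qed
  have "prime_elem f"
  proof (rule prime_elem_in_extension[OF f(1) f0])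
    fix a b assume "a \<in> ?B" "b \<in> ?B" "f dvd a * b"
    then show "f dvd a \<or> f dvd b" using rel[of a b] by fast
  qed
  then show False using np by simp
qed

subsection \<open>Existence of factorizations\<close>

text \<open>The width of the Newton polytope in direction \<open>j\<close>. In contrast to a degree,
  it does not change under multiplication by monomials, which are units here.\<close>

definition width :: "'d::finite \<Rightarrow> 'd laurent \<Rightarrow> nat"
  where "width j e = nat (Max ((\<lambda>n. n $ j) ` keys e) - Min ((\<lambda>n. n $ j) ` keys e))"

lemma width_eqI:
  assumes "m \<in> keys e" "m' \<in> keys e"
    "\<And>k. k \<in> keys e \<Longrightarrow> k $ j \<le> m $ j" "\<And>k. k \<in> keys e \<Longrightarrow> m' $ j \<le> k $ j"
  shows "int (width j e) = m $ j - m' $ j"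
proof -
  have "Max ((\<lambda>n. n $ j) ` keys e) = m $ j" using assms by (intro Max_eqI) auto
  moreover have "Min ((\<lambda>n. n $ j) ` keys e) = m' $ j" using assms by (intro Min_eqI) auto
  moreover have "m' $ j \<le> m $ j" using assms by auto
  ultimately show ?thesis unfolding width_def by simp
qed

text \<open>For the functional \<open>n $ j\<close> and for its negative there are extreme terms of
  both factors whose product survives in \<open>a * b\<close>, so both ends of the range of
  exponents add up.\<close>

lemma width_mult:
  assumes "a \<noteq> 0" "b \<noteq> 0"
  shows "width j (a * b) = width j a + width j b"
proof -
  have add: "(m + n) $ j = m $ j + n $ j" "- ((m + n) $ j) = - (m $ j) + - (n $ j)" for m n :: "int ^ 'a"
    by auto
  obtain m n where mn: "m \<in> keys a" "n \<in> keys b"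
    "\<And>k. k \<in> keys a \<Longrightarrow> k $ j \<le> m $ j" "\<And>k. k \<in> keys b \<Longrightarrow> k $ j \<le> n $ j"
    "m + n \<in> keys (a * b)"
    by (rule leading_term[OF assms, of "\<lambda>n. n $ j", OF add(1)]) blast
  obtain m' n' where mn': "m' \<in> keys a" "n' \<in> keys b"
    "\<And>k. k \<in> keys a \<Longrightarrow> - (k $ j) \<le> - (m' $ j)"
    "\<And>k. k \<in> keys b \<Longrightarrow> - (k $ j) \<le> - (n' $ j)"
    "m' + n' \<in> keys (a * b)"
    by (rule leading_term[OF assms, of "\<lambda>n. - (n $ j)", OF add(2)]) blast
  have "int (width j (a * b)) = (m + n) $ j - (m' + n') $ j"
  proof (rule width_eqI[OF mn(5) mn'(5)])
    fix k assume "k \<in> keys (a * b)"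
    then obtain p q where pq: "k = p + q" "p \<in> keys a" "q \<in> keys b"
      using keys_mult[of a b] by auto
    show "k $ j \<le> (m + n) $ j" using mn(3)[OF pq(2)] mn(4)[OF pq(3)] pq(1) by simp
    show "(m' + n') $ j \<le> k $ j" using mn'(3)[OF pq(2)] mn'(4)[OF pq(3)] pq(1) by simp
  qed
  moreover have "int (width j a) = m $ j - m' $ j"
    by (rule width_eqI[OF mn(1) mn'(1) mn(3)]) (use mn'(3) in auto)
  moreover have "int (width j b) = n $ j - n' $ j"
    by (rule width_eqI[OF mn(2) mn'(2) mn(4)]) (use mn'(4) in auto)
  ultimately show ?thesis by simp
qed

lemma width_0_const:
  assumes "width j e = 0" "m \<in> keys e" "n \<in> keys e"
  shows "m $ j = n $ j"
proof -
  let ?A = "(\<lambda>n. n $ j) ` keys e"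
  have le: "Max ?A \<le> Min ?A" using assms(1) unfolding width_def by simp
  have "Min ?A \<le> k $ j" "k $ j \<le> Max ?A" if "k \<in> keys e" for k
    using that by (auto intro: Max_ge Min_le)
  from this[OF assms(2)] this[OF assms(3)] le show ?thesis by linarith
qed

text \<open>Natural-number valued, so that it can serve in a well-founded measure. It also bounds
  the alphabet of the integer perturbations later.\<close>

definition coeff_norm :: "'d::finite laurent \<Rightarrow> nat"
  where "coeff_norm e = (\<Sum>n\<in>keys e. nat \<bar>lookup e n\<bar>)"

lemma coeff_norm_pos: "e \<noteq> 0 \<Longrightarrow> 0 < coeff_norm e"
  unfolding coeff_norm_def by (intro sum_pos) (auto simp: in_keys_iff)

lemma coeff_norm_single_mult:
  "coeff_norm (single m c * b) = nat \<bar>c\<bar> * coeff_norm b"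
proof (cases "c = 0")
  case False
  have keys: "keys (single m c * b) = (\<lambda>n. n + m) ` keys b"
  proof (rule set_eqI)
    fix n
    have "n \<in> keys (single m c * b) \<longleftrightarrow> n - m \<in> keys b"
      using False by (simp add: in_keys_iff lookup_single_times del: mult.commute)
    also have "\<dots> \<longleftrightarrow> n \<in> (\<lambda>n. n + m) ` keys b"
      by (force simp: image_iff)
    finally show "n \<in> keys (single m c * b) \<longleftrightarrow>
        n \<in> (\<lambda>n. n + m) ` keys b" .
  qed
  show ?thesis
    unfolding coeff_norm_def keys
    by (subst sum.reindex) (auto simp: inj_on_def lookup_single_times abs_mult nat_mult_distrib sum_distrib_left)
qed (simp add: coeff_norm_def)

lemma monomial_of_width_0:
  assumes "a \<noteq> 0" "(\<Sum>j\<in>UNIV. width j a) = 0"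
  obtains m c where "a = single m c" "c \<noteq> 0"
proof -
  obtain m where m: "m \<in> keys a" using assms(1) by (metis all_not_in_conv keys_eq_empty)
  have "n = m" if "n \<in> keys a" for n
    using width_0_const[OF _ that m] assms(2) by (auto simp: vec_eq_iff)
  then have "a = single m (lookup a m)"
    by (intro poly_mapping_eqI) (auto simp: lookup_single when_def in_keys_iff)
  then show ?thesis using that m by (metis in_keys_iff)
qed

lemma single_unit: "\<bar>c\<bar> = 1 \<Longrightarrow> single m (c::int) dvd (1 :: 'd::finite laurent)"
proof -
  assume "\<bar>c\<bar> = 1"
  then have "c = 1 \<or> c = - 1" by linarith
  then have "c * c = 1" by auto
  then have "single m c * single (- m) c = (1 :: 'd laurent)"
    unfolding mult_single by (simp only: add.right_inverse single_one)
  then show ?thesis by (metis dvd_triv_left)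
qed

inductive irreducible_factorable :: "'d::finite laurent \<Rightarrow> bool" where
  unit: "u dvd 1 \<Longrightarrow> irreducible_factorable u"
| irreducible: "irreducible p \<Longrightarrow> irreducible_factorable e \<Longrightarrow> irreducible_factorable (p * e)"

lemma irreducible_factorable_mult:
  assumes "irreducible_factorable a" "irreducible_factorable b"
  shows "irreducible_factorable (a * b)"
  using assms
proof (induction rule: irreducible_factorable.induct)
  case (unit u)
  from unit(2,1) show ?case
  proof (induction rule: irreducible_factorable.induct)
    case (unit v)
    then show ?case by (metis irreducible_factorable.unit mult_1_right mult_dvd_mono)
  next
    case (irreducible p e)
    then show ?case by (metis irreducible_factorable.irreducible mult.left_commute)
  qed
next
  case (irreducible p e)
  then show ?case by (simp add: irreducible_factorable.irreducible mult.assoc)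
qed

text \<open>Widths add up, so the total width drops unless \<open>b\<close> has width 0 in all
  directions. In that case \<open>b\<close> is a monomial with a coefficient of absolute value at
  least 2, and the coefficient norm drops instead.\<close>

lemma proper_factor_smaller:
  assumes ab: "e = a * b" "e \<noteq> 0" "\<not> a dvd 1" "\<not> b dvd 1"
  shows "(a, e) \<in> measures [\<lambda>e. \<Sum>j\<in>UNIV. width j e, coeff_norm]"
proof -
  have nz: "a \<noteq> 0" "b \<noteq> 0" using ab by auto
  have W: "(\<Sum>j\<in>UNIV. width j e) = (\<Sum>j\<in>UNIV. width j a) + (\<Sum>j\<in>UNIV. width j b)"
    unfolding ab(1) width_mult[OF nz] by (simp add: sum.distrib)
  show ?thesis
  proof (cases "(\<Sum>j\<in>UNIV. width j b) = 0")
    case True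
    obtain m c where mc: "b = single m c" "c \<noteq> 0"
      using monomial_of_width_0[OF nz(2) True] .
    have "\<bar>c\<bar> \<noteq> 1" using ab(4) single_unit mc(1) by auto
    then have "2 \<le> nat \<bar>c\<bar>" using mc(2) by linarith
    moreover have "coeff_norm e = nat \<bar>c\<bar> * coeff_norm a"
      unfolding ab(1) mc(1) by (metis coeff_norm_single_mult mult.commute)
    moreover note coeff_norm_pos[OF nz(1)]
    ultimately have "coeff_norm a < coeff_norm e" by auto
    then show ?thesis using W True by simp
  next
    case False
    then have "(\<Sum>j\<in>UNIV. width j a) < (\<Sum>j\<in>UNIV. width j e)" using W by linarith
    then show ?thesis by simp
  qed
qed

lemma irreducible_factorable:
  fixes e :: "'d::finite laurent"
  shows "e \<noteq> 0 \<Longrightarrow> irreducible_factorable e"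
proof (induction e rule: wf_induct[OF wf_measures[of "[\<lambda>e. \<Sum>j\<in>UNIV. width j e, coeff_norm]"]])
  case (1 e)
  show ?case
  proof (cases "e dvd 1 \<or> irreducible e")
    case True
    then show ?thesis
      by (metis dvd_refl irreducible_factorable.simps mult_1_right)
  next
    case False
    then obtain a b where ab: "e = a * b" "\<not> a dvd 1" "\<not> b dvd 1"
      using 1(2) by (auto simp: irreducible_def)
    have "a \<noteq> 0" "b \<noteq> 0" using ab 1(2) by auto
    moreover have "(a, e) \<in> measures [\<lambda>e. \<Sum>j\<in>UNIV. width j e, coeff_norm]"
      by (rule proper_factor_smaller[OF ab(1) 1(2) ab(2,3)])
    moreover have "(b, e) \<in> measures [\<lambda>e. \<Sum>j\<in>UNIV. width j e, coeff_norm]"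
      by (rule proper_factor_smaller[OF _ 1(2) ab(3,2)]) (simp add: ab(1) mult.commute)
    ultimately show ?thesis unfolding ab(1) using 1(1) irreducible_factorable_mult ab(1) by blast
  qed
qed

lemma laurent_in_imp_width_0:
  assumes "e \<in> laurent_in T" "e \<noteq> 0" "j \<notin> T"
  shows "width j e = 0"
proof -
  have "n $ j = 0" if "n \<in> keys e" for n
    using assms that by (auto simp: laurent_in_def exponents_in_def)
  moreover obtain m where "m \<in> keys e" using assms(2) by (metis all_not_in_conv keys_eq_empty)
  ultimately have "(\<lambda>n. n $ j) ` keys e = {0}" by force
  then show ?thesis unfolding width_def by simp
qed

text \<open>Width 0 only makes the exponents constant in that coordinate; a monomial unit is needed
  to move the constant to 0.\<close>

lemma width_0_imp_laurent_in:
  assumes "e \<noteq> 0" "\<And>j. j \<notin> T \<Longrightarrow> width j e = 0"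
  shows "\<exists>m. single m 1 * e \<in> laurent_in T"
proof -
  obtain m where m: "m \<in> keys e" using assms(1) by (metis all_not_in_conv keys_eq_empty)
  have "n - (- m) \<in> keys e \<Longrightarrow> j \<notin> T \<Longrightarrow> n $ j = 0" for n j
    using width_0_const[OF assms(2) _ m, of j "n - (- m)"] by simp
  then have "single (- m) 1 * e \<in> laurent_in T"
    unfolding laurent_in_def exponents_in_def by (auto simp: in_keys_iff lookup_single_times)
  then show ?thesis by blast
qed

lemma dvd_single_mult_iff:
  fixes f :: "'d::finite laurent"
  shows "single m 1 * f dvd g \<longleftrightarrow> f dvd g"
proof
  assume "f dvd g"
  then obtain k where "g = f * k" by (auto elim: dvdE)
  then have "g = (single m 1 * single (- m) 1) * (f * k)"
    by (simp only: single_inverse mult_1_left)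
  also have "\<dots> = (single m 1 * f) * (single (- m) 1 * k)"
    by (simp only: mult.assoc mult.left_commute)
  finally have "g = (single m 1 * f) * (single (- m) 1 * k)" .
  then show "single m 1 * f dvd g" by simp
qed (metis dvd_mult_right)

lemma single_neq_0: "single m (1::int) \<noteq> 0"
  by (metis lookup_single_eq lookup_zero zero_neq_one)

lemma irreducible_single_mult:
  fixes f :: "'d::finite laurent"
  assumes "irreducible f"
  shows "irreducible (single m 1 * f)"
  unfolding irreducible_def
proof (intro conjI allI impI)
  show "single m 1 * f \<noteq> 0"
    using assms single_neq_0[of m] by (simp add: irreducible_def laurent_mult_eq_0)
  show "\<not> single m 1 * f dvd 1"
    using assms by (simp add: irreducible_def dvd_single_mult_iff)
  fix a b assume ab: "single m 1 * f = a * b"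
  have "f = single (- m) 1 * (single m 1 * f)"
    using single_inverse[of "- m", where ?'b = int] by (simp flip: mult.assoc)
  also have "\<dots> = (single (- m) 1 * a) * b"
    unfolding ab by (simp add: mult.assoc)
  finally have "single (- m) 1 * a dvd 1 \<or> b dvd 1"
    using assms unfolding irreducible_def by blast
  then show "a dvd 1 \<or> b dvd 1" by (simp add: dvd_single_mult_iff)
qed

lemma prime_elem_single_mult_iff:
  fixes f :: "'d::finite laurent"
  shows "prime_elem (single m 1 * f) \<longleftrightarrow> prime_elem f"
  using single_neq_0[of m] by (simp add: prime_elem_def dvd_single_mult_iff laurent_mult_eq_0)

text \<open>Induction on the number of variables. Constants factor into prime numbers, and in the
  step every irreducible factor is prime by \<open>irreducible_imp_prime_step\<close>, whose
  hypothesis on the coefficient ring is the induction hypothesis.\<close>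

lemma prime_factorable_laurent_in:
  fixes T :: "'d::finite set"
  shows "finite T \<Longrightarrow> e \<in> laurent_in T \<Longrightarrow> e \<noteq> 0 \<Longrightarrow> prime_factorable e"
proof (induction T arbitrary: e rule: finite_induct)
  case empty
  have const: "p = single 0 (lookup p 0)" if "p \<in> laurent_in {}" for p :: "'d laurent"
  proof (rule poly_mapping_eqI)
    fix k
    have "k = 0" if "lookup p k \<noteq> 0"
    proof -
      have "k \<in> exponents_in {}" using that \<open>p \<in> laurent_in {}\<close> by (auto simp: laurent_in_def in_keys_iff)
      then show ?thesis by (simp add: exponents_in_def vec_eq_iff)
    qed
    then show "lookup p k = lookup (single 0 (lookup p 0)) k"
      by (auto simp: lookup_single when_def)
  qed
  have dvd: "single 0 p dvd (single 0 c :: 'd laurent) \<longleftrightarrow> p dvd c" for p c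
  proof
    assume "single 0 p dvd (single 0 c :: 'd laurent)"
    then obtain k where "single 0 c = single 0 p * (k :: 'd laurent)" by (auto elim: dvdE)
    from arg_cong[OF this, of "\<lambda>p. lookup p 0"] show "p dvd c"
      by (simp add: lookup_single_times)
  next
    assume "p dvd c"
    then obtain k where "c = p * k" by (auto elim: dvdE)
    then have "single 0 c = single 0 p * (single 0 k :: 'd laurent)"
      by (simp add: mult_single)
    then show "single 0 p dvd (single 0 c :: 'd laurent)" by simp
  qed
  \<comment> \<open>With no variables in the coefficient ring,
    \<open>prime_elem_in_extension\<close> lifts primality from the integers to the whole
    ring.\<close>
  have prime: "prime_elem (single 0 p :: 'd laurent)" if "prime_elem p" for p :: int
  proof (rule prime_elem_in_extension[of _ "{}"])
    show "single 0 p \<in> laurent_in {}" by (rule laurent_in_single) (simp add: exponents_in_def)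
    show "single 0 p \<noteq> (0 :: 'd laurent)"
      using that by (metis lookup_single_eq lookup_zero prime_elem_def)
    show "\<not> single 0 p dvd (1 :: 'd laurent)"
      using that dvd[of p 1] by (simp add: prime_elem_def)
    fix a b :: "'d laurent"
    assume ab: "a \<in> laurent_in {}" "b \<in> laurent_in {}" "single 0 p dvd a * b"
    have "single 0 p dvd (single 0 (lookup a 0 * lookup b 0) :: 'd laurent)"
      using ab(3) const[OF ab(1)] const[OF ab(2)] by (metis add_0 mult_single)
    then have "p dvd lookup a 0 \<or> p dvd lookup b 0"
      using prime_elem_dvd_mult_iff[OF \<open>prime_elem p\<close>] unfolding dvd by blast
    then show "single 0 p dvd a \<or> single 0 p dvd b"
      using const[OF ab(1)] const[OF ab(2)] dvd by metis
  qed
  have "prime_factorable (single 0 c :: 'd laurent)" if "c \<noteq> 0" for c :: int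
    using that
  proof (induction c rule: prime_divisors_induct)
    case (unit c)
    then show ?case using dvd[of c 1] by (intro prime_factorable.unit) simp
  next
    case (factor p c)
    have "single 0 (p * c) = single 0 p * (single 0 c :: 'd laurent)"
      by (simp add: mult_single)
    then show ?case using factor prime[of p] by (auto intro!: prime_factorable.prime)
  qed simp
  moreover have "lookup e 0 \<noteq> 0" using const[OF empty(1)] empty(2) by (metis single_zero)
  ultimately show ?case using const[OF empty(1)] by metis
next
  case (insert j T)
  have step: "prime_factorable e" if "irreducible_factorable e" "\<And>i. i \<notin> insert j T \<Longrightarrow> width i e = 0" for e :: "'d laurent"
    using that
  proof (induction rule: irreducible_factorable.induct)
    case (unit u)
    then show ?case by (intro prime_factorable.unit)
  next
    case (irreducible p e)
    have nz: "p \<noteq> 0" "e \<noteq> 0"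
    proof -
      show "p \<noteq> 0" using irreducible by (simp add: irreducible_def)
      show "e \<noteq> 0" using irreducible(2)
        by (induction rule: irreducible_factorable.induct) (auto simp: irreducible_def laurent_mult_eq_0)
    qed
    \<comment> \<open>As widths add up, a factor of an element free of the variable \<open>i\<close>
      is free of it too, up to a monomial.\<close>
    have w: "width i p = 0" "width i e = 0" if "i \<notin> insert j T" for i
      using irreducible.prems[OF that] width_mult[OF nz, of i] by auto
    obtain m where "single m 1 * p \<in> laurent_in (insert j T)"
      using width_0_imp_laurent_in[OF nz(1), of "insert j T"] w(1) by blast
    then have "prime_elem (single m 1 * p)"
      using irreducible_imp_prime_step[OF insert.IH insert.hyps(2)] irreducible_single_mult[OF irreducible(1)]
      by blast
    then have "prime_elem p" by (simp add: prime_elem_single_mult_iff)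
    then show ?case using irreducible.IH w(2) by (intro prime_factorable.prime) auto
  qed
  show ?case
    by (rule step[OF irreducible_factorable[OF insert.prems(2)]])
      (rule laurent_in_imp_width_0[OF insert.prems])
qed

theorem irreducible_imp_prime_laurent:
  fixes f :: "'d::finite laurent"
  assumes "irreducible f"
  shows "prime_elem f"
proof -
  have "prime_factorable f"
    by (rule prime_factorable_laurent_in[of UNIV])
      (use assms in \<open>auto simp: irreducible_def laurent_in_def exponents_in_def\<close>)
  then show ?thesis
  proof cases
    case unit
    then show ?thesis using assms by (simp add: irreducible_def)
  next
    case (prime p e)
    then show ?thesis using irreducible_dvd_primeD[OF assms] by simp
  qed
qed

section \<open>Evaluation on the torus\<close>

definition torus :: "(complex ^ 'd::finite) set"
  where "torus = {z. \<forall>j. norm (z $ j) = 1}"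

definition monomial_at :: "complex ^ 'd::finite \<Rightarrow> int ^ 'd \<Rightarrow> complex"
  where "monomial_at z n = (\<Prod>j\<in>UNIV. (z $ j) powi (n $ j))"

lemma torus_nonzero: "z \<in> torus \<Longrightarrow> z $ j \<noteq> 0"
  by (auto simp: torus_def dest: spec[of _ j])

lemma monomial_at_add: "z \<in> torus \<Longrightarrow> monomial_at z (m + n) = monomial_at z m * monomial_at z n"
  by (simp add: monomial_at_def power_int_add torus_nonzero prod.distrib)

lemma norm_monomial_at: "z \<in> torus \<Longrightarrow> norm (monomial_at z n) = 1"
  by (simp add: monomial_at_def torus_def norm_power_int flip: prod_norm)

lemma monomial_at_minus: "z \<in> torus \<Longrightarrow> monomial_at z (- n) = cnj (monomial_at z n)"
proof -
  assume z: "z \<in> torus"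
  have "monomial_at z (- n) * monomial_at z n = 1"
    using monomial_at_add[OF z, of "- n" n] by (simp add: monomial_at_def)
  moreover have "cnj (monomial_at z n) * monomial_at z n = 1"
    using norm_monomial_at[OF z, of n] by (metis complex_norm_square mult.commute of_real_1 one_power2)
  ultimately show ?thesis
    by (metis mult_cancel_right mult_zero_right zero_neq_one)
qed

lemma laurent_eval_superset:
  assumes "finite A" "keys f \<subseteq> A"
  shows "laurent_eval f z = (\<Sum>n\<in>A. of_int (lookup f n) * monomial_at z n)"
  unfolding laurent_eval_def monomial_at_def using assms
  by (intro sum.mono_neutral_left) (auto simp: in_keys_iff)

lemma laurent_eval_add: "laurent_eval (a + b) z = laurent_eval a z + laurent_eval b z"
proof -
  let ?A = "keys a \<union> keys b"
  have A: "finite ?A" "keys (a + b) \<subseteq> ?A" using keys_add[of a b] by auto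
  show ?thesis
    by (subst (1 2 3) laurent_eval_superset[of ?A])
      (use A in \<open>auto simp: lookup_add algebra_simps sum.distrib\<close>)
qed

lemma laurent_eval_single: "laurent_eval (single m c) z = of_int c * monomial_at z m"
  by (cases "c = 0") (simp_all add: laurent_eval_def monomial_at_def)

lemma laurent_eval_uminus: "laurent_eval (- a) z = - laurent_eval a z"
  by (simp add: laurent_eval_def sum_negf)

lemma laurent_eval_diff: "laurent_eval (a - b) z = laurent_eval a z - laurent_eval b z"
  using laurent_eval_add[of a "- b" z] by (simp add: laurent_eval_uminus)

lemma laurent_eval_mult:
  assumes z: "z \<in> torus"
  shows "laurent_eval (a * b) z = laurent_eval a z * laurent_eval b z"
proof -
  let ?N = "(\<lambda>(k, l). k + l) ` (keys a \<times> keys b)"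
  have N: "finite ?N" "keys (a * b) \<subseteq> ?N" using keys_mult[of a b] by auto
  have inner: "(\<Sum>n\<in>?N. of_int (lookup b (n - k)) * monomial_at z n)
      = monomial_at z k * laurent_eval b z" if k: "k \<in> keys a" for k
  proof -
    have "laurent_eval b z = (\<Sum>n\<in>(\<lambda>n. n - k) ` ?N. of_int (lookup b n) * monomial_at z n)"
    proof (rule laurent_eval_superset)
      show "keys b \<subseteq> (\<lambda>n. n - k) ` ?N"
      proof
        fix n assume "n \<in> keys b"
        then have "k + n \<in> ?N" using k by force
        then show "n \<in> (\<lambda>n. n - k) ` ?N" by (metis add_diff_cancel_left' imageI)
      qed
    qed simp
    also have "\<dots> = (\<Sum>n\<in>?N. of_int (lookup b (n - k)) * monomial_at z (n - k))"
      by (subst sum.reindex) (auto simp: inj_on_def)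
    finally have "monomial_at z k * laurent_eval b z =
        (\<Sum>n\<in>?N. of_int (lookup b (n - k)) * (monomial_at z (n - k) * monomial_at z k))"
      by (simp add: sum_distrib_left mult_ac)
    moreover have "monomial_at z (n - k) * monomial_at z k = monomial_at z n" for n
      using monomial_at_add[OF z, of "n - k" k] by simp
    ultimately show ?thesis by simp
  qed
  have "laurent_eval (a * b) z = (\<Sum>n\<in>?N. of_int (lookup (a * b) n) * monomial_at z n)"
    by (rule laurent_eval_superset[OF N])
  also have "\<dots> = (\<Sum>n\<in>?N. \<Sum>k\<in>keys a. of_int (lookup a k) *
      (of_int (lookup b (n - k)) * monomial_at z n))"
    by (simp add: lookup_times sum_distrib_right mult.assoc)
  also have "\<dots> = (\<Sum>k\<in>keys a. of_int (lookup a k) *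
      (\<Sum>n\<in>?N. of_int (lookup b (n - k)) * monomial_at z n))"
    by (subst sum.swap) (simp add: sum_distrib_left)
  also have "\<dots> = (\<Sum>k\<in>keys a. of_int (lookup a k) * (monomial_at z k * laurent_eval b z))"
    using inner by (intro sum.cong) simp_all
  also have "\<dots> = laurent_eval a z * laurent_eval b z"
    by (simp add: laurent_eval_def monomial_at_def sum_distrib_right mult.assoc)
  finally show ?thesis .
qed

lemma laurent_eval_1: "laurent_eval 1 z = 1"
  using laurent_eval_single[of 0 1 z] by (simp add: monomial_at_def)

lemma laurent_eval_power: "z \<in> torus \<Longrightarrow> laurent_eval (a ^ k) z = laurent_eval a z ^ k"
  by (induction k) (simp_all add: laurent_eval_1 laurent_eval_mult)

text \<open>As the coefficients are real, inverting the variables amounts to complex conjugation of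
  the values on the torus.\<close>

definition adjoint :: "'d::finite laurent \<Rightarrow> 'd laurent"
  where "adjoint f = Poly_Mapping.map_key uminus f"

lemma lookup_adjoint: "lookup (adjoint f) n = lookup f (- n)"
  unfolding adjoint_def by (subst map_key.rep_eq) (simp_all add: inj_on_def)

lemma keys_adjoint: "keys (adjoint f) = uminus ` keys f"
  by (force simp: in_keys_iff lookup_adjoint image_iff)

lemma adjoint_adjoint: "adjoint (adjoint f) = f"
  by (rule poly_mapping_eqI) (simp add: lookup_adjoint)

lemma adjoint_mult: "adjoint (a * b) = adjoint a * adjoint b"
proof (rule poly_mapping_eqI)
  fix n
  have "lookup (adjoint a * adjoint b) n =
      (\<Sum>k\<in>keys a. lookup a k * lookup b (- n - k))"
    unfolding lookup_times keys_adjoint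
    by (subst sum.reindex) (auto simp: inj_on_def lookup_adjoint minus_diff_commute[of n])
  then show "lookup (adjoint (a * b)) n = lookup (adjoint a * adjoint b) n"
    by (simp add: lookup_adjoint lookup_times)
qed

lemma laurent_eval_adjoint:
  assumes "z \<in> torus"
  shows "laurent_eval (adjoint f) z = cnj (laurent_eval f z)"
proof -
  have "laurent_eval (adjoint f) z =
      (\<Sum>n\<in>keys f. of_int (lookup f n) * monomial_at z (- n))"
    unfolding laurent_eval_def monomial_at_def[symmetric] keys_adjoint
    by (subst sum.reindex) (auto simp: inj_on_def lookup_adjoint)
  then show ?thesis
    using assms by (simp add: laurent_eval_def monomial_at_def[symmetric] monomial_at_minus)
qed

subsection \<open>Coefficients are bounded by the supremum norm\<close>

lemma sum_roots_of_unity: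
  assumes "0 < N" "\<bar>n\<bar> < int N" "n \<noteq> 0"
  shows "(\<Sum>k<N. cis (2 * pi * real k / real N) powi n) = 0"
proof -
  define \<zeta> where "\<zeta> = cis (2 * pi * real_of_int n / real N)"
  have "cis (2 * pi * real k / real N) powi n = \<zeta> ^ k" for k
    unfolding \<zeta>_def cis_power_int Complex.DeMoivre by (simp add: field_simps)
  moreover have "\<zeta> ^ N = 1"
    unfolding \<zeta>_def Complex.DeMoivre using assms(1) by (simp add: cis_multiple_2pi)
  moreover have "\<zeta> \<noteq> 1"
  proof
    assume "\<zeta> = 1"
    then have "cos (2 * pi * real_of_int n / real N) = 1" unfolding \<zeta>_def
      by (metis cis.simps(1) one_complex.simps(1))
    then obtain m :: int where "2 * pi * real_of_int n / real N = of_int m * 2 * pi"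
      using cos_one_2pi_int by blast
    then have "real_of_int n = of_int (m * int N)" using assms(1) by (simp add: field_simps)
    then have "n = m * int N" by (simp only: of_int_eq_iff)
    then show False using assms(2,3) by (auto simp: abs_mult)
  qed
  ultimately show ?thesis by (simp add: sum_gp_strict)
qed

text \<open>Averaging over the grid of \<open>N\<close>-th roots of unity isolates the constant
  coefficient exactly and takes the place of integration over the torus.\<close>

lemma constant_coeff_bound:
  fixes q :: "'d::finite laurent"
  assumes bound: "\<And>z. z \<in> torus \<Longrightarrow> norm (laurent_eval q z) \<le> B"
  shows "\<bar>real_of_int (lookup q 0)\<bar> \<le> B"
proof -
  \<comment> \<open>\<open>N\<close> exceeds every coordinate of every exponent in absolute value,
    so a nonzero exponent has a coordinate that is nonzero modulo \<open>N\<close>.\<close>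
  define N where "N = Suc (\<Sum>n\<in>keys q. \<Sum>j\<in>UNIV. nat \<bar>n $ j\<bar>)"
  have small: "\<bar>n $ j\<bar> < int N" if n: "n \<in> keys q" for n j
  proof -
    have "nat \<bar>n $ j\<bar> \<le> (\<Sum>j\<in>UNIV. nat \<bar>n $ j\<bar>)" by (rule member_le_sum) auto
    also have "\<dots> \<le> (\<Sum>n\<in>keys q. \<Sum>j\<in>UNIV. nat \<bar>n $ j\<bar>)"
      using n by (intro member_le_sum) auto
    finally show ?thesis unfolding N_def by linarith
  qed
  define S where "S = (PiE UNIV (\<lambda>_. {..<N}) :: ('d \<Rightarrow> nat) set)"
  define pt where "pt = (\<lambda>s :: 'd \<Rightarrow> nat. (\<chi> j. cis (2 * pi * real (s j) / real N)) :: complex ^ 'd)"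
  have pt: "pt s \<in> torus" for s unfolding pt_def torus_def by simp
  have fS: "finite S" unfolding S_def by (intro finite_PiE) auto
  have cS: "card S > 0" unfolding S_def by (simp add: card_PiE N_def)
  have avg: "(\<Sum>s\<in>S. monomial_at (pt s) n) = (if n = 0 then of_nat (card S) else 0)"
    if n: "n \<in> keys q" for n
  proof -
    have "(\<Sum>s\<in>S. monomial_at (pt s) n) =
        (\<Prod>j\<in>UNIV. \<Sum>k<N. cis (2 * pi * real k / real N) powi (n $ j))"
      unfolding S_def monomial_at_def pt_def by (subst prod_sum_PiE) auto
    also have "\<dots> = (if n = 0 then of_nat (card S) else 0)"
    proof (cases "n = 0")
      case False
      then obtain j where "n $ j \<noteq> 0" by (metis vec_eq_iff zero_index)
      then have "(\<Sum>k<N. cis (2 * pi * real k / real N) powi (n $ j)) = 0"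
        using small[OF n] by (intro sum_roots_of_unity) (auto simp: N_def)
      then show ?thesis using False by (auto intro!: prod_zero)
    qed (simp add: S_def card_PiE)
    finally show ?thesis .
  qed
  have "(\<Sum>s\<in>S. laurent_eval q (pt s)) =
      (\<Sum>n\<in>keys q. of_int (lookup q n) * (\<Sum>s\<in>S. monomial_at (pt s) n))"
    unfolding laurent_eval_def monomial_at_def[symmetric] by (subst sum.swap) (simp add: sum_distrib_left)
  also have "\<dots> = (\<Sum>n\<in>keys q.
      if n = 0 then of_int (lookup q 0) * of_nat (card S) else 0)"
    using avg by (intro sum.cong) auto
  also have "\<dots> = of_int (lookup q 0) * of_nat (card S)"
    by (auto simp: sum.delta not_in_keys_iff_lookup_eq_zero)
  finally have "norm (complex_of_int (lookup q 0) * of_nat (card S)) \<le> (\<Sum>s\<in>S. norm (laurent_eval q (pt s)))"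
    by (metis norm_sum)
  also have "\<dots> \<le> (\<Sum>s\<in>S. B)" by (intro sum_mono bound pt)
  finally have "\<bar>real_of_int (lookup q 0)\<bar> * real (card S) \<le> B * real (card S)"
    by (simp add: norm_mult mult.commute)
  then show ?thesis using cS by simp
qed

text \<open>Bessel's inequality: the sum of the squares is the constant coefficient of
  \<open>p * adjoint p\<close>, whose values are those of \<open>p\<close> times their
  conjugates.\<close>

lemma coeff_square_sum_bound:
  fixes p :: "'d::finite laurent"
  assumes bound: "\<And>z. z \<in> torus \<Longrightarrow> norm (laurent_eval p z) \<le> B"
  shows "(\<Sum>n\<in>keys p. (real_of_int (lookup p n))\<^sup>2) \<le> B\<^sup>2"
proof -
  have "norm (laurent_eval (p * adjoint p) z) \<le> B\<^sup>2" if "z \<in> torus" for z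
    using power_mono[OF bound[OF that], of 2] that
    by (simp add: laurent_eval_mult laurent_eval_adjoint norm_mult power2_eq_square)
  from constant_coeff_bound[OF this]
  have "\<bar>real_of_int (lookup (p * adjoint p) 0)\<bar> \<le> B\<^sup>2" .
  moreover have "lookup (p * adjoint p) 0 = (\<Sum>n\<in>keys p. (lookup p n)\<^sup>2)"
    by (simp add: lookup_times lookup_adjoint power2_eq_square)
  ultimately show ?thesis by (simp add: sum_nonneg)
qed

lemma coeff_bound:
  fixes p :: "'d::finite laurent"
  assumes "\<And>z. z \<in> torus \<Longrightarrow> norm (laurent_eval p z) \<le> B" "0 \<le> B"
  shows "\<bar>real_of_int (lookup p n)\<bar> \<le> B"
proof (cases "n \<in> keys p")
  case True
  then have "(real_of_int (lookup p n))\<^sup>2 \<le>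
      (\<Sum>n\<in>keys p. (real_of_int (lookup p n))\<^sup>2)"
    by (intro member_le_sum) auto
  also have "\<dots> \<le> B\<^sup>2" by (rule coeff_square_sum_bound[OF assms(1)])
  finally show ?thesis using assms(2) by (simp add: abs_le_square_iff[symmetric])
next
  case False
  then show ?thesis using assms(2) by (simp add: in_keys_iff)
qed

lemma coeff_sum_bound:
  fixes p :: "'d::finite laurent" and B :: real
  assumes "\<And>z. z \<in> torus \<Longrightarrow> norm (laurent_eval p z) \<le> B" "0 \<le> B"
  shows "(\<Sum>n\<in>keys p. \<bar>real_of_int (lookup p n)\<bar>) \<le> card (keys p) * B"
  using sum_bounded_above[of "keys p" "\<lambda>n. \<bar>real_of_int (lookup p n)\<bar>" B]
    coeff_bound[OF assms] by simp

section \<open>Summable fractions\<close>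

definition int_box :: "int \<Rightarrow> (int ^ 'd::finite) set"
  where "int_box r = {n. \<forall>j. \<bar>n $ j\<bar> \<le> r}"

lemma int_box_image: "int_box r = vec_lambda ` (PiE UNIV (\<lambda>_. {-r..r}))"
proof (intro set_eqI iffI)
  fix n :: "int ^ 'a"
  assume "n \<in> int_box r"
  then show "n \<in> vec_lambda ` (PiE UNIV (\<lambda>_. {-r..r}))"
    by (intro image_eqI[of _ _ "vec_nth n"]) (auto simp: int_box_def abs_le_iff PiE_UNIV_domain minus_le_iff)
next
  fix n :: "int ^ 'a"
  assume "n \<in> vec_lambda ` (PiE UNIV (\<lambda>_. {-r..r}))"
  then show "n \<in> int_box r"
    by (auto simp: int_box_def abs_le_iff PiE_UNIV_domain minus_le_iff)
qed

lemma finite_int_box [simp]: "finite (int_box r :: (int ^ 'd::finite) set)"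
  unfolding int_box_image by (intro finite_imageI finite_PiE) auto

lemma card_int_box: "card (int_box r :: (int ^ 'd::finite) set) = nat (2 * r + 1) ^ CARD('d)"
proof -
  have "card (int_box r :: (int ^ 'd) set) = card (PiE (UNIV :: 'd set) (\<lambda>_. {-r..r}))"
    unfolding int_box_image by (rule card_image) (auto simp: inj_on_def vec_lambda_inject)
  also have "\<dots> = nat (2 * r + 1) ^ CARD('d)"
    by (simp add: card_PiE)
  finally show ?thesis .
qed

lemma finite_subset_int_box:
  fixes A :: "(int ^ 'd::finite) set"
  assumes "finite A"
  obtains r :: nat where "A \<subseteq> int_box (int r)"
proof -
  define r where "r = (\<Sum>n\<in>A. \<Sum>j\<in>UNIV. nat \<bar>n $ j\<bar>)"
  have "\<bar>n $ j\<bar> \<le> int r" if n: "n \<in> A" for n j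
  proof -
    have "nat \<bar>n $ j\<bar> \<le> (\<Sum>j\<in>UNIV. nat \<bar>n $ j\<bar>)" by (rule member_le_sum) auto
    also have "\<dots> \<le> r" unfolding r_def using n assms by (intro member_le_sum) auto
    finally show ?thesis by linarith
  qed
  then show ?thesis using that unfolding int_box_def by blast
qed

lemma int_box_add: "m \<in> int_box r \<Longrightarrow> n \<in> int_box s \<Longrightarrow> m + n \<in> int_box (r + s)"
  unfolding int_box_def by (auto intro: order_trans[OF abs_triangle_ineq] add_mono)

lemma keys_mult_int_box:
  assumes "keys a \<subseteq> int_box r" "keys b \<subseteq> int_box s"
  shows "keys (a * b) \<subseteq> int_box (r + s)"
  using keys_mult[of a b] assms by (fastforce intro: int_box_add)

lemma keys_power_int_box:
  assumes "keys a \<subseteq> int_box r"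
  shows "keys (a ^ k) \<subseteq> int_box (int k * r)"
proof (induction k)
  case 0
  then show ?case by (auto simp: int_box_def)
next
  case (Suc k)
  show ?case using keys_mult_int_box[OF assms Suc] by (simp add: algebra_simps)
qed

text \<open>The right-hand side is the product of the factors \<open>k + 1, ..., k + q\<close>, each
  of which is at least \<open>Suc k\<close>.\<close>

lemma binomial_lower_bound: "Suc k ^ q \<le> fact q * ((k + q) choose q)"
proof (induction q)
  case (Suc q)
  have "fact (Suc q) * ((k + Suc q) choose Suc q) = fact q * (Suc q * (Suc (k + q) choose Suc q))"
    by (simp only: fact_Suc of_nat_id add_Suc_right mult.assoc mult.left_commute)
  also have "\<dots> = Suc (k + q) * (fact q * ((k + q) choose q))"
    by (simp only: Suc_times_binomial) (simp add: mult_ac)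
  finally show ?case
    using mult_mono[OF _ Suc.IH, of "Suc k" "Suc (k + q)"] by simp
qed simp

text \<open>The binomial weight of \<open>s\<^sup>q (1 - s)\<^sup>k\<close> in the expansion of \<open>(s + (1 - s))\<^sup>k\<^sup>+\<^sup>q\<close>.\<close>

lemma power_mult_power_bound:
  fixes s :: real
  assumes "0 \<le> s" "s \<le> 1"
  shows "s ^ q * (1 - s) ^ k \<le> fact q / real (Suc k) ^ q"
proof -
  have "real ((k + q) choose q) * (s ^ q * (1 - s) ^ k)
      = of_nat ((k + q) choose q) * s ^ q * (1 - s) ^ (k + q - q)" by simp
  also have "\<dots> \<le> (\<Sum>i\<le>k + q. of_nat ((k + q) choose i) * s ^ i * (1 - s) ^ (k + q - i))"
    by (rule member_le_sum) (use assms in auto)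
  also have "\<dots> = (s + (1 - s)) ^ (k + q)" by (simp only: binomial_ring)
  finally have "real ((k + q) choose q) * (s ^ q * (1 - s) ^ k) \<le> 1" by simp
  then have "fact q * (real ((k + q) choose q) * (s ^ q * (1 - s) ^ k)) \<le> fact q * 1"
    by (intro mult_left_mono) auto
  moreover have "real (Suc k) ^ q * (s ^ q * (1 - s) ^ k) \<le> (fact q * real ((k + q) choose q)) * (s ^ q * (1 - s) ^ k)"
  proof (rule mult_right_mono)
    have "real (Suc k ^ q) \<le> real (fact q * ((k + q) choose q))"
      using binomial_lower_bound by (rule of_nat_mono)
    then show "real (Suc k) ^ q \<le> fact q * real ((k + q) choose q)" by simp
  qed (use assms in auto)
  ultimately have "real (Suc k) ^ q * (s ^ q * (1 - s) ^ k) \<le> fact q"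
    by (simp only: mult.assoc mult_1_right)
  then have "(s ^ q * (1 - s) ^ k) * real (Suc k) ^ q \<le> fact q" by (simp only: mult.commute)
  then show ?thesis by (subst pos_le_divide_eq) simp_all
qed

text \<open>Expanding \<open>1/f = f\<^sup>*/P\<close>, where \<open>P = f f\<^sup>*\<close> takes values in \<open>[0, S]\<close>, as the geometric
  series of \<open>1 - P/S\<close> writes \<open>g\<^sup>4\<^sup>q/f\<close> as a sum of Laurent polynomials. The zeros of \<open>g\<close> make the
  supremum norm of the \<open>k\<close>th term decay like \<open>k\<^sup>-\<^sup>q\<close>, while its support grows only like \<open>k\<^sup>d\<close>.\<close>

lemma summable_fraction:
  fixes f g :: "'d::finite laurent"
  assumes f0: "f \<noteq> 0" and C: "\<And>z. z \<in> torus \<Longrightarrow> norm (laurent_eval g z) ^ 2 \<le> C * norm (laurent_eval f z)"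
  obtains q :: nat and w :: "int ^ 'd \<Rightarrow> real" and W :: real where
    "\<And>F. finite F \<Longrightarrow> (\<Sum>n\<in>F. \<bar>w n\<bar>) \<le> W"
    "\<And>l. (\<Sum>m\<in>keys f. of_int (lookup f m) * w (l - m)) =
        of_int (lookup (g ^ q) l)"
proof -
  define d where "d = CARD('d)"
  \<comment> \<open>The support of the \<open>k\<close>-th term costs a factor of order
    \<open>Suc k ^ d\<close>; two further powers leave the summable bound
    \<open>1 / Suc k ^ 2\<close>.\<close>
  define q where "q = d + 2"
  \<comment> \<open>The \<open>q\<close> factors of \<open>\<bar>f\<bar>\<^sup>2\<close> that the
    estimate of \<open>s ^ q * (1 - s) ^ k\<close> needs require \<open>2 * q\<close> factors of
    \<open>\<bar>f\<bar>\<close>, and each of these is paid for by two factors of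
    \<open>\<bar>g\<bar>\<close>.\<close>
  define G where "G = g ^ (4 * q)"
  define P where "P = f * adjoint f"
  define s where "s = (\<Sum>n\<in>keys f. \<bar>lookup f n\<bar>)"
  \<comment> \<open>\<open>s\<close> bounds the absolute value of \<open>f\<close> on the torus, so
    the values of \<open>P\<close> divided by \<open>S\<close> lie in the unit interval.\<close>
  define S where "S = s\<^sup>2"
  have "s > 0" unfolding s_def using f0 by (intro sum_pos) (auto simp: in_keys_iff)
  then have S: "S > 0" unfolding S_def by simp
  define D where "D = single 0 S - P"
  define p where "p = (\<lambda>k. G * adjoint f * D ^ k)"
  \<comment> \<open>The coefficients of the \<open>k\<close>-th term of
    \<open>G * adjoint f / P\<close>, where \<open>1 / P\<close> is the sum of
    \<open>D ^ k / S ^ Suc k\<close>. Integer numerators are kept apart from the power of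
    \<open>S\<close> so that all bounds concern Laurent polynomials over the integers.\<close>
  define c where "c = (\<lambda>k n. real_of_int (lookup (p k) n) / real_of_int S ^ Suc k)"
  have C0: "C \<ge> 0" if "z \<in> (torus :: (complex ^ 'd) set)" "laurent_eval f z \<noteq> 0" for z
  proof -
    have "0 \<le> C * norm (laurent_eval f z)" using C[OF that(1)] by (meson order_trans zero_le_power2)
    then show ?thesis using that(2) by (simp add: zero_le_mult_iff)
  qed
  have fs: "norm (laurent_eval f z) \<le> real_of_int s" if "z \<in> torus" for z
  proof -
    have "norm (laurent_eval f z) \<le> (\<Sum>n\<in>keys f. norm (of_int (lookup f n) * monomial_at z n))"
      unfolding laurent_eval_def monomial_at_def[symmetric] by (rule norm_sum)
    then show ?thesis unfolding s_def using that by (simp add: norm_mult norm_monomial_at)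
  qed
  define A where "A = \<bar>C\<bar> ^ (2 * q) * real_of_int S ^ q * fact q"
  have A0: "A \<ge> 0" unfolding A_def using S by simp
  have main: "norm (laurent_eval (G * D ^ k) z) \<le> A / real (Suc k) ^ q * real_of_int S ^ k"
    if z: "z \<in> torus" for z k
  proof -
    define y where "y = norm (laurent_eval f z)"
    define t where "t = y\<^sup>2 / real_of_int S"
    have y: "0 \<le> y" "y \<le> real_of_int s" unfolding y_def using fs[OF z] by auto
    have t: "0 \<le> t" "t \<le> 1"
      unfolding t_def using power_mono[OF y(2) y(1), of 2] S by (auto simp: S_def)
    have "laurent_eval P z = of_real (y\<^sup>2)"
      unfolding P_def laurent_eval_mult[OF z] laurent_eval_adjoint[OF z] y_def
      by (simp only: complex_norm_square)
    then have "laurent_eval D z = of_real (real_of_int S * (1 - t))"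
      unfolding D_def laurent_eval_diff laurent_eval_single t_def using S
      by (simp add: monomial_at_def right_diff_distrib)
    then have nD: "norm (laurent_eval D z) = real_of_int S * (1 - t)"
      using S t by (simp only: norm_of_real) simp
    have "norm (laurent_eval G z) = (norm (laurent_eval g z) ^ 2) ^ (2 * q)"
      unfolding G_def laurent_eval_power[OF z] norm_power by (simp flip: power_mult)
    also have "\<dots> \<le> (\<bar>C\<bar> * y) ^ (2 * q)"
    proof (rule power_mono)
      have "C * y \<le> \<bar>C\<bar> * y" using y by (intro mult_right_mono) auto
      then show "(norm (laurent_eval g z))\<^sup>2 \<le> \<bar>C\<bar> * y"
        using C[OF z] unfolding y_def by linarith
    qed simp
    also have "\<dots> = \<bar>C\<bar> ^ (2 * q) * (y\<^sup>2) ^ q" by (simp add: power_mult_distrib power_mult)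
    also have "y\<^sup>2 = real_of_int S * t" unfolding t_def using S by simp
    finally have nG: "norm (laurent_eval G z) \<le> \<bar>C\<bar> ^ (2 * q) * real_of_int S ^ q * t ^ q"
      by (simp add: power_mult_distrib mult.assoc)
    have "norm (laurent_eval (G * D ^ k) z) = norm (laurent_eval G z) * (real_of_int S * (1 - t)) ^ k"
      unfolding laurent_eval_mult[OF z] laurent_eval_power[OF z] norm_mult norm_power nD ..
    also have "\<dots> \<le> (\<bar>C\<bar> ^ (2 * q) * real_of_int S ^ q * t ^ q) * (real_of_int S * (1 - t)) ^ k"
      using S t by (intro mult_right_mono nG) auto
    also have "\<dots> = \<bar>C\<bar> ^ (2 * q) * real_of_int S ^ q * (t ^ q * (1 - t) ^ k) * real_of_int S ^ k"
      by (simp add: power_mult_distrib mult_ac)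
    also have "\<dots> \<le> \<bar>C\<bar> ^ (2 * q) * real_of_int S ^ q * (fact q / real (Suc k) ^ q) * real_of_int S ^ k"
      using S by (intro mult_right_mono mult_left_mono power_mult_power_bound t) auto
    finally show ?thesis unfolding A_def by simp
  qed
  have sup: "norm (laurent_eval (p k) z) \<le> real_of_int s * (A / real (Suc k) ^ q * real_of_int S ^ k)"
    if z: "z \<in> torus" for z k
  proof -
    have "norm (laurent_eval (p k) z) = norm (laurent_eval f z) * norm (laurent_eval (G * D ^ k) z)"
      unfolding p_def laurent_eval_mult[OF z] norm_mult laurent_eval_adjoint[OF z] by simp
    also have "\<dots> \<le> real_of_int s * (A / real (Suc k) ^ q * real_of_int S ^ k)"
      using \<open>s > 0\<close> by (intro mult_mono fs main z) auto
    finally show ?thesis .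
  qed
  obtain r0 :: nat where r0: "keys (G * adjoint f) \<subseteq> int_box (int r0)"
    using finite_subset_int_box[OF finite_keys] .
  obtain r1 :: nat where r1: "keys D \<subseteq> int_box (int r1)"
    using finite_subset_int_box[OF finite_keys] .
  \<comment> \<open>The support of \<open>p k\<close> lies in a box of side
    \<open>2 * (r0 + k * r1) + 1\<close>, which is at most \<open>E\<close> times
    \<open>Suc k\<close>.\<close>
  define E where "E = real (2 * r0 + 2 * r1 + 1)"
  have card: "real (card (keys (p k))) \<le> E ^ d * real (Suc k) ^ d" for k
  proof -
    have "keys (p k) \<subseteq> int_box (int r0 + int k * int r1)"
      unfolding p_def by (intro keys_mult_int_box r0 keys_power_int_box r1)
    then have "card (keys (p k)) \<le> nat (2 * (int r0 + int k * int r1) + 1) ^ d"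
      unfolding d_def card_int_box[symmetric] by (intro card_mono) auto
    also have "nat (2 * (int r0 + int k * int r1) + 1) = 2 * (r0 + k * r1) + 1"
      by (metis (no_types, opaque_lifting) nat_int of_nat_1 of_nat_add of_nat_mult of_nat_numeral)
    also have "(2 * (r0 + k * r1) + 1) ^ d \<le> ((2 * r0 + 2 * r1 + 1) * Suc k) ^ d"
      by (rule power_mono) (simp_all add: algebra_simps)
    finally have "real (card (keys (p k))) \<le> real (((2 * r0 + 2 * r1 + 1) * Suc k) ^ d)"
      by (rule of_nat_mono)
    then show ?thesis by (simp only: E_def of_nat_mult of_nat_power power_mult_distrib)
  qed
  define L where "L = (\<lambda>k. E ^ d * real_of_int s * A / real_of_int S * (1 / real (Suc k) ^ 2))"
  have L: "(\<Sum>n\<in>F. \<bar>c k n\<bar>) \<le> L k" if "finite F" for F k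
  proof -
    define B where "B = real_of_int s * (A / real (Suc k) ^ q * real_of_int S ^ k)"
    have B0: "0 \<le> B" unfolding B_def using A0 S \<open>s > 0\<close> by simp
    have "(\<Sum>n\<in>F. \<bar>real_of_int (lookup (p k) n)\<bar>)
        = (\<Sum>n\<in>F \<inter> keys (p k). \<bar>real_of_int (lookup (p k) n)\<bar>)"
      using that by (intro sum.mono_neutral_right) (auto simp: in_keys_iff)
    also have "\<dots> \<le> (\<Sum>n\<in>keys (p k). \<bar>real_of_int (lookup (p k) n)\<bar>)"
      by (intro sum_mono2) auto
    also have "\<dots> \<le> real (card (keys (p k))) * B"
      using coeff_sum_bound[OF sup, of k] B0 unfolding B_def by blast
    also have "\<dots> \<le> (E ^ d * real (Suc k) ^ d) * B"
      by (rule mult_right_mono[OF card B0])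
    also have "\<dots> = E ^ d * real_of_int s * A * (real (Suc k) ^ d / real (Suc k) ^ q) * real_of_int S ^ k"
      unfolding B_def by simp
    also have "real (Suc k) ^ d / real (Suc k) ^ q = 1 / real (Suc k) ^ 2"
      unfolding q_def power_add by simp
    finally have *: "(\<Sum>n\<in>F. \<bar>real_of_int (lookup (p k) n)\<bar>)
        \<le> E ^ d * real_of_int s * A * (1 / real (Suc k) ^ 2) * real_of_int S ^ k" .
    have "(\<Sum>n\<in>F. \<bar>c k n\<bar>) = (\<Sum>n\<in>F. \<bar>real_of_int (lookup (p k) n)\<bar>) / real_of_int S ^ Suc k"
      unfolding c_def sum_divide_distrib using S by (intro sum.cong) auto
    also have "\<dots> \<le> (E ^ d * real_of_int s * A * (1 / real (Suc k) ^ 2) * real_of_int S ^ k) / real_of_int S ^ Suc k"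
      by (rule divide_right_mono[OF *]) (use S in simp)
    also have "\<dots> = L k" unfolding L_def using S by (simp add: mult_ac)
    finally show ?thesis .
  qed
  have "summable (\<lambda>k. inverse (real (Suc k) ^ 2))"
    using summable_Suc_iff[of "\<lambda>k. inverse (real k ^ 2)"] inverse_power_summable[of 2, where ?'a = real]
    by simp
  then have sumL: "summable L"
    unfolding L_def by (intro summable_mult) (simp only: inverse_eq_divide)
  have absc: "summable (\<lambda>k. \<bar>c k n\<bar>)" for n
    by (rule summable_comparison_test'[OF sumL, of 0]) (use L[of "{n}"] in simp)
  then have sumc: "summable (\<lambda>k. c k n)" for n by (rule summable_rabs_cancel)
  define w where "w = (\<lambda>n. suminf (\<lambda>k. c k n))"
  have bound: "(\<Sum>n\<in>F. \<bar>w n\<bar>) \<le> suminf L" if "finite F" for F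
  proof -
    have "(\<Sum>n\<in>F. \<bar>w n\<bar>) \<le> (\<Sum>n\<in>F. suminf (\<lambda>k. \<bar>c k n\<bar>))"
      unfolding w_def by (intro sum_mono summable_rabs absc)
    also have "\<dots> = suminf (\<lambda>k. \<Sum>n\<in>F. \<bar>c k n\<bar>)" using absc by (intro suminf_sum[symmetric]) auto
    also have "\<dots> \<le> suminf L"
      by (intro suminf_le L that sumL summable_sum absc)
    finally show ?thesis .
  qed
  have eq: "(\<Sum>m\<in>keys f. of_int (lookup f m) * w (l - m)) =
      of_int (lookup G l)" for l
  proof -
    \<comment> \<open>Since \<open>P = S - D\<close>, the product \<open>f * p k\<close> equals
      \<open>S * (G * D ^ k) - G * D ^ Suc k\<close>, and the sum telescopes.\<close>
    have partial: "(\<Sum>k<K. real_of_int (lookup (f * p k) l) / real_of_int S ^ Suc k) =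
        of_int (lookup G l) - of_int (lookup (G * D ^ K) l) / real_of_int S ^ K" for K
    proof (induction K)
      case (Suc K)
      have "f * p K = single 0 S * (G * D ^ K) - G * D ^ Suc K"
        unfolding p_def D_def P_def by (simp add: algebra_simps)
      then have "lookup (f * p K) l =
          S * lookup (G * D ^ K) l - lookup (G * D ^ Suc K) l"
        by (simp only: lookup_minus lookup_single_times) simp
      then have "real_of_int (lookup (f * p K) l) / real_of_int S ^ Suc K =
          of_int (lookup (G * D ^ K) l) / real_of_int S ^ K
          - of_int (lookup (G * D ^ Suc K) l) / real_of_int S ^ Suc K"
        using S by (simp add: diff_divide_distrib)
      then show ?case by (simp only: sum.lessThan_Suc Suc.IH)
    qed simp
    have fp: "real_of_int (lookup (f * p k) l) / real_of_int S ^ Suc k =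
        (\<Sum>m\<in>keys f. of_int (lookup f m) * c k (l - m))" for k
      unfolding lookup_times c_def by (simp add: sum_divide_distrib)
    have "(\<lambda>k. \<Sum>m\<in>keys f. of_int (lookup f m) * c k (l - m)) sums
        (\<Sum>m\<in>keys f. of_int (lookup f m) * w (l - m))"
      unfolding w_def by (intro sums_sum sums_mult summable_sums sumc)
    then have lim1: "(\<lambda>K. \<Sum>k<K. real_of_int (lookup (f * p k) l) / real_of_int S ^ Suc k)
        \<longlonglongrightarrow> (\<Sum>m\<in>keys f. of_int (lookup f m) * w (l - m))"
      unfolding sums_def fp .
    \<comment> \<open>The remainder tends to 0 because the zeros of \<open>g\<close> damp
      \<open>D ^ K\<close> where it comes close to its largest value \<open>S ^ K\<close>.\<close>
    have small: "norm (real_of_int (lookup (G * D ^ K) l) / real_of_int S ^ K) \<le> A * (1 / real (Suc K))" for K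
    proof -
      have "\<bar>real_of_int (lookup (G * D ^ K) l)\<bar> \<le> A / real (Suc K) ^ q * real_of_int S ^ K"
        by (rule coeff_bound[OF main]) (use A0 S in auto)
      then have "norm (real_of_int (lookup (G * D ^ K) l) / real_of_int S ^ K) \<le> A / real (Suc K) ^ q"
        using S by (simp add: pos_divide_le_eq)
      also have "\<dots> \<le> A / real (Suc K) ^ 1"
        using A0 by (intro divide_left_mono power_increasing) (auto simp: q_def)
      finally show ?thesis by simp
    qed
    have "(\<lambda>K. A * (1 / real (Suc K))) \<longlonglongrightarrow> A * 0"
      by (intro tendsto_mult tendsto_const LIMSEQ_Suc[OF lim_1_over_n])
    then have "(\<lambda>K. real_of_int (lookup (G * D ^ K) l) / real_of_int S ^ K) \<longlonglongrightarrow> 0"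
      by (intro Lim_null_comparison[OF eventuallyI[OF small]]) simp
    then have "(\<lambda>K. \<Sum>k<K. real_of_int (lookup (f * p k) l) / real_of_int S ^ Suc k)
        \<longlonglongrightarrow> of_int (lookup G l) - 0"
      unfolding partial by (intro tendsto_diff tendsto_const)
    then show ?thesis using LIMSEQ_unique[OF lim1] by simp
  qed
  show ?thesis by (rule that[of w "suminf L" "4 * q"]) (use bound eq in \<open>auto simp: G_def\<close>)
qed

section \<open>Extension of homomorphisms into the circle group\<close>

lemma zmult_add_left: "zmult (k + l) x = zmult k x + zmult l x"
  by transfer (simp add: distrib_right)

lemma zmult_minus_left: "zmult (- k) x = - zmult k x"
  by transfer simp

lemma zmult_zmult: "zmult k (zmult l x) = zmult (k * l) x"
  by transfer (simp add: mult.assoc)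

lemma zmult_zero_left [simp]: "zmult 0 x = 0"
  by transfer simp

lemma zmult_one [simp]: "zmult 1 x = x"
  by transfer simp

lemma zmult_divisible: "k \<noteq> 0 \<Longrightarrow> \<exists>t. zmult k t = s"
proof -
  assume k: "k \<noteq> 0"
  obtain r where r: "s = to_circle r" using surj_to_circle by (metis surjD)
  have "zmult k (to_circle (r / of_int k)) = s"
    unfolding r zmult.abs_eq using k by simp
  then show ?thesis by blast
qed

lemma zmult_sum: "zmult k (\<Sum>x\<in>A. h x) = (\<Sum>x\<in>A. zmult k (h x))"
  by (induction A rule: infinite_finite_induct) (simp_all add: zmult_0 zmult_add)

lemma additive_zmult:
  fixes \<psi> :: "'a::ring_1 \<Rightarrow> add_circle"
  assumes add: "\<And>a b. \<psi> (a + b) = \<psi> a + \<psi> b"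
  shows "\<psi> (of_int k * a) = zmult k (\<psi> a)"
proof -
  have 0: "\<psi> 0 = 0" using add[of 0 0] by simp
  have minus: "\<psi> (- b) = - \<psi> b" for b using add[of b "- b"] 0 by (simp add: minus_unique)
  have "\<psi> (of_nat n * a) = zmult (int n) (\<psi> a)" for n
    by (induction n) (simp_all add: 0 distrib_right add zmult_add_left)
  then show ?thesis
    by (cases k) (simp_all only: of_int_of_nat_eq of_int_minus mult_minus_left minus zmult_minus_left)
qed

text \<open>Partial homomorphisms are represented by their graphs.\<close>

definition hom_graph :: "('a::comm_ring_1 \<times> add_circle) set \<Rightarrow> bool"
  where "hom_graph \<Gamma> \<longleftrightarrow> (0, 0) \<in> \<Gamma> \<and>
    (\<forall>a s b t. (a, s) \<in> \<Gamma> \<longrightarrow> (b, t) \<in> \<Gamma> \<longrightarrow> (a - b, s - t) \<in> \<Gamma>) \<and> (\<forall>t. (0, t) \<in> \<Gamma> \<longrightarrow> t = 0)"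

lemma hom_graph_diff: "hom_graph \<Gamma> \<Longrightarrow> (a, s) \<in> \<Gamma> \<Longrightarrow> (b, t) \<in> \<Gamma> \<Longrightarrow> (a - b, s - t) \<in> \<Gamma>"
  by (simp add: hom_graph_def)

lemma hom_graph_minus: "hom_graph \<Gamma> \<Longrightarrow> (b, t) \<in> \<Gamma> \<Longrightarrow> (- b, - t) \<in> \<Gamma>"
  using hom_graph_diff[of \<Gamma> 0 0 b t] by (simp add: hom_graph_def)

lemma hom_graph_add: "hom_graph \<Gamma> \<Longrightarrow> (a, s) \<in> \<Gamma> \<Longrightarrow> (b, t) \<in> \<Gamma> \<Longrightarrow> (a + b, s + t) \<in> \<Gamma>"
  using hom_graph_diff[of \<Gamma> a s "- b" "- t"] hom_graph_minus[of \<Gamma> b t] by simp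

lemma hom_graph_zmult:
  assumes "hom_graph \<Gamma>" "(a, s) \<in> \<Gamma>"
  shows "(of_int k * a, zmult k s) \<in> \<Gamma>"
proof -
  have *: "(of_nat n * a, zmult (int n) s) \<in> \<Gamma>" for n
  proof (induction n)
    case (Suc n)
    then show ?case
      using hom_graph_add[OF assms(1) assms(2) Suc] by (simp add: distrib_right zmult_add_left)
  qed (use assms in \<open>simp add: hom_graph_def\<close>)
  show ?thesis
  proof (cases k)
    case (nonneg n)
    then show ?thesis using * by simp
  next
    case (neg n)
    then show ?thesis using hom_graph_minus[OF assms(1) *[of "Suc n"]]
      by (simp only: of_int_minus of_int_of_nat_eq mult_minus_left zmult_minus_left)
  qed
qed

text \<open>The integers \<open>k\<close> with \<open>k\<close> times \<open>e\<close> in the domain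
  are the multiples of some \<open>m\<close>. If \<open>m\<close> is positive, divisibility of the
  circle provides a value at \<open>e\<close> that is compatible with the given value at
  \<open>m\<close> times \<open>e\<close>; if only 0 occurs, every value is compatible.\<close>

lemma hom_graph_extend:
  assumes \<Gamma>: "hom_graph \<Gamma>"
  shows "\<exists>\<Gamma>' t. hom_graph \<Gamma>' \<and> \<Gamma> \<subseteq> \<Gamma>' \<and> (e, t) \<in> \<Gamma>'"
proof -
  define K where "K = {k :: int. \<exists>s. (of_int k * e, s) \<in> \<Gamma>}"
  have "\<exists>t. \<forall>k\<in>K. (of_int k * e, zmult k t) \<in> \<Gamma>"
  proof (cases "K \<subseteq> {0}")
    case True
    then show ?thesis using \<Gamma> by (intro exI[of _ 0]) (auto simp: hom_graph_def zmult_0)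
  next
    case False
    then obtain k where k: "k \<in> K" "k \<noteq> 0" by blast
    have negK: "- k \<in> K" if kK: "k \<in> K" for k
    proof -
      obtain s where "(of_int k * e, s) \<in> \<Gamma>" using kK K_def by blast
      from hom_graph_minus[OF \<Gamma> this] have "(of_int (- k) * e, - s) \<in> \<Gamma>" by simp
      then show ?thesis unfolding K_def by blast
    qed
    have "int (nat \<bar>k\<bar>) \<in> K" using k(1) negK[OF k(1)] by (cases "0 \<le> k") auto
    then have ex: "\<exists>n. 0 < n \<and> int n \<in> K" using k(2) by (intro exI[of _ "nat \<bar>k\<bar>"]) auto
    define m where "m = (LEAST n. 0 < n \<and> int n \<in> K)"
    have m: "0 < m" "int m \<in> K" using LeastI_ex[OF ex] unfolding m_def by auto
    obtain s where s: "(of_int (int m) * e, s) \<in> \<Gamma>" using m(2) unfolding K_def by blast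
    obtain t where t: "zmult (int m) t = s" using zmult_divisible m(1) by (metis of_nat_0_less_iff less_irrefl)
    have "(of_int k * e, zmult k t) \<in> \<Gamma>" if kK: "k \<in> K" for k
    proof -
      obtain u where u: "(of_int k * e, u) \<in> \<Gamma>" using kK K_def by blast
      have q: "(of_int (k div int m) * (of_int (int m) * e), zmult (k div int m) s) \<in> \<Gamma>"
        by (rule hom_graph_zmult[OF \<Gamma> s])
      have eq: "of_int (k mod int m) * e = of_int k * e - of_int (k div int m) * (of_int (int m) * e)"
        by (simp add: minus_div_mult_eq_mod[symmetric] left_diff_distrib mult.assoc)
      have "k mod int m \<in> K"
        unfolding K_def mem_Collect_eq eq using hom_graph_diff[OF \<Gamma> u q] by blast
      then have "\<not> (0 < nat (k mod int m))"
        using not_less_Least[of "nat (k mod int m)" "\<lambda>n. 0 < n \<and> int n \<in> K"] m(1)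
        unfolding m_def[symmetric] by (auto simp: nat_less_iff)
      moreover have "0 \<le> k mod int m" using m(1) by simp
      ultimately have "k mod int m = 0" by simp
      then have k: "k = (k div int m) * int m" by (metis add.right_neutral div_mult_mod_eq)
      have "zmult (k div int m) s = zmult k t" unfolding t[symmetric] zmult_zmult using k by simp
      moreover have "of_int (k div int m) * (of_int (int m) * e) = of_int k * e"
        using k by (metis mult.assoc of_int_mult)
      ultimately show ?thesis using q by simp
    qed
    then show ?thesis by blast
  qed
  then obtain t where t: "\<And>k. k \<in> K \<Longrightarrow> (of_int k * e, zmult k t) \<in> \<Gamma>" by blast
  define \<Gamma>' where "\<Gamma>' = {(a + of_int k * e, s + zmult k t) | a s k. (a, s) \<in> \<Gamma>}"
  have "\<Gamma> \<subseteq> \<Gamma>'"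
  proof
    fix x assume "x \<in> \<Gamma>"
    then show "x \<in> \<Gamma>'" unfolding \<Gamma>'_def
      by (cases x) (force intro: exI[of _ "0 :: int"])
  qed
  moreover have "(e, t) \<in> \<Gamma>'"
    unfolding \<Gamma>'_def using \<Gamma> by (force simp: hom_graph_def intro: exI[of _ "1 :: int"])
  moreover have "hom_graph \<Gamma>'"
    unfolding hom_graph_def
  proof (intro conjI allI impI)
    show "(0, 0) \<in> \<Gamma>'" using \<open>\<Gamma> \<subseteq> \<Gamma>'\<close> \<Gamma> by (auto simp: hom_graph_def)
    fix a s b u
    assume "(a, s) \<in> \<Gamma>'" "(b, u) \<in> \<Gamma>'"
    then obtain a' s' k b' u' l where *: "a = a' + of_int k * e" "s = s' + zmult k t" "(a', s') \<in> \<Gamma>"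
      "b = b' + of_int l * e" "u = u' + zmult l t" "(b', u') \<in> \<Gamma>" unfolding \<Gamma>'_def by blast
    have "a - b = (a' - b') + of_int (k - l) * e" unfolding * by (simp add: algebra_simps)
    moreover have "s - u = (s' - u') + zmult (k - l) t"
      unfolding * using zmult_add_left[of k "- l" t] by (simp add: zmult_minus_left)
    ultimately show "(a - b, s - u) \<in> \<Gamma>'"
      unfolding \<Gamma>'_def using hom_graph_diff[OF \<Gamma> *(3,6)] by blast
  next
    fix u assume "(0, u) \<in> \<Gamma>'"
    then obtain a s k where *: "0 = a + of_int k * e" "u = s + zmult k t" "(a, s) \<in> \<Gamma>"
      unfolding \<Gamma>'_def by blast
    have "of_int k * e = - a" using *(1) by (metis add.commute add_eq_0_iff)
    then have "k \<in> K" unfolding K_def using hom_graph_minus[OF \<Gamma> *(3)] by auto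
    then have "(a + of_int k * e, s + zmult k t) \<in> \<Gamma>"
      using hom_graph_add[OF \<Gamma> *(3)] t by blast
    then show "u = 0" using * \<Gamma> by (simp add: hom_graph_def)
  qed
  ultimately show ?thesis by blast
qed

text \<open>The circle is an injective abelian group: a maximal partial homomorphism is total, since
  otherwise \<open>hom_graph_extend\<close> would enlarge it.\<close>

lemma hom_extension:
  fixes \<Gamma>0 :: "('a::comm_ring_1 \<times> add_circle) set"
  assumes "hom_graph \<Gamma>0"
  obtains \<psi> where "\<And>a b. \<psi> (a + b) = \<psi> a + \<psi> b" "\<And>a t. (a, t) \<in> \<Gamma>0 \<Longrightarrow> \<psi> a = t"
proof -
  let ?A = "{\<Gamma>. hom_graph \<Gamma> \<and> \<Gamma>0 \<subseteq> \<Gamma>}"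
  have "\<exists>M\<in>?A. \<forall>X\<in>?A. M \<subseteq> X \<longrightarrow> X = M"
  proof (rule subset_Zorn_nonempty)
    show "?A \<noteq> {}" using assms by blast
    fix C assume C: "C \<noteq> {}" "subset.chain ?A C"
    then have CA: "C \<subseteq> ?A" and lin: "\<And>X Y. X \<in> C \<Longrightarrow> Y \<in> C \<Longrightarrow> X \<subseteq> Y \<or> Y \<subseteq> X"
      by (auto simp: subset_chain_def)
    have "hom_graph (\<Union>C)"
      unfolding hom_graph_def
    proof (intro conjI allI impI)
      show "(0, 0) \<in> \<Union>C" using C(1) CA by (auto simp: hom_graph_def)
      fix a s b t assume "(a, s) \<in> \<Union>C" "(b, t) \<in> \<Union>C"
      then obtain X Y where "X \<in> C" "(a, s) \<in> X" "Y \<in> C" "(b, t) \<in> Y" by blast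
      then obtain Z where "Z \<in> C" "(a, s) \<in> Z" "(b, t) \<in> Z" using lin[of X Y] by blast
      then show "(a - b, s - t) \<in> \<Union>C" using CA hom_graph_diff by blast
    next
      fix t assume "(0, t) \<in> \<Union>C"
      then show "t = 0" using CA by (auto simp: hom_graph_def)
    qed
    moreover have "\<Gamma>0 \<subseteq> \<Union>C" using C(1) CA by blast
    ultimately show "\<Union>C \<in> ?A" by simp
  qed
  then obtain M where "M \<in> ?A" and "\<forall>X\<in>?A. M \<subseteq> X \<longrightarrow> X = M" by (rule bexE)
  then have M: "hom_graph M" "\<Gamma>0 \<subseteq> M"
    and max: "\<And>X. hom_graph X \<Longrightarrow> \<Gamma>0 \<subseteq> X \<Longrightarrow> M \<subseteq> X \<Longrightarrow> X = M"
    by simp_all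
  have total: "\<exists>t. (e, t) \<in> M" for e
  proof -
    obtain \<Gamma>' t where "hom_graph \<Gamma>'" "M \<subseteq> \<Gamma>'" "(e, t) \<in> \<Gamma>'"
      using hom_graph_extend[OF M(1)] by blast
    then show ?thesis using max[of \<Gamma>'] M(2) by blast
  qed
  have unique: "s = t" if "(e, s) \<in> M" "(e, t) \<in> M" for e s t
  proof -
    have "(0, s - t) \<in> M" using hom_graph_diff[OF M(1) that] by simp
    then have "s - t = 0" using M(1) unfolding hom_graph_def by blast
    then show ?thesis by simp
  qed
  define \<psi> where "\<psi> = (\<lambda>e. SOME t. (e, t) \<in> M)"
  have \<psi>: "(e, \<psi> e) \<in> M" for e unfolding \<psi>_def using total by (rule someI_ex)
  show ?thesis
  proof (rule that)
    show "\<psi> (a + b) = \<psi> a + \<psi> b" for a b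
      using unique[OF \<psi> hom_graph_add[OF M(1) \<psi> \<psi>]] .
    show "\<psi> a = t" if "(a, t) \<in> \<Gamma>0" for a t
      using unique[OF \<psi>] M(2) that by blast
  qed
qed

section \<open>Surjectivity of multiplication on the principal group\<close>

text \<open>The Pontryagin pairing between Laurent polynomials and circle-valued configurations;
  \<open>principal_group f\<close> is the annihilator of the ideal generated by
  \<open>f\<close>.\<close>

definition circle_pairing :: "'d::finite laurent \<Rightarrow> (int ^ 'd \<Rightarrow> add_circle) \<Rightarrow> add_circle"
  where "circle_pairing b y = (\<Sum>n\<in>keys b. zmult (lookup b n) (y n))"

lemma circle_pairing_add: "circle_pairing (a + b) y = circle_pairing a y + circle_pairing b y"
proof -
  let ?A = "keys a \<union> keys b"
  have sup: "circle_pairing c y = (\<Sum>n\<in>?A. zmult (lookup c n) (y n))"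
    if "keys c \<subseteq> ?A" for c
    unfolding circle_pairing_def using that
    by (intro sum.mono_neutral_left) (auto simp: in_keys_iff)
  show ?thesis
    using keys_add[of a b] by (simp add: sup lookup_add zmult_add_left sum.distrib)
qed

lemma circle_pairing_single_mult:
  "circle_pairing (single k c * b) y =
    zmult c (\<Sum>n\<in>keys b. zmult (lookup b n) (y (k + n)))"
proof -
  have "circle_pairing (single k c * b) y =
      (\<Sum>n\<in>(+) k ` keys b. zmult (c * lookup b (n - k)) (y n))"
    unfolding circle_pairing_def lookup_single_times
  proof (intro sum.mono_neutral_left ballI)
    show "keys (single k c * b) \<subseteq> (+) k ` keys b"
    proof
      fix n assume "n \<in> keys (single k c * b)"
      then have "n - k \<in> keys b" by (auto simp: in_keys_iff lookup_single_times)
      then show "n \<in> (+) k ` keys b" by (intro image_eqI[of _ _ "n - k"]) simp_all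
    qed
    fix n assume "n \<in> (+) k ` keys b - keys (single k c * b)"
    then have "c * lookup b (n - k) = 0"
      by (metis DiffD2 in_keys_iff lookup_single_times)
    then show "zmult (c * lookup b (n - k)) (y n) = 0" by (simp only: zmult_zero_left)
  qed simp
  also have "\<dots> = zmult c (\<Sum>n\<in>keys b. zmult (lookup b n) (y (k + n)))"
    by (subst sum.reindex) (auto simp: zmult_zmult zmult_sum)
  finally show ?thesis .
qed

lemma laurent_sum_singles: "a = (\<Sum>k\<in>keys a. single k (lookup a k))"
  by (rule poly_mapping_eqI) (simp add: lookup_sum lookup_single when_def in_keys_iff)

lemma circle_pairing_mult_eq_0:
  assumes "y \<in> principal_group f"
  shows "circle_pairing (a * f) y = 0"
proof -
  have "circle_pairing ((\<Sum>k\<in>A. single k (lookup a k)) * f) y = 0" if "finite A" for A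
    using that
  proof (induction A rule: finite_induct)
    case empty
    then show ?case by (simp add: circle_pairing_def)
  next
    case (insert k A)
    have "circle_pairing (single k (lookup a k) * f) y = 0"
      unfolding circle_pairing_single_mult using assms by (simp add: principal_group_def zmult_0)
    then show ?case using insert by (simp add: distrib_right circle_pairing_add)
  qed
  from this[of "keys a"] show ?thesis by (simp flip: laurent_sum_singles)
qed

text \<open>In dual terms: the homomorphism that sends \<open>a * f + b * G\<close> to the pairing
  of \<open>b\<close> with \<open>y\<close> is defined on the ideal generated by \<open>f\<close>
  and \<open>G\<close>. An extension to the whole ring kills the multiples of \<open>f\<close>, so
  its values on monomials form a point \<open>z\<close> of the group, and its values on multiples of
  \<open>G\<close> say that \<open>G\<close> maps \<open>z\<close> to \<open>y\<close>.\<close>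

lemma principal_group_surjective:
  fixes f G :: "'d::finite laurent"
  assumes f: "prime_elem f" "\<not> f dvd G" and y: "y \<in> principal_group f"
  obtains z where "z \<in> principal_group f"
    "\<And>m. (\<Sum>n\<in>keys G. zmult (lookup G n) (z (m + n))) = y m"
proof -
  define \<Gamma> where "\<Gamma> = {(a * f + b * G, circle_pairing b y) | a b. True}"
  have \<Gamma>I: "(a * f + b * G, circle_pairing b y) \<in> \<Gamma>" for a b unfolding \<Gamma>_def by blast
  have pairing0: "circle_pairing 0 y = 0" by (simp add: circle_pairing_def)
  have pairing_diff: "circle_pairing (a - b) y = circle_pairing a y - circle_pairing b y" for a b
    using circle_pairing_add[of "a - b" b y] by simp
  have "hom_graph \<Gamma>"
    unfolding hom_graph_def
  proof (intro conjI allI impI)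
    show "(0, 0) \<in> \<Gamma>" using \<Gamma>I[of 0 0] by (simp add: pairing0)
    fix a s b t assume "(a, s) \<in> \<Gamma>" "(b, t) \<in> \<Gamma>"
    then obtain a1 a2 b1 b2 where "a = a1 * f + a2 * G" "s = circle_pairing a2 y"
      "b = b1 * f + b2 * G" "t = circle_pairing b2 y" unfolding \<Gamma>_def by blast
    then show "(a - b, s - t) \<in> \<Gamma>"
      using \<Gamma>I[of "a1 - b1" "a2 - b2"] by (simp add: pairing_diff algebra_simps)
  next
    fix t assume "(0, t) \<in> \<Gamma>"
    \<comment> \<open>Well-definedness: a relation \<open>a * f + b * G = 0\<close> forces
      \<open>f\<close> to divide \<open>b\<close>, by primality, and \<open>y\<close> annihilates
      the multiples of \<open>f\<close>.\<close>
    then obtain a b where ab: "0 = a * f + b * G" "t = circle_pairing b y" unfolding \<Gamma>_def by blast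
    have "b * G = f * (- a)" using ab(1) by (simp add: algebra_simps eq_neg_iff_add_eq_0)
    then have "f dvd b * G" by simp
    then have "f dvd b" using f by (auto simp: prime_elem_def)
    then obtain c where "b = f * c" by (auto elim: dvdE)
    then show "t = 0" using circle_pairing_mult_eq_0[OF y, of c] ab(2) by (simp add: mult.commute)
  qed
  then obtain \<psi> where \<psi>: "\<And>a b. \<psi> (a + b) = \<psi> a + \<psi> b" "\<And>a t. (a, t) \<in> \<Gamma> \<Longrightarrow> \<psi> a = t"
    by (rule hom_extension) blast
  define z where "z = (\<lambda>n. \<psi> (single n 1))"
  have eval: "(\<Sum>n\<in>keys b. zmult (lookup b n) (z (m + n))) =
      \<psi> (single m 1 * b)" for b m
  proof -
    have 0: "\<psi> 0 = 0" using \<psi>(1)[of 0 0] by simp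
    have sum: "\<psi> (\<Sum>k\<in>A. h k) = (\<Sum>k\<in>A. \<psi> (h k))" for h and A :: "(int ^ 'd) set"
      by (induction A rule: infinite_finite_induct) (simp_all add: 0 \<psi>(1))
    have "single m 1 * b =
        (\<Sum>n\<in>keys b. of_int (lookup b n) * single (m + n) 1)"
      by (subst laurent_sum_singles[of b])
        (simp add: sum_distrib_left mult_single flip: single_of_int)
    then show ?thesis by (simp add: sum additive_zmult[OF \<psi>(1)] z_def)
  qed
  show ?thesis
  proof (rule that[of z])
    show "z \<in> principal_group f"
      using \<psi>(2)[OF \<Gamma>I[of _ 0]] by (simp add: principal_group_def eval pairing0)
    fix m
    have "\<psi> (single m 1 * G) = circle_pairing (single m 1) y"
      using \<psi>(2)[OF \<Gamma>I[of 0 "single m 1"]] by simp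
    then show "(\<Sum>n\<in>keys G. zmult (lookup G n) (z (m + n))) = y m"
      unfolding eval by (simp add: circle_pairing_def)
  qed
qed

section \<open>Sign changes and dimension\<close>

definition sign_changes :: "('a::metric_space \<Rightarrow> real) \<Rightarrow> 'a set"
  where "sign_changes F = {p. \<forall>e>0. (\<exists>x\<in>ball p e. F x > 0) \<and> (\<exists>x\<in>ball p e. F x < 0)}"

lemma sign_changes_zero:
  fixes F :: "'a::metric_space \<Rightarrow> real"
  assumes "continuous_on UNIV F" "p \<in> sign_changes F"
  shows "F p = 0"
proof (rule ccontr)
  assume "F p \<noteq> 0"
  then obtain e where e: "e > 0" "\<And>x. dist x p < e \<Longrightarrow> dist (F x) (F p) < \<bar>F p\<bar>"
    using assms(1) unfolding continuous_on_iff by (metis UNIV_I zero_less_abs_iff)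
  obtain x y where "x \<in> ball p e" "F x > 0" "y \<in> ball p e" "F y < 0"
    using assms(2) e(1) unfolding sign_changes_def by blast
  then show False using e(2)[of x] e(2)[of y] by (auto simp: dist_commute dist_real_def split: abs_split)
qed

text \<open>Away from the sign changes, every point has a neighbourhood on which \<open>F\<close> is
  nonnegative or one on which it is nonpositive. These two open conditions exclude each other
  because the zero set of \<open>F\<close> has no interior.\<close>

lemma constant_sign_on_connected:
  fixes F :: "'a::metric_space \<Rightarrow> real"
  assumes W: "connected W" "W \<inter> sign_changes F = {}"
    and dense: "\<And>x e. e > 0 \<Longrightarrow> \<exists>y\<in>ball x e. F y \<noteq> 0"
  shows "(\<forall>x\<in>W. F x \<ge> 0) \<or> (\<forall>x\<in>W. F x \<le> 0)"
proof -
  define A where "A = {x. \<exists>e>0. \<forall>y\<in>ball x e. F y \<ge> 0}"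
  define B where "B = {x. \<exists>e>0. \<forall>y\<in>ball x e. F y \<le> 0}"
  have op: "open {x. \<exists>e>0. \<forall>y\<in>ball x e. Q y}" for Q :: "'a \<Rightarrow> bool"
  proof -
    have "\<exists>e>0. ball x e \<subseteq> {x. \<exists>e>0. \<forall>y\<in>ball x e. Q y}" if "e > 0" "\<forall>y\<in>ball x e. Q y" for x e
    proof (intro exI[of _ "e/2"] conjI subsetI CollectI)
      show "e / 2 > 0" using that by simp
      fix y assume y: "y \<in> ball x (e/2)"
      have "z \<in> ball x e" if z: "z \<in> ball y (e/2)" for z
        using dist_triangle_half_r[of y x e z] y z by (simp add: dist_commute)
      then show "\<forall>z\<in>ball y (e/2). Q z" using that by blast
    qed (use that in simp)
    then show ?thesis unfolding open_contains_ball by blast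
  qed
  have "A \<inter> B = {}"
  proof (rule equals0I)
    fix x assume "x \<in> A \<inter> B"
    then obtain e e' where e: "e > 0" "\<forall>y\<in>ball x e. F y \<ge> 0" "e' > 0" "\<forall>y\<in>ball x e'. F y \<le> 0"
      unfolding A_def B_def by blast
    obtain y where "y \<in> ball x (min e e')" "F y \<noteq> 0" using dense[of "min e e'" x] e by auto
    then show False using e by force
  qed
  moreover have "W \<subseteq> A \<union> B"
  proof
    fix x assume "x \<in> W"
    then obtain e where "e > 0" "\<not> ((\<exists>y\<in>ball x e. F y > 0) \<and> (\<exists>y\<in>ball x e. F y < 0))"
      using W(2) unfolding sign_changes_def by blast
    then show "x \<in> A \<union> B" unfolding A_def B_def by (auto simp: not_less)
  qed
  moreover have "open A" "open B" unfolding A_def B_def by (rule op)+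
  ultimately have "A \<inter> W = {} \<or> B \<inter> W = {}" using connectedD[OF W(1), of A B] by blast
  then have "W \<subseteq> B \<or> W \<subseteq> A" using \<open>W \<subseteq> A \<union> B\<close> by blast
  moreover have "F x \<ge> 0" if "x \<in> A" for x using that unfolding A_def by force
  moreover have "F x \<le> 0" if "x \<in> B" for x using that unfolding B_def by force
  ultimately show ?thesis by blast
qed

lemma nonneg_at_left_end:
  fixes \<phi> :: "real \<Rightarrow> real"
  assumes "continuous_on UNIV \<phi>" "a < b" "\<And>x. a < x \<Longrightarrow> x \<le> b \<Longrightarrow> \<phi> x \<ge> 0"
  shows "\<phi> a \<ge> 0"
  by (rule continuous_ge_on_closure[of "{a<..b}"])
    (use assms in \<open>auto intro: continuous_on_subset\<close>)

lemma nonneg_at_right_end: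
  fixes \<phi> :: "real \<Rightarrow> real"
  assumes "continuous_on UNIV \<phi>" "a < b" "\<And>x. a \<le> x \<Longrightarrow> x < b \<Longrightarrow> \<phi> x \<ge> 0"
  shows "\<phi> b \<ge> 0"
  by (rule continuous_ge_on_closure[of "{a..<b}"])
    (use assms in \<open>auto intro: continuous_on_subset\<close>)

text \<open>Near \<open>p\<close> the zero set of \<open>G\<close> is a graph over the hyperplane orthogonal to \<open>v\<close>. The function
  \<open>F\<close> does not change sign on either side of it, so the sign change at \<open>p\<close> takes place across the
  graph, on which \<open>F\<close> therefore vanishes.\<close>

lemma zero_hypersurface_at_sign_change:
  fixes F G G' :: "'a::euclidean_space \<Rightarrow> real" and v p :: 'a
  assumes cont: "continuous_on UNIV F" "continuous_on UNIV G" "continuous_on UNIV G'"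
    and der: "\<And>t s. ((\<lambda>s. G (t + s *\<^sub>R v)) has_real_derivative G' (t + s *\<^sub>R v)) (at s)"
    and v: "norm v = 1"
    and dense: "\<And>x e. e > 0 \<Longrightarrow> \<exists>y\<in>ball x e. F y \<noteq> 0"
    and G0: "\<And>x. x \<in> sign_changes F \<Longrightarrow> G x = 0"
    and p: "p \<in> sign_changes F" "G' p > 0" and \<rho>: "\<rho> > 0"
  obtains g r where "r > 0" "continuous_on {h. h \<bullet> v = 0 \<and> norm h \<le> r} g"
    "inj_on g {h. h \<bullet> v = 0 \<and> norm h \<le> r}"
    "\<And>h. h \<bullet> v = 0 \<Longrightarrow> norm h \<le> r \<Longrightarrow> g h \<in> cball p \<rho> \<and> F (g h) = 0"
proof -
  have vv: "v \<bullet> v = 1" using v by (simp add: norm_eq_1)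
  obtain \<delta> where \<delta>: "\<delta> > 0" "\<And>x. dist x p < \<delta> \<Longrightarrow> G' x > 0"
  proof -
    have "open {x. G' x > 0}" using cont(3) by (simp add: open_Collect_less)
    then show ?thesis using p(2) that unfolding open_dist by auto
  qed
  \<comment> \<open>A third, so that a displacement by \<open>h\<close> and then by
    \<open>s *\<^sub>R v\<close>, both of length at most \<open>r\<close>, stays within both
    \<open>\<delta>\<close> and \<open>\<rho>\<close>.\<close>
  define r where "r = min \<delta> \<rho> / 3"
  have r: "r > 0" "2 * r < \<delta>" "2 * r < \<rho>" unfolding r_def using \<delta>(1) \<rho> by (auto simp: min_def)
  have mono: "G (p + h + s *\<^sub>R v) < G (p + h + s' *\<^sub>R v)" if "norm h \<le> r" "- r \<le> s" "s < s'" "s' \<le> r" for h s s'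
  proof (rule DERIV_pos_imp_increasing[of s s' "\<lambda>s. G (p + h + s *\<^sub>R v)", OF that(3)])
    fix x assume x: "s \<le> x" "x \<le> s'"
    have "norm (h + x *\<^sub>R v) \<le> norm h + \<bar>x\<bar>" using norm_triangle_ineq[of h "x *\<^sub>R v"] v by simp
    also have "\<dots> < \<delta>" using that x r by simp
    finally have "G' (p + h + x *\<^sub>R v) > 0" by (intro \<delta>(2)) (simp add: dist_norm add.assoc)
    then show "\<exists>y. ((\<lambda>s. G (p + h + s *\<^sub>R v)) has_real_derivative y) (at x) \<and> y > 0"
      using der[of "p + h" x] by blast
  qed
  have Gp: "G p = 0" using G0 p(1) by simp
  have ends: "G (p + r *\<^sub>R v) > 0" "G (p - r *\<^sub>R v) < 0"
    using mono[of 0 0 r] mono[of 0 "- r" 0] r Gp by simp_all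
  have "open {h. G (p + h + r *\<^sub>R v) > 0}" "open {h. G (p + h - r *\<^sub>R v) < 0}"
    by (intro open_Collect_less continuous_intros continuous_on_compose2[OF cont(2)]; simp)+
  then have "open ({h. G (p + h + r *\<^sub>R v) > 0} \<inter> {h. G (p + h - r *\<^sub>R v) < 0})" by (rule open_Int)
  moreover have "0 \<in> {h. G (p + h + r *\<^sub>R v) > 0} \<inter> {h. G (p + h - r *\<^sub>R v) < 0}" using ends by simp
  ultimately obtain r0 where r0: "r0 > 0"
    "cball 0 r0 \<subseteq> {h. G (p + h + r *\<^sub>R v) > 0} \<inter> {h. G (p + h - r *\<^sub>R v) < 0}"
    using open_contains_cball by metis
  \<comment> \<open>On this smaller disc the signs of \<open>G\<close> at the heights
    \<open>r\<close> and \<open>- r\<close> persist by continuity, so each vertical segment over it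
    crosses the zero set of \<open>G\<close>.\<close>
  define r' where "r' = min r0 r"
  have r': "r' > 0" "r' \<le> r" "\<And>h. norm h \<le> r' \<Longrightarrow> G (p + h + r *\<^sub>R v) > 0"
    "\<And>h. norm h \<le> r' \<Longrightarrow> G (p + h - r *\<^sub>R v) < 0"
    unfolding r'_def using r0 r by (auto simp: subset_iff)
  define D where "D = {h. h \<bullet> v = 0 \<and> norm h \<le> r'}"
  define \<pi> where "\<pi> = (\<lambda>x. x - p - ((x - p) \<bullet> v) *\<^sub>R v)"
  define M where "M = {x. G x = 0 \<and> \<bar>(x - p) \<bullet> v\<bar> \<le> r \<and> norm (\<pi> x) \<le> r'}"
  have \<pi>_cont: "continuous_on S \<pi>" for S unfolding \<pi>_def by (intro continuous_intros)
  have \<pi>v: "\<pi> x \<bullet> v = 0" for x unfolding \<pi>_def by (simp add: inner_diff_left vv)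
  have split: "x = p + \<pi> x + ((x - p) \<bullet> v) *\<^sub>R v" for x unfolding \<pi>_def by simp
  have \<pi>_point: "\<pi> (p + h + s *\<^sub>R v) = h" "(p + h + s *\<^sub>R v - p) \<bullet> v = s" if "h \<bullet> v = 0" for h s
  proof -
    show 1: "(p + h + s *\<^sub>R v - p) \<bullet> v = s" using that by (simp add: inner_add_left vv)
    show "\<pi> (p + h + s *\<^sub>R v) = h" unfolding \<pi>_def 1 by simp
  qed
  have M_ball: "M \<subseteq> cball p \<rho>"
  proof
    fix x assume "x \<in> M"
    then have "norm (\<pi> x) + \<bar>(x - p) \<bullet> v\<bar> \<le> 2 * r" using r'(2) unfolding M_def by simp
    moreover have "norm (x - p) \<le> norm (\<pi> x) + norm (((x - p) \<bullet> v) *\<^sub>R v)"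
      using norm_triangle_ineq[of "\<pi> x" "((x - p) \<bullet> v) *\<^sub>R v"] unfolding \<pi>_def by simp
    ultimately show "x \<in> cball p \<rho>" using v r(3) by (simp add: dist_norm norm_minus_commute)
  qed
  have "closed M"
    unfolding M_def
    by (intro closed_Collect_conj closed_Collect_eq closed_Collect_le continuous_intros cont \<pi>_cont)
  then have "compact M" using M_ball bounded_subset[OF bounded_cball] by (auto simp: compact_eq_bounded_closed)
  have surj: "\<exists>s. - r < s \<and> s < r \<and> G (p + h + s *\<^sub>R v) = 0" if h: "norm h \<le> r'" for h
  proof -
    have "continuous_on {- r..r} (\<lambda>s. G (p + h + s *\<^sub>R v))"
      by (intro continuous_intros continuous_on_compose2[OF cont(2)]) simp
    then obtain s where s: "- r \<le> s" "s \<le> r" "G (p + h + s *\<^sub>R v) = 0"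
      using IVT'[of "\<lambda>s. G (p + h + s *\<^sub>R v)" "- r" 0 r] r'(3,4)[OF h] r(1) by auto
    then have "s \<noteq> r" "s \<noteq> - r" using r'(3,4)[OF h] by auto
    then show ?thesis using s by (intro exI[of _ s]) auto
  qed
  have "\<pi> ` M = D"
  proof
    show "\<pi> ` M \<subseteq> D" unfolding D_def using \<pi>v by (auto simp: M_def)
    show "D \<subseteq> \<pi> ` M"
    proof
      fix h assume h: "h \<in> D"
      then obtain s where s: "- r < s" "s < r" "G (p + h + s *\<^sub>R v) = 0" using surj unfolding D_def by blast
      then have "p + h + s *\<^sub>R v \<in> M" using h \<pi>_point[of h s] unfolding M_def D_def by simp
      then show "h \<in> \<pi> ` M" using \<pi>_point(1)[of h s] h unfolding D_def by force
    qed
  qed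
  moreover have "inj_on \<pi> M"
  proof (rule inj_onI)
    fix x y assume xy: "x \<in> M" "y \<in> M" "\<pi> x = \<pi> y"
    have *: "\<not> (x - p) \<bullet> v < (y - p) \<bullet> v" if "x \<in> M" "y \<in> M" "\<pi> x = \<pi> y" for x y
      using mono[of "\<pi> x" "(x - p) \<bullet> v" "(y - p) \<bullet> v"] that split[of x] split[of y] r'(2)
      unfolding M_def by (auto simp: abs_le_iff)
    have "(x - p) \<bullet> v = (y - p) \<bullet> v" using *[OF xy] *[OF xy(2,1) xy(3)[symmetric]] by simp
    then show "x = y" using split[of x] split[of y] xy(3) by metis
  qed
  \<comment> \<open>The projection is a continuous bijection from a compact set onto the disc, so
    its inverse is continuous. This yields the graph without differentiating it.\<close>
  ultimately obtain g where g: "homeomorphism M D \<pi> g"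
    using homeomorphism_compact[OF \<open>compact M\<close> \<pi>_cont] by blast
  define Wu where "Wu = {x. \<pi> x \<in> D \<and> \<bar>(x - p) \<bullet> v\<bar> \<le> r \<and> G x > 0}"
  define Wl where "Wl = {x. \<pi> x \<in> D \<and> \<bar>(x - p) \<bullet> v\<bar> \<le> r \<and> G x < 0}"
  have convD: "convex D"
  proof -
    have "D = {h. v \<bullet> h = 0} \<inter> cball 0 r'" unfolding D_def by (auto simp: inner_commute)
    then show ?thesis by (simp add: convex_Int convex_hyperplane)
  qed
  have 0: "0 \<in> D" unfolding D_def using r'(1) by simp
  \<comment> \<open>Each point is joined, by a vertical segment inside the set, to the disc at
    height \<open>\<tau>\<close>. The choices are the top disc for \<open>G > 0\<close> and the
    bottom disc for \<open>G < 0\<close>.\<close>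
  have conn: "connected {x. \<pi> x \<in> D \<and> \<bar>(x - p) \<bullet> v\<bar> \<le> r \<and> Q x}" (is "connected ?W")
    if top: "\<bar>\<tau>\<bar> \<le> r" "\<And>h. h \<in> D \<Longrightarrow> Q (p + h + \<tau> *\<^sub>R v)"
      and seg: "\<And>h s s'. h \<in> D \<Longrightarrow> \<bar>s\<bar> \<le> r \<Longrightarrow> Q (p + h + s *\<^sub>R v) \<Longrightarrow>
        s' \<in> closed_segment s \<tau> \<Longrightarrow> Q (p + h + s' *\<^sub>R v)" for Q \<tau>
  proof -
    define Top where "Top = (\<lambda>h. p + h + \<tau> *\<^sub>R v) ` D"
    have cT: "connected Top" unfolding Top_def
      by (intro connected_continuous_image continuous_intros convex_connected convD)
    define V where "V = (\<lambda>x. (\<lambda>s. p + \<pi> x + s *\<^sub>R v) ` closed_segment ((x - p) \<bullet> v) \<tau>)"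
    have cV: "connected (V x)" for x unfolding V_def
      by (intro connected_continuous_image continuous_intros connected_segment)
    have TW: "Top \<subseteq> ?W"
    proof
      fix y assume "y \<in> Top"
      then obtain h where h: "h \<in> D" "y = p + h + \<tau> *\<^sub>R v" unfolding Top_def by blast
      then have "h \<bullet> v = 0" unfolding D_def by simp
      then show "y \<in> ?W" using h top \<pi>_point[of h \<tau>] by simp
    qed
    have VW: "V x \<subseteq> ?W" if x: "x \<in> ?W" for x
    proof
      fix y assume "y \<in> V x"
      then obtain s where s: "s \<in> closed_segment ((x - p) \<bullet> v) \<tau>" "y = p + \<pi> x + s *\<^sub>R v"
        unfolding V_def by blast
      have "\<bar>s\<bar> \<le> r" using s(1) x top(1) by (auto simp: closed_segment_eq_real_ivl split: if_splits)
      moreover have "Q y" unfolding s(2) by (rule seg[OF _ _ _ s(1)]) (use x split[of x] in auto)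
      ultimately show "y \<in> ?W" using x s(2) \<pi>_point[OF \<pi>v] by simp
    qed
    have cTV: "connected (Top \<union> V x)" if x: "x \<in> ?W" for x
    proof (rule connected_Un[OF cT cV])
      have "p + \<pi> x + \<tau> *\<^sub>R v \<in> Top \<inter> V x" unfolding Top_def V_def using x by auto
      then show "Top \<inter> V x \<noteq> {}" by blast
    qed
    have "?W = \<Union> ((\<lambda>x. Top \<union> V x) ` ?W)"
    proof
      show "?W \<subseteq> \<Union> ((\<lambda>x. Top \<union> V x) ` ?W)"
      proof
        fix x assume x: "x \<in> ?W"
        have "x \<in> V x" unfolding V_def using split[of x] by (intro image_eqI[of _ _ "(x - p) \<bullet> v"]) auto
        then show "x \<in> \<Union> ((\<lambda>x. Top \<union> V x) ` ?W)" using x by blast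
      qed
      show "\<Union> ((\<lambda>x. Top \<union> V x) ` ?W) \<subseteq> ?W" using TW VW by blast
    qed
    moreover have "connected (\<Union> ((\<lambda>x. Top \<union> V x) ` ?W))"
    proof (rule connected_Union)
      show "connected S" if "S \<in> (\<lambda>x. Top \<union> V x) ` ?W" for S using that cTV by blast
      have "p + 0 + \<tau> *\<^sub>R v \<in> Top" unfolding Top_def using 0 by blast
      then show "\<Inter> ((\<lambda>x. Top \<union> V x) ` ?W) \<noteq> {}" by blast
    qed
    ultimately show ?thesis by simp
  qed
  have monoD: "G (p + h + s *\<^sub>R v) < G (p + h + s' *\<^sub>R v)" if "h \<in> D" "- r \<le> s" "s < s'" "s' \<le> r" for h s s'
    using mono[of h s s'] that r'(2) unfolding D_def by simp
  have "connected Wu"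
    unfolding Wu_def
  proof (rule conn[of r])
    show "G (p + h + s' *\<^sub>R v) > 0" if "h \<in> D" "\<bar>s\<bar> \<le> r" "G (p + h + s *\<^sub>R v) > 0" "s' \<in> closed_segment s r" for h s s'
      using monoD[of h s s'] that by (cases "s = s'") (auto simp: closed_segment_eq_real_ivl abs_le_iff split: if_splits)
  qed (use r r'(3) in \<open>auto simp: D_def\<close>)
  moreover have "connected Wl"
    unfolding Wl_def
  proof (rule conn[of "- r"])
    show "G (p + h + s' *\<^sub>R v) < 0" if "h \<in> D" "\<bar>s\<bar> \<le> r" "G (p + h + s *\<^sub>R v) < 0" "s' \<in> closed_segment s (- r)" for h s s'
      using monoD[of h s' s] that by (cases "s = s'") (auto simp: closed_segment_eq_real_ivl abs_le_iff split: if_splits)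
  qed (use r r'(4) in \<open>auto simp: D_def\<close>)
  moreover have "Wu \<inter> sign_changes F = {}" "Wl \<inter> sign_changes F = {}"
    unfolding Wu_def Wl_def using G0 by force+
  ultimately have signs: "(\<forall>x\<in>Wu. F x \<ge> 0) \<or> (\<forall>x\<in>Wu. - F x \<ge> 0)" "(\<forall>x\<in>Wl. F x \<ge> 0) \<or> (\<forall>x\<in>Wl. - F x \<ge> 0)"
    using constant_sign_on_connected[OF _ _ dense] by auto
  have line: "continuous_on UNIV (\<lambda>s. F (p + h + s *\<^sub>R v))" "continuous_on UNIV (\<lambda>s. - F (p + h + s *\<^sub>R v))" for h
    by (intro continuous_intros continuous_on_compose2[OF cont(1)]; simp)+
  have Mpoint: "\<exists>h s. x = p + h + s *\<^sub>R v \<and> h \<in> D \<and> - r < s \<and> s < r \<and> G (p + h + s *\<^sub>R v) = 0" if x: "x \<in> M" for x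
  proof -
    have h: "\<pi> x \<in> D" "norm (\<pi> x) \<le> r'" using x \<pi>v unfolding M_def D_def by auto
    have "(x - p) \<bullet> v \<noteq> r" "(x - p) \<bullet> v \<noteq> - r"
      using r'(3,4)[OF h(2)] split[of x] x unfolding M_def by auto
    then show ?thesis using split[of x] h x unfolding M_def
      by (intro exI[of _ "\<pi> x"] exI[of _ "(x - p) \<bullet> v"]) auto
  qed
  have up: "\<sigma> * F x \<ge> 0" if "x \<in> M" "\<forall>x\<in>Wu. \<sigma> * F x \<ge> 0" for x \<sigma>
  proof -
    obtain h s where x: "x = p + h + s *\<^sub>R v" "h \<in> D" "- r < s" "s < r" "G (p + h + s *\<^sub>R v) = 0"
      using Mpoint[OF \<open>x \<in> M\<close>] by blast
    have hv: "h \<bullet> v = 0" using x(2) unfolding D_def by simp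
    have "p + h + s' *\<^sub>R v \<in> Wu" if "s < s'" "s' \<le> r" for s'
      unfolding Wu_def using monoD[OF x(2), of s s'] x that \<pi>_point[OF hv, of s'] by auto
    then have "\<sigma> * F (p + h + s *\<^sub>R v) \<ge> 0"
      by (intro nonneg_at_left_end[of "\<lambda>s. \<sigma> * F (p + h + s *\<^sub>R v)" s r])
        (use x(4) that(2) line in \<open>auto intro!: continuous_intros\<close>)
    then show ?thesis unfolding x(1) .
  qed
  have down: "\<sigma> * F x \<ge> 0" if "x \<in> M" "\<forall>x\<in>Wl. \<sigma> * F x \<ge> 0" for x \<sigma>
  proof -
    obtain h s where x: "x = p + h + s *\<^sub>R v" "h \<in> D" "- r < s" "s < r" "G (p + h + s *\<^sub>R v) = 0"
      using Mpoint[OF \<open>x \<in> M\<close>] by blast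
    have hv: "h \<bullet> v = 0" using x(2) unfolding D_def by simp
    have "p + h + s' *\<^sub>R v \<in> Wl" if "- r \<le> s'" "s' < s" for s'
      unfolding Wl_def using monoD[OF x(2), of s' s] x that \<pi>_point[OF hv, of s'] by auto
    then have "\<sigma> * F (p + h + s *\<^sub>R v) \<ge> 0"
      by (intro nonneg_at_right_end[of "\<lambda>s. \<sigma> * F (p + h + s *\<^sub>R v)" "- r" s])
        (use x(3) that(2) line in \<open>auto intro!: continuous_intros\<close>)
    then show ?thesis unfolding x(1) .
  qed
  \<comment> \<open>Equal signs on both sides would extend to the graph by continuity and give
    \<open>F\<close> one sign on a ball around the sign change \<open>p\<close>.\<close>
  have not_both: "\<not> ((\<forall>x\<in>Wu. \<sigma> * F x \<ge> 0) \<and> (\<forall>x\<in>Wl. \<sigma> * F x \<ge> 0))" if "\<sigma> = 1 \<or> \<sigma> = - 1" for \<sigma> :: real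
  proof
    assume H: "(\<forall>x\<in>Wu. \<sigma> * F x \<ge> 0) \<and> (\<forall>x\<in>Wl. \<sigma> * F x \<ge> 0)"
    have "\<sigma> * F x \<ge> 0" if x: "x \<in> ball p r'" for x
    proof -
      have nx: "norm (x - p) < r'" using x by (simp add: dist_norm norm_minus_commute)
      have "\<bar>(x - p) \<bullet> v\<bar> \<le> norm (x - p)" using Cauchy_Schwarz_ineq2[of "x - p" v] v by simp
      then have 1: "\<bar>(x - p) \<bullet> v\<bar> \<le> r" using nx r'(2) by simp
      have "(norm (\<pi> x))\<^sup>2 = (norm (x - p))\<^sup>2 - ((x - p) \<bullet> v)\<^sup>2"
        unfolding \<pi>_def power2_norm_eq_inner
        by (simp only: inner_diff_left inner_diff_right inner_scaleR_left inner_scaleR_right vv)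
          (simp add: power2_eq_square inner_commute algebra_simps)
      then have "(norm (\<pi> x))\<^sup>2 \<le> (norm (x - p))\<^sup>2"
        using zero_le_power2[of "(x - p) \<bullet> v"] by linarith
      then have "norm (\<pi> x) \<le> norm (x - p)" by (rule power2_le_imp_le) (rule norm_ge_zero)
      then have 2: "norm (\<pi> x) \<le> r'" using nx by simp
      then have 3: "\<pi> x \<in> D" using \<pi>v unfolding D_def by simp
      consider "G x > 0" | "G x < 0" | "G x = 0" by linarith
      then show ?thesis
      proof cases
        case 1
        then show ?thesis using H 3 \<open>\<bar>(x - p) \<bullet> v\<bar> \<le> r\<close> unfolding Wu_def by blast
      next
        case 2
        then show ?thesis using H 3 \<open>\<bar>(x - p) \<bullet> v\<bar> \<le> r\<close> unfolding Wl_def by blast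
      next
        case 3
        then have "x \<in> M" using 1 2 unfolding M_def by simp
        then show ?thesis using up H by blast
      qed
    qed
    moreover obtain x y where "x \<in> ball p r'" "F x > 0" "y \<in> ball p r'" "F y < 0"
      using p(1) r'(1) unfolding sign_changes_def by blast
    ultimately show False using that by force
  qed
  \<comment> \<open>A point of the graph is a limit of points of both sides, so \<open>F\<close> is
    both nonnegative and nonpositive there.\<close>
  have FM: "F x = 0" if x: "x \<in> M" for x
  proof -
    from signs not_both[of 1] not_both[of "- 1"]
    consider "\<forall>x\<in>Wu. 1 * F x \<ge> 0" "\<forall>x\<in>Wl. (- 1) * F x \<ge> 0" | "\<forall>x\<in>Wu. (- 1) * F x \<ge> 0" "\<forall>x\<in>Wl. 1 * F x \<ge> 0"
      by auto
    then show ?thesis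
      by cases (use up[OF x, of 1] up[OF x, of "- 1"] down[OF x, of 1] down[OF x, of "- 1"] in auto)
  qed
  show ?thesis
  proof (rule that[of r' g])
    show "r' > 0" by (rule r')
    show "continuous_on {h. h \<bullet> v = 0 \<and> norm h \<le> r'} g"
      using homeomorphism_cont2[OF g] unfolding D_def .
    show "inj_on g {h. h \<bullet> v = 0 \<and> norm h \<le> r'}"
      using homeomorphism_apply2[OF g] unfolding D_def[symmetric] by (metis inj_onI)
    show "g h \<in> cball p \<rho> \<and> F (g h) = 0" if "h \<bullet> v = 0" "norm h \<le> r'" for h
    proof -
      have "g h \<in> M" using homeomorphism_image2[OF g] that unfolding D_def by blast
      then show ?thesis using FM M_ball by blast
    qed
  qed
qed

text \<open>By Baire's theorem, one of the countably many compact pieces of the cells contains an open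
  part of an embedded hypersurface; invariance of domain excludes this for cells of codimension
  at least two.\<close>

lemma cells_contain_no_hypersurface:
  fixes \<psi> :: "'a::euclidean_space \<Rightarrow> 'b::euclidean_space" and v :: 'a
  assumes dim: "has_semialgebraic_dim S k" "k + 2 \<le> DIM('a)" and v: "norm v = 1" and r: "r > 0"
    and \<psi>: "continuous_on {h. h \<bullet> v = 0 \<and> norm h \<le> r} \<psi>" "inj_on \<psi> {h. h \<bullet> v = 0 \<and> norm h \<le> r}"
      "\<And>h. h \<bullet> v = 0 \<Longrightarrow> norm h \<le> r \<Longrightarrow> \<psi> h \<in> S"
  shows False
proof -
  define D where "D = {h. h \<bullet> v = 0 \<and> norm h \<le> r}"
  define H where "H = {h. v \<bullet> h = 0}"
  have D: "D = H \<inter> cball 0 r" unfolding D_def H_def by (auto simp: inner_commute)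
  have v0: "v \<noteq> 0" using v by auto
  have H: "subspace H" "dim H = DIM('a) - 1" unfolding H_def
    using dim_hyperplane[OF v0] by (auto intro: subspace_hyperplane)
  obtain \<C> \<delta> where \<C>: "finite \<C>" "\<Union>\<C> = S" "\<And>C. C \<in> \<C> \<Longrightarrow> semialgebraic_cell (\<delta> C) C" "k = Max (\<delta> ` \<C>)"
    using dim(1) unfolding has_semialgebraic_dim_def by blast
  have "\<exists>B h h'. B \<subseteq> (Basis :: 'b set) \<and> card B \<le> k \<and> homeomorphism (open_cube B) C h h'" if C: "C \<in> \<C>" for C
  proof -
    have "\<delta> C \<le> k" unfolding \<C>(4) using \<C>(1) C by simp
    moreover obtain B h h' where "B \<subseteq> (Basis :: 'b set)" "card B = \<delta> C" "homeomorphism (open_cube B) C h h'"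
      using \<C>(3)[OF C] unfolding semialgebraic_cell_def by (elim conjE exE) (rule that; assumption)
    ultimately show ?thesis by (intro exI[of _ B] exI[of _ h] exI[of _ h']) simp
  qed
  then obtain B h h' where B: "\<And>C. C \<in> \<C> \<Longrightarrow> B C \<subseteq> (Basis :: 'b set)" "\<And>C. C \<in> \<C> \<Longrightarrow> card (B C) \<le> k"
    "\<And>C. C \<in> \<C> \<Longrightarrow> homeomorphism (open_cube (B C)) C (h C) (h' C)"
    by metis
  \<comment> \<open>Compact boxes that exhaust the open cube; \<open>n + 2\<close> keeps the lower
    bound at most the upper one. Their images in a cell are closed, as Baire's theorem
    requires.\<close>
  define Q where "Q = (\<lambda>A (n::nat). {x::'b. \<forall>b\<in>Basis. if b \<in> A then 1 / real (n + 2) \<le> x \<bullet> b \<and> x \<bullet> b \<le> 1 - 1 / real (n + 2) else x \<bullet> b = 0})"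
  have Q_cube: "open_cube A = (\<Union>n. Q A n)" for A :: "'b set"
  proof
    show "(\<Union>n. Q A n) \<subseteq> open_cube A"
    proof
      fix x assume "x \<in> (\<Union>n. Q A n)"
      then obtain n where n: "x \<in> Q A n" by blast
      have pos: "0 < 1 / real (n + 2)" by simp
      show "x \<in> open_cube A"
        unfolding open_cube_def mem_Collect_eq
      proof
        fix b :: 'b assume "b \<in> Basis"
        then have "if b \<in> A then 1 / real (n + 2) \<le> x \<bullet> b \<and> x \<bullet> b \<le> 1 - 1 / real (n + 2) else x \<bullet> b = 0"
          using n unfolding Q_def by blast
        then show "if b \<in> A then 0 < x \<bullet> b \<and> x \<bullet> b < 1 else x \<bullet> b = 0"
          using pos by (cases "b \<in> A") (simp_all only: if_True if_False, linarith)
      qed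
    qed
    show "open_cube A \<subseteq> (\<Union>n. Q A n)"
    proof
      fix x assume x: "x \<in> open_cube A"
      define \<epsilon> where "\<epsilon> = Min (insert 1 ((\<lambda>b. min (x \<bullet> b) (1 - x \<bullet> b)) ` (A \<inter> Basis)))"
      have "\<epsilon> > 0" unfolding \<epsilon>_def using x by (subst Min_gr_iff) (auto simp: open_cube_def split: if_splits)
      then obtain n where n: "inverse (real (Suc n)) < \<epsilon>" using reals_Archimedean by blast
      have "1 / real (n + 2) \<le> inverse (real (Suc n))" by (simp add: divide_simps)
      then have le: "1 / real (n + 2) \<le> \<epsilon>" using n by simp
      have "\<epsilon> \<le> min (x \<bullet> b) (1 - x \<bullet> b)" if "b \<in> A" "b \<in> Basis" for b
        unfolding \<epsilon>_def using that by (intro Min_le) auto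
      note le' = this
      have "x \<in> Q A n"
        unfolding Q_def mem_Collect_eq
      proof
        fix b :: 'b assume b: "b \<in> Basis"
        show "if b \<in> A then 1 / real (n + 2) \<le> x \<bullet> b \<and> x \<bullet> b \<le> 1 - 1 / real (n + 2) else x \<bullet> b = 0"
        proof (cases "b \<in> A")
          case True
          then show ?thesis using le' [OF True b] le by (simp only: if_True) linarith
        next
          case False
          then show ?thesis using x b unfolding open_cube_def by auto
        qed
      qed
      then show "x \<in> (\<Union>n. Q A n)" by blast
    qed
  qed
  have Q_compact: "compact (Q A n)" for A n
  proof -
    have "closed (Q A n)"
    proof -
      have "Q A n = (\<Inter>b\<in>Basis. {x. if b \<in> A then 1 / real (n + 2) \<le> x \<bullet> b \<and> x \<bullet> b \<le> 1 - 1 / real (n + 2) else x \<bullet> b = 0})"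
        unfolding Q_def by auto
      moreover have "closed {x::'b. if b \<in> A then 1 / real (n + 2) \<le> x \<bullet> b \<and> x \<bullet> b \<le> 1 - 1 / real (n + 2) else x \<bullet> b = 0}" for b
        by (cases "b \<in> A") (simp_all, (intro closed_Collect_conj closed_Collect_eq closed_Collect_le continuous_intros)+)
      ultimately show ?thesis by (metis (no_types, lifting) closed_INT)
    qed
    moreover have "Q A n \<subseteq> cbox 0 One"
    proof
      fix x assume x: "x \<in> Q A n"
      have pos: "0 < 1 / real (n + 2)" by simp
      show "x \<in> cbox 0 One"
        unfolding mem_box
      proof
        fix b :: 'b assume b: "b \<in> Basis"
        then have "if b \<in> A then 1 / real (n + 2) \<le> x \<bullet> b \<and> x \<bullet> b \<le> 1 - 1 / real (n + 2) else x \<bullet> b = 0"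
          using x unfolding Q_def by blast
        then have "0 \<le> x \<bullet> b \<and> x \<bullet> b \<le> 1"
          using pos by (cases "b \<in> A") (simp_all only: if_True if_False, linarith+)
        then show "0 \<bullet> b \<le> x \<bullet> b \<and> x \<bullet> b \<le> One \<bullet> b" using b by simp
      qed
    qed
    ultimately show ?thesis using bounded_subset[OF bounded_cbox] by (auto simp: compact_eq_bounded_closed)
  qed
  define L where "L = (\<lambda>C n. h C ` Q (B C) n)"
  have L_closed: "closed (L C n)" if "C \<in> \<C>" for C n
    unfolding L_def using B(3)[OF that] Q_cube[of "B C"]
    by (intro compact_imp_closed compact_continuous_image Q_compact)
      (auto intro: continuous_on_subset dest: homeomorphism_cont1)
  have cover: "\<exists>C\<in>\<C>. \<exists>n. \<psi> x \<in> L C n" if "x \<in> D" for x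
  proof -
    have "\<psi> x \<in> S" using \<psi>(3) that unfolding D_def by blast
    then obtain C where C: "C \<in> \<C>" "\<psi> x \<in> C" using \<C>(2) by blast
    then have "\<psi> x \<in> h C ` (\<Union>n. Q (B C) n)" using homeomorphism_image1[OF B(3)[OF C(1)]] Q_cube by blast
    then show ?thesis using C(1) unfolding L_def by blast
  qed
  \<comment> \<open>The part of the disc that misses the piece \<open>L C n\<close>. The pieces
    cover the image of the disc, so these relatively open sets have no point in common and cannot
    all be dense.\<close>
  define T where "T = (\<lambda>(C, n). D - (D \<inter> \<psi> -` L C n))"
  have closedD: "closed D" unfolding D by (rule closed_Int[OF closed_subspace[OF H(1)] closed_cball])
  have T_open: "openin (top_of_set D) (T (C, n))" if "C \<in> \<C>" for C n
    unfolding T_def prod.case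
    by (intro openin_diff openin_subtopology_self continuous_closedin_preimage L_closed that)
      (use \<psi>(1) in \<open>simp add: D_def\<close>)
  have "\<exists>C\<in>\<C>. \<exists>n. \<not> D \<subseteq> closure (T (C, n))"
  proof (rule ccontr)
    assume "\<not> ?thesis"
    then have dense: "D \<subseteq> closure (T (C, n))" if "C \<in> \<C>" for C n using that by blast
    have "D \<subseteq> closure (\<Inter> (T ` (\<C> \<times> UNIV)))"
    proof (rule Baire[OF closedD])
      show "countable (T ` (\<C> \<times> (UNIV :: nat set)))"
        by (rule countable_image, rule countable_SIGMA)
          (use \<C>(1) in \<open>auto intro: countable_finite\<close>)
      show "openin (top_of_set D) U \<and> D \<subseteq> closure U" if U: "U \<in> T ` (\<C> \<times> UNIV)" for U
      proof -
        obtain C n where "C \<in> \<C>" "U = T (C, n)" using U by auto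
        then show ?thesis using T_open dense by simp
      qed
    qed
    moreover have "0 \<in> D" unfolding D_def using r by simp
    ultimately have "\<Inter> (T ` (\<C> \<times> UNIV)) \<noteq> {}" by auto
    then obtain x where x: "x \<in> \<Inter> (T ` (\<C> \<times> UNIV))" by blast
    obtain C n where "C \<in> \<C>" "\<psi> 0 \<in> L C n" using cover[OF \<open>0 \<in> D\<close>] by blast
    then have "x \<in> D" using x unfolding T_def by blast
    then show False using cover[of x] x unfolding T_def by blast
  qed
  then obtain C n where C: "C \<in> \<C>" "\<not> D \<subseteq> closure (T (C, n))" by blast
  then obtain x where x: "x \<in> D" "x \<notin> closure (T (C, n))" by blast
  then obtain e where e: "e > 0" "ball x e \<inter> T (C, n) = {}"
    by (metis closure_approachable disjoint_iff dist_commute mem_ball)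
  define Op where "Op = H \<inter> (ball 0 r \<inter> ball x e)"
  have OpD: "Op \<subseteq> D" unfolding Op_def D by auto
  have Op_ne: "Op \<noteq> {}"
  proof -
    \<comment> \<open>The point \<open>x\<close> may lie on the boundary sphere of the disc; scaling
      it by \<open>cc\<close> moves it inside by less than \<open>e\<close>.\<close>
    define cc where "cc = 1 - min (1/2) (e / (2 * (norm x + 1)))"
    have "0 < norm x + 1" by (simp add: add_nonneg_pos)
    then have "0 < e / (2 * (norm x + 1))" using e(1) by simp
    then have "0 < min (1/2) (e / (2 * (norm x + 1)))" by simp
    moreover have "min (1/2) (e / (2 * (norm x + 1))) \<le> 1/2" by (rule min.cobounded1)
    ultimately have l: "0 < cc" "cc < 1" unfolding cc_def by linarith+
    have "cc *\<^sub>R x \<in> H" using x(1) H(1) unfolding D by (auto intro: subspace_scale)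
    moreover have "norm (cc *\<^sub>R x) < r"
    proof (cases "x = 0")
      case False
      then have "cc * norm x < 1 * norm x" using l by (intro mult_strict_right_mono) auto
      then show ?thesis using x(1) l unfolding D_def by simp
    qed (use r in simp)
    moreover have "dist x (cc *\<^sub>R x) < e"
    proof -
      have "x - cc *\<^sub>R x = (1 - cc) *\<^sub>R x" by (simp add: algebra_simps)
      then have "dist x (cc *\<^sub>R x) = (1 - cc) * norm x" using l by (simp add: dist_norm)
      also have "\<dots> \<le> (e / (2 * (norm x + 1))) * norm x"
        unfolding cc_def by (rule mult_right_mono) simp_all
      also have "\<dots> < e"
      proof -
        have "norm x < 2 * (norm x + 1)" by (simp add: distrib_left add_nonneg_pos)
        then have "e * norm x < e * (2 * (norm x + 1))" using e(1) by (intro mult_strict_left_mono)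
        then have "(e * norm x) / (2 * (norm x + 1)) < e"
          by (subst pos_divide_less_eq) (simp_all add: add_nonneg_pos)
        then show ?thesis by simp
      qed
      finally show ?thesis .
    qed
    ultimately show ?thesis unfolding Op_def by auto
  qed
  have OpL: "\<psi> y \<in> L C n" if y: "y \<in> Op" for y
  proof -
    have "y \<in> D" "y \<in> ball x e" using OpD y unfolding Op_def by auto
    then have "y \<notin> T (C, n)" using e(2) by blast
    then show ?thesis using \<open>y \<in> D\<close> unfolding T_def by simp
  qed
  have LC: "L C n \<subseteq> C" unfolding L_def using homeomorphism_image1[OF B(3)[OF C(1)]] Q_cube by blast
  have "dim H \<le> dim (span (B C))"
  proof (rule invariance_of_dimension_subspaces[of H Op "span (B C)" "h' C \<circ> \<psi>"])
    show "openin (top_of_set H) Op" unfolding Op_def by (intro openin_open_Int open_Int open_ball)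
    show "subspace H" by (rule H)
    show "subspace (span (B C))" by (rule subspace_span)
    show "continuous_on Op (h' C \<circ> \<psi>)"
    proof (rule continuous_on_compose)
      show "continuous_on Op \<psi>" using \<psi>(1) OpD unfolding D_def by (rule continuous_on_subset)
      show "continuous_on (\<psi> ` Op) (h' C)"
        using homeomorphism_cont2[OF B(3)[OF C(1)]] OpL LC by (blast intro: continuous_on_subset)
    qed
    show "h' C \<circ> \<psi> \<in> Op \<rightarrow> span (B C)"
    proof
      fix y assume "y \<in> Op"
      then have "h' C (\<psi> y) \<in> open_cube (B C)"
        using OpL LC homeomorphism_image2[OF B(3)[OF C(1)]] by blast
      then have 0: "h' C (\<psi> y) \<bullet> b = 0" if "b \<in> Basis" "b \<notin> B C" for b
        using that unfolding open_cube_def by auto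
      have "h' C (\<psi> y) = (\<Sum>b\<in>Basis. (h' C (\<psi> y) \<bullet> b) *\<^sub>R b)" by (simp add: euclidean_representation)
      also have "\<dots> \<in> span (B C)"
      proof (rule span_sum)
        fix b :: 'b assume "b \<in> Basis"
        then show "(h' C (\<psi> y) \<bullet> b) *\<^sub>R b \<in> span (B C)"
          using 0[of b] by (cases "b \<in> B C") (auto intro: span_scale span_base span_zero)
      qed
      finally show "(h' C \<circ> \<psi>) y \<in> span (B C)" by simp
    qed
    show "inj_on (h' C \<circ> \<psi>) Op"
    proof (rule comp_inj_on)
      show "inj_on \<psi> Op" using \<psi>(2) OpD unfolding D_def by (rule inj_on_subset)
      show "inj_on (h' C) (\<psi> ` Op)"
        using homeomorphism_apply2[OF B(3)[OF C(1)]] OpL LC by (intro inj_onI) (metis imageE subsetD)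
    qed
    show "Op \<noteq> {}" by (rule Op_ne)
  qed
  also have "dim (span (B C)) \<le> card (B C)"
    using B(1)[OF C(1)] by (simp add: dim_le_card' finite_subset[OF _ finite_Basis])
  also have "\<dots> \<le> k" by (rule B(2)[OF C(1)])
  finally show False using H(2) dim(2) by simp
qed

section \<open>Real trigonometric sums\<close>

text \<open>Frequencies are arbitrary vectors, so that half-integral exponents are covered as
  well.\<close>

definition trig_sum :: "('k \<Rightarrow> complex) \<Rightarrow> ('k \<Rightarrow> 'a::euclidean_space) \<Rightarrow> 'k set \<Rightarrow> 'a \<Rightarrow> real"
  where "trig_sum c \<omega> K t = Re (\<Sum>n\<in>K. c n * cis (\<omega> n \<bullet> t))"

text \<open>The coefficients of the \<open>m\<close>-th derivative in direction
  \<open>v\<close>.\<close>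

definition diff_coeff :: "('k \<Rightarrow> 'a::euclidean_space) \<Rightarrow> 'a \<Rightarrow> nat \<Rightarrow> ('k \<Rightarrow> complex) \<Rightarrow> 'k \<Rightarrow> complex"
  where "diff_coeff \<omega> v m c n = c n * (\<i> * of_real (\<omega> n \<bullet> v)) ^ m"

lemma continuous_trig_sum: "continuous_on S (trig_sum c \<omega> K)"
  unfolding trig_sum_def by (intro continuous_intros)

lemma trig_sum_has_derivative:
  "((\<lambda>s. trig_sum (diff_coeff \<omega> v m c) \<omega> K (t + s *\<^sub>R v)) has_real_derivative
    trig_sum (diff_coeff \<omega> v (Suc m) c) \<omega> K (t + s *\<^sub>R v)) (at s)"
proof -
  have eq: "trig_sum c' \<omega> K (t + s *\<^sub>R v) =
      (\<Sum>n\<in>K. Re (c' n) * cos (\<omega> n \<bullet> t + s * (\<omega> n \<bullet> v)) - Im (c' n) * sin (\<omega> n \<bullet> t + s * (\<omega> n \<bullet> v)))" for c' s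
    unfolding trig_sum_def by (simp add: inner_add_right)
  have "((\<lambda>s. \<Sum>n\<in>K. Re (c' n) * cos (\<omega> n \<bullet> t + s * (\<omega> n \<bullet> v)) - Im (c' n) * sin (\<omega> n \<bullet> t + s * (\<omega> n \<bullet> v)))
      has_real_derivative
      (\<Sum>n\<in>K. - Im (c' n) * (\<omega> n \<bullet> v) * cos (\<omega> n \<bullet> t + s * (\<omega> n \<bullet> v))
        - Re (c' n) * (\<omega> n \<bullet> v) * sin (\<omega> n \<bullet> t + s * (\<omega> n \<bullet> v)))) (at s)" for c'
    by (intro DERIV_sum) (auto intro!: derivative_eq_intros simp: algebra_simps)
  moreover have "Re (diff_coeff \<omega> v (Suc m) c n) = - Im (diff_coeff \<omega> v m c n) * (\<omega> n \<bullet> v)"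
      "Im (diff_coeff \<omega> v (Suc m) c n) = Re (diff_coeff \<omega> v m c n) * (\<omega> n \<bullet> v)" for n
  proof -
    have "diff_coeff \<omega> v (Suc m) c n = diff_coeff \<omega> v m c n * (\<i> * of_real (\<omega> n \<bullet> v))"
      unfolding diff_coeff_def by simp
    then show "Re (diff_coeff \<omega> v (Suc m) c n) = - Im (diff_coeff \<omega> v m c n) * (\<omega> n \<bullet> v)"
      "Im (diff_coeff \<omega> v (Suc m) c n) = Re (diff_coeff \<omega> v m c n) * (\<omega> n \<bullet> v)" by simp_all
  qed
  ultimately show ?thesis unfolding eq by simp
qed

lemma diff_coeff_0 [simp]: "diff_coeff \<omega> v 0 c = c"
  unfolding diff_coeff_def by simp

lemma trig_sum_bound: "\<bar>trig_sum c \<omega> K t\<bar> \<le> (\<Sum>n\<in>K. norm (c n))"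
proof -
  have "\<bar>trig_sum c \<omega> K t\<bar> \<le> norm (\<Sum>n\<in>K. c n * cis (\<omega> n \<bullet> t))"
    unfolding trig_sum_def by (rule abs_Re_le_cmod)
  also have "\<dots> \<le> (\<Sum>n\<in>K. norm (c n * cis (\<omega> n \<bullet> t)))" by (rule norm_sum)
  finally show ?thesis by (simp add: norm_mult)
qed

text \<open>The exponential series of each term converges on the whole line, so the Taylor expansion
  at \<open>p\<close> determines the sum everywhere on it.\<close>

lemma trig_sum_zero_on_line:
  assumes "\<And>m. trig_sum (diff_coeff \<omega> v m c) \<omega> K p = 0"
  shows "trig_sum c \<omega> K (p + s *\<^sub>R v) = 0"
proof -
  define z where "z = (\<lambda>n. \<i> * of_real (s * (\<omega> n \<bullet> v)))"
  have cis: "cis (\<omega> n \<bullet> (p + s *\<^sub>R v)) = cis (\<omega> n \<bullet> p) * exp (z n)" for n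
    unfolding z_def inner_add_right inner_scaleR_right cis_mult[symmetric]
    by (simp add: cis_conv_exp)
  have "(\<lambda>m. Re (\<Sum>n\<in>K. c n * cis (\<omega> n \<bullet> p) * (z n ^ m /\<^sub>R fact m))) sums
      Re (\<Sum>n\<in>K. c n * cis (\<omega> n \<bullet> p) * exp (z n))"
    by (intro sums_Re sums_sum sums_mult exp_converges)
  moreover have "Re (\<Sum>n\<in>K. c n * cis (\<omega> n \<bullet> p) * (z n ^ m /\<^sub>R fact m)) = 0" for m
  proof -
    have "(\<Sum>n\<in>K. c n * cis (\<omega> n \<bullet> p) * (z n ^ m /\<^sub>R fact m)) =
        of_real (s ^ m / fact m) * (\<Sum>n\<in>K. diff_coeff \<omega> v m c n * cis (\<omega> n \<bullet> p))"
      unfolding z_def diff_coeff_def sum_distrib_left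
      by (intro sum.cong) (simp_all add: scaleR_conv_of_real power_mult_distrib field_simps)
    then have "Re (\<Sum>n\<in>K. c n * cis (\<omega> n \<bullet> p) * (z n ^ m /\<^sub>R fact m)) =
        s ^ m / fact m * trig_sum (diff_coeff \<omega> v m c) \<omega> K p"
      unfolding trig_sum_def by (simp only: Re_complex_of_real Re_divide_of_real times_complex.simps
          complex_of_real_def complex.sel)
    then show ?thesis using assms by simp
  qed
  ultimately have "(\<lambda>m. 0 :: real) sums Re (\<Sum>n\<in>K. c n * cis (\<omega> n \<bullet> p) * exp (z n))" by simp
  then have "Re (\<Sum>n\<in>K. c n * cis (\<omega> n \<bullet> p) * exp (z n)) = 0" by (rule sums_unique2) (rule sums_zero)
  then show ?thesis unfolding trig_sum_def cis by (simp add: mult.assoc)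
qed

text \<open>If the sum vanished on a ball, all its derivatives in the direction of \<open>a\<close>
  would vanish at the centre, and so would the sum at \<open>a\<close>.\<close>

lemma trig_sum_nonzero_dense:
  fixes \<omega> :: "'k \<Rightarrow> 'a::euclidean_space"
  assumes a: "trig_sum c \<omega> K a \<noteq> 0" and e: "e > 0"
  shows "\<exists>y\<in>ball x e. trig_sum c \<omega> K y \<noteq> 0"
proof (rule ccontr)
  assume "\<not> ?thesis"
  then have zero: "\<And>y. y \<in> ball x e \<Longrightarrow> trig_sum c \<omega> K y = 0" by blast
  define v where "v = a - x"
  have "v \<noteq> 0" using zero[of x] a e unfolding v_def by auto
  define \<delta> where "\<delta> = e / norm v"
  have \<delta>: "\<delta> > 0" unfolding \<delta>_def using e \<open>v \<noteq> 0\<close> by simp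
  have "trig_sum (diff_coeff \<omega> v m c) \<omega> K (x + s *\<^sub>R v) = 0" if "\<bar>s\<bar> < \<delta>" for m s
    using that
  proof (induction m arbitrary: s)
    case 0
    then have "\<bar>s\<bar> * norm v < e" unfolding \<delta>_def using \<open>v \<noteq> 0\<close> by (simp add: pos_less_divide_eq)
    then show ?case using zero[of "x + s *\<^sub>R v"] by (simp add: dist_norm)
  next
    case (Suc m)
    have "((\<lambda>s. trig_sum (diff_coeff \<omega> v m c) \<omega> K (x + s *\<^sub>R v)) has_real_derivative 0) (at s)"
    proof (rule has_field_derivative_transform_within_open[of "\<lambda>_. 0" _ _ "{- \<delta><..<\<delta>}"])
      show "((\<lambda>_. 0 :: real) has_field_derivative 0) (at s)" by simp
    qed (use Suc in auto)
    then show ?case using DERIV_unique[OF trig_sum_has_derivative] by blast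
  qed
  from this[of 0] have "trig_sum (diff_coeff \<omega> v m c) \<omega> K x = 0" for m using \<delta> by simp
  from trig_sum_zero_on_line[OF this, of 1] have "trig_sum c \<omega> K a = 0" unfolding v_def by simp
  then show False using a by simp
qed

text \<open>If \<open>l + 1\<close> is the least order of an iterated derivative along \<open>v\<close> that is nonzero at some sign
  change, then the \<open>l\<close>th derivative cuts out a smooth hypersurface there.\<close>

lemma trig_sum_constant_sign:
  fixes \<omega> :: "'k \<Rightarrow> 'a::euclidean_space" and \<tau> :: "'a \<Rightarrow> 'b::euclidean_space"
  assumes S: "has_semialgebraic_dim S k" "k + 2 \<le> DIM('a)"
    and \<tau>: "continuous_on UNIV \<tau>" "\<And>p. inj_on \<tau> (cball p \<rho>)" "\<rho> > 0"
      "\<And>t. trig_sum c \<omega> K t = 0 \<Longrightarrow> \<tau> t \<in> S"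
  shows "(\<forall>t. trig_sum c \<omega> K t \<ge> 0) \<or> (\<forall>t. trig_sum c \<omega> K t \<le> 0)"
proof (rule ccontr)
  assume neg: "\<not> ?thesis"
  define F where "F = trig_sum c \<omega> K"
  obtain a where a: "F a \<noteq> 0" using neg unfolding F_def by force
  have dense: "\<exists>y\<in>ball x e. F y \<noteq> 0" if "e > 0" for x e
    using trig_sum_nonzero_dense[of c \<omega> K a] a that unfolding F_def by blast
  have "sign_changes F \<noteq> {}"
    using constant_sign_on_connected[of UNIV F] dense neg unfolding F_def by auto
  then obtain p0 where p0: "p0 \<in> sign_changes F" by blast
  have FZ: "F x = 0" if "x \<in> sign_changes F" for x
    using sign_changes_zero[OF _ that] unfolding F_def by (simp add: continuous_trig_sum)
  \<comment> \<open>The line through \<open>p0\<close> in this direction meets the point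
    \<open>a\<close>, where \<open>F\<close> is nonzero, so some derivative along \<open>v\<close>
    is nonzero at \<open>p0\<close>.\<close>
  define v where "v = sgn (a - p0)"
  have "a \<noteq> p0" using a FZ[OF p0] by auto
  then have v: "norm v = 1" unfolding v_def by (simp add: norm_sgn)
  have av: "a = p0 + norm (a - p0) *\<^sub>R v" unfolding v_def using \<open>a \<noteq> p0\<close> by (simp add: sgn_div_norm)
  define Fm where "Fm = (\<lambda>m. trig_sum (diff_coeff \<omega> v m c) \<omega> K)"
  have F0: "Fm 0 = F" unfolding Fm_def F_def by simp
  have "\<exists>m. Fm m p0 \<noteq> 0"
  proof (rule ccontr)
    assume "\<not> ?thesis"
    then have "F (p0 + norm (a - p0) *\<^sub>R v) = 0"
      unfolding F_def by (intro trig_sum_zero_on_line) (simp add: Fm_def)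
    then show False using a av by simp
  qed
  then have ex: "\<exists>m. \<exists>p\<in>sign_changes F. Fm m p \<noteq> 0" using p0 by blast
  define m where "m = (LEAST m. \<exists>p\<in>sign_changes F. Fm m p \<noteq> 0)"
  obtain p where p: "p \<in> sign_changes F" "Fm m p \<noteq> 0" using LeastI_ex[OF ex] unfolding m_def by blast
  \<comment> \<open>Order 0 is excluded because \<open>F\<close> itself vanishes at its sign
    changes, so a preceding order \<open>l\<close> exists.\<close>
  have "m \<noteq> 0" using p FZ F0 by metis
  then obtain l where l: "m = Suc l" using not0_implies_Suc by blast
  have low: "Fm l x = 0" if "x \<in> sign_changes F" for x
    using not_less_Least[of l "\<lambda>m. \<exists>p\<in>sign_changes F. Fm m p \<noteq> 0"] that l unfolding m_def[symmetric] by auto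
  \<comment> \<open>Normalizes the nonzero derivative at \<open>p\<close> to be positive; the zero
    set is unaffected.\<close>
  define \<sigma> where "\<sigma> = sgn (Fm m p)"
  have der: "((\<lambda>s. \<sigma> * Fm l (t + s *\<^sub>R v)) has_real_derivative \<sigma> * Fm m (t + s *\<^sub>R v)) (at s)" for t s
    unfolding Fm_def l by (intro DERIV_cmult trig_sum_has_derivative)
  have pos: "\<sigma> * Fm m p > 0" unfolding \<sigma>_def using p(2) by (simp add: sgn_if)
  have contF: "continuous_on UNIV F" unfolding F_def by (rule continuous_trig_sum)
  have contG: "continuous_on UNIV (\<lambda>t. \<sigma> * Fm i t)" for i
    unfolding Fm_def by (intro continuous_intros continuous_trig_sum)
  have low': "\<And>x. x \<in> sign_changes F \<Longrightarrow> \<sigma> * Fm l x = 0" using low by simp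
  show False
  proof (rule zero_hypersurface_at_sign_change[OF contF contG contG der v dense low' p(1) pos \<tau>(3)])
    fix g r
    assume g: "r > 0" "continuous_on {h. h \<bullet> v = 0 \<and> norm h \<le> r} g"
      "inj_on g {h. h \<bullet> v = 0 \<and> norm h \<le> r}"
      "\<And>h. h \<bullet> v = 0 \<Longrightarrow> norm h \<le> r \<Longrightarrow> g h \<in> cball p \<rho> \<and> F (g h) = 0"
    show False
  proof (rule cells_contain_no_hypersurface[OF S v g(1), of "\<tau> \<circ> g"])
    show "continuous_on {h. h \<bullet> v = 0 \<and> norm h \<le> r} (\<tau> \<circ> g)"
      by (intro continuous_on_compose g(2) continuous_on_subset[OF \<tau>(1)]) auto
    show "inj_on (\<tau> \<circ> g) {h. h \<bullet> v = 0 \<and> norm h \<le> r}"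
      by (intro comp_inj_on g(3) inj_on_subset[OF \<tau>(2)[of p]]) (use g(4) in blast)
    show "(\<tau> \<circ> g) h \<in> S" if "h \<bullet> v = 0" "norm h \<le> r" for h
      using g(4)[OF that] \<tau>(4) unfolding F_def by simp
  qed
  qed
qed

text \<open>Taylor's formula bounds \<open>\<phi>\<close> above by a quadratic polynomial;
  \<open>x\<close> is its minimum point, and nonnegativity of \<open>\<phi>\<close> there is the
  discriminant inequality.\<close>

lemma derivative_square_le:
  fixes \<phi> \<phi>' \<phi>'' :: "real \<Rightarrow> real"
  assumes der: "\<And>s. (\<phi> has_real_derivative \<phi>' s) (at s)" "\<And>s. (\<phi>' has_real_derivative \<phi>'' s) (at s)"
    and M: "\<And>s. \<bar>\<phi>'' s\<bar> \<le> M" "M > 0" and nonneg: "\<And>s. \<phi> s \<ge> 0"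
  shows "(\<phi>' 0)\<^sup>2 \<le> 2 * M * \<phi> 0"
proof -
  define x where "x = - \<phi>' 0 / M"
  define diff where "diff = (\<lambda>m::nat. if m = 0 then \<phi> else if m = 1 then \<phi>' else \<phi>'')"
  have "\<exists>t. \<bar>t\<bar> \<le> \<bar>x\<bar> \<and> \<phi> x = (\<Sum>m<2. diff m 0 / fact m * x ^ m) + diff 2 t / fact 2 * x ^ 2"
  proof (rule Maclaurin_bi_le)
    show "\<forall>m t. m < 2 \<and> \<bar>t\<bar> \<le> \<bar>x\<bar> \<longrightarrow> (diff m has_real_derivative diff (Suc m) t) (at t)"
      using der by (auto simp: diff_def less_2_cases_iff)
  qed (simp add: diff_def)
  then obtain t where "\<phi> x = \<phi> 0 + \<phi>' 0 * x + \<phi>'' t / 2 * x\<^sup>2"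
    by (auto simp: diff_def numeral_2_eq_2)
  moreover have "\<phi>'' t / 2 * x\<^sup>2 \<le> M / 2 * x\<^sup>2" using M(1)[of t] by (intro mult_right_mono) auto
  ultimately have "0 \<le> \<phi> 0 + \<phi>' 0 * x + M / 2 * x\<^sup>2" using nonneg[of x] by linarith
  also have "\<dots> = \<phi> 0 - (\<phi>' 0)\<^sup>2 / (2 * M)"
    unfolding x_def using M(2) by (simp add: power2_eq_square field_simps)
  finally show ?thesis using M(2) by (simp add: field_simps)
qed

text \<open>Gronwall's argument: \<open>\<phi>\<close> squared times the exponential of
  \<open>- 2 * L * s\<close> is nonnegative, nonincreasing and starts at 0.\<close>

lemma zero_of_linear_growth:
  fixes \<phi> \<phi>' :: "real \<Rightarrow> real"
  assumes der: "\<And>s. (\<phi> has_real_derivative \<phi>' s) (at s)" and L: "\<And>s. \<bar>\<phi>' s\<bar> \<le> L * \<bar>\<phi> s\<bar>" and 0: "\<phi> 0 = 0"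
  shows "\<phi> 1 = 0"
proof -
  define \<psi> where "\<psi> = (\<lambda>s. (\<phi> s)\<^sup>2 * exp (- (2 * L * s)))"
  have "\<psi> 1 \<le> \<psi> 0"
  proof (rule DERIV_nonpos_imp_nonincreasing[of 0 1])
    fix s :: real
    have "(\<psi> has_real_derivative (2 * \<phi> s * \<phi>' s - 2 * L * (\<phi> s)\<^sup>2) * exp (- (2 * L * s))) (at s)"
      unfolding \<psi>_def by (auto intro!: derivative_eq_intros der simp: power2_eq_square algebra_simps)
    moreover have "\<phi> s * \<phi>' s \<le> L * (\<phi> s)\<^sup>2"
    proof -
      have "\<phi> s * \<phi>' s \<le> \<bar>\<phi> s\<bar> * \<bar>\<phi>' s\<bar>" by (simp flip: abs_mult)
      also have "\<dots> \<le> \<bar>\<phi> s\<bar> * (L * \<bar>\<phi> s\<bar>)" by (intro mult_left_mono L) simp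
      finally show ?thesis by (simp add: power2_eq_square mult_ac)
    qed
    ultimately show "\<exists>y. (\<psi> has_real_derivative y) (at s) \<and> y \<le> 0"
      by (intro exI conjI) (auto simp: mult_le_0_iff)
  qed simp
  then have "(\<phi> 1)\<^sup>2 * exp (- (2 * L)) \<le> 0" unfolding \<psi>_def by (simp add: 0)
  then show ?thesis by (simp add: mult_le_0_iff)
qed

section \<open>A multiplier vanishing on the unitary variety\<close>

definition torus_point :: "real ^ 'd \<Rightarrow> complex ^ 'd::finite"
  where "torus_point t = (\<chi> j. cis (2 * pi * t $ j))"

lemma torus_point_in_torus: "torus_point t \<in> torus"
  unfolding torus_point_def torus_def by simp

lemma torus_pointE:
  assumes "z \<in> torus"
  obtains t where "torus_point t = z" "\<And>j. \<bar>t $ j\<bar> \<le> 1"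
proof -
  define t :: "real ^ 'a" where "t = (\<chi> j. Arg (z $ j) / (2 * pi))"
  have "torus_point t = z"
    unfolding torus_point_def t_def vec_eq_iff using assms
    by (auto simp: torus_def cis_Arg torus_nonzero[OF assms] sgn_div_norm)
  moreover have "\<bar>t $ j\<bar> \<le> 1" for j
    using Arg_bounded[of "z $ j"] pi_gt_zero unfolding t_def by (simp add: abs_le_iff divide_le_eq)
  ultimately show ?thesis using that by blast
qed

lemma continuous_torus_point: "continuous_on S torus_point"
  unfolding torus_point_def by (intro continuous_on_vec_lambda continuous_intros)

text \<open>Points of a ball of radius \<open>1/4\<close> differ by at most \<open>1/2\<close> in
  each coordinate, and 0 is the only integer that small.\<close>

lemma inj_on_torus_point: "inj_on torus_point (cball p (1/4))"
proof (rule inj_onI)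
  fix x y :: "real ^ 'a"
  assume xy: "x \<in> cball p (1/4)" "y \<in> cball p (1/4)" "torus_point x = torus_point y"
  have "x $ j = y $ j" for j
  proof -
    have "circle_exp (to_circle (x $ j)) = circle_exp (to_circle (y $ j))"
      using xy(3) unfolding circle_exp_to_circle torus_point_def by (simp add: vec_eq_iff)
    then have "to_circle (x $ j) = to_circle (y $ j)" using inj_circle_exp by (simp add: inj_eq)
    then have int: "x $ j - y $ j \<in> \<int>" by (simp add: add_circle.abs_eq_iff)
    have "\<bar>x $ j - y $ j\<bar> \<le> dist x y"
      using component_le_norm_cart[of "x - y" j] by (simp add: dist_norm)
    also have "\<dots> \<le> dist x p + dist p y" by (rule dist_triangle)
    also have "\<dots> < 1" using xy by (simp add: dist_commute)
    finally show ?thesis using int Ints_nonzero_abs_less1 by fastforce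
  qed
  then show "x = y" by (simp add: vec_eq_iff)
qed

lemma torus_point_in_variety:
  "laurent_eval f (torus_point t) = 0 \<longleftrightarrow> torus_point t \<in> torus_embed ` unitary_variety f"
proof -
  have "torus_embed (\<chi> j. to_circle (t $ j)) = torus_point t"
    by (simp add: torus_embed_def torus_point_def circle_exp_to_circle)
  moreover have "laurent_eval f z = 0" if "z \<in> torus_embed ` unitary_variety f" for z
    using that by (auto simp: unitary_variety_def)
  ultimately show ?thesis unfolding unitary_variety_def by (metis (mono_tags, lifting) imageI mem_Collect_eq)
qed

lemma norm_laurent_eval_le:
  "z \<in> torus \<Longrightarrow> norm (laurent_eval h z) \<le> (\<Sum>n\<in>keys h. \<bar>real_of_int (lookup h n)\<bar>)"
  unfolding laurent_eval_def monomial_at_def[symmetric]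
  by (rule order_trans[OF norm_sum]) (simp add: norm_mult norm_monomial_at)

lemma prod_cis: "finite A \<Longrightarrow> (\<Prod>j\<in>A. cis (a j)) = cis (\<Sum>j\<in>A. a j)"
  by (induction A rule: finite_induct) (simp_all add: cis_mult)

text \<open>Half-integral shifts of the exponents make a reciprocal Laurent polynomial real on the torus.\<close>

definition shifted_freq :: "int ^ 'd \<Rightarrow> int ^ 'd \<Rightarrow> real ^ 'd::finite"
  where "shifted_freq m n = (\<chi> j. pi * of_int (2 * n $ j + m $ j))"

definition shifted_eval :: "int ^ 'd \<Rightarrow> 'd::finite laurent \<Rightarrow> real ^ 'd \<Rightarrow> complex"
  where "shifted_eval m f t =
    (\<Sum>n\<in>keys f. of_int (lookup f n) * cis (shifted_freq m n \<bullet> t))"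

lemma shifted_eval_eq:
  "shifted_eval m f t = cis (\<Sum>j\<in>UNIV. pi * of_int (m $ j) * t $ j) * laurent_eval f (torus_point t)"
proof -
  have "cis (shifted_freq m n \<bullet> t) =
      cis (\<Sum>j\<in>UNIV. pi * of_int (m $ j) * t $ j) * monomial_at (torus_point t) n" for n
    unfolding monomial_at_def torus_point_def shifted_freq_def inner_vec_def
    by (simp add: cis_power_int prod_cis cis_mult sum.distrib[symmetric]) (simp add: algebra_simps)
  then show ?thesis
    unfolding shifted_eval_def laurent_eval_def monomial_at_def[symmetric]
    by (simp add: sum_distrib_left sum_distrib_right mult_ac)
qed

lemma norm_shifted_eval: "norm (shifted_eval m f t) = norm (laurent_eval f (torus_point t))"
  unfolding shifted_eval_eq by (simp add: norm_mult)

text \<open>If \<open>adjoint f = f * h\<close>, taking adjoints gives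
  \<open>h * adjoint h = 1\<close>. Its constant coefficient is a sum of squares of nonzero
  integers, so \<open>h\<close> has a single coefficient, equal to 1 or to -1.\<close>

lemma reciprocal_of_dvd_adjoint:
  fixes f :: "'d::finite laurent"
  assumes "f \<noteq> 0" "f dvd adjoint f"
  obtains m :: "int ^ 'd" and \<epsilon> :: int where "\<epsilon> = 1 \<or> \<epsilon> = - 1"
    "\<And>n. lookup f (- n) = \<epsilon> * lookup f (n - m)"
proof -
  obtain h where h: "adjoint f = f * h" using assms(2) by (auto elim: dvdE)
  have "f = adjoint f * adjoint h" by (metis adjoint_adjoint adjoint_mult h)
  then have "f * (h * adjoint h) = f * 1" unfolding h by (simp add: mult.assoc)
  then have "h * adjoint h = 1" by (rule laurent_cancel[OF assms(1)])
  then have "lookup (h * adjoint h) 0 = 1" by simp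
  then have sq: "(\<Sum>n\<in>keys h. (lookup h n)\<^sup>2) = 1"
    by (simp add: lookup_times lookup_adjoint power2_eq_square)
  have ge: "1 \<le> (lookup h n)\<^sup>2" if "n \<in> keys h" for n
  proof -
    have "0 < (lookup h n)\<^sup>2" using that by (simp add: in_keys_iff)
    then show ?thesis by linarith
  qed
  have "int (card (keys h)) \<le> 1"
  proof -
    have "(\<Sum>n\<in>keys h. 1 :: int) \<le> (\<Sum>n\<in>keys h. (lookup h n)\<^sup>2)"
      by (rule sum_mono) (rule ge)
    then show ?thesis unfolding sq by simp
  qed
  moreover have "keys h \<noteq> {}" using sq by (metis sum.empty zero_neq_one)
  then have "0 < card (keys h)" by (simp add: card_gt_0_iff)
  ultimately have "card (keys h) = 1" by linarith
  then obtain m where m: "keys h = {m}" by (rule card_1_singletonE)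
  define \<epsilon> where "\<epsilon> = lookup h m"
  have "\<epsilon>\<^sup>2 = 1" using sq unfolding m \<epsilon>_def by simp
  then have \<epsilon>: "\<epsilon> = 1 \<or> \<epsilon> = - 1" by (simp add: power2_eq_1_iff)
  have "h = single m \<epsilon>"
    using m unfolding \<epsilon>_def by (intro poly_mapping_eqI) (auto simp: lookup_single when_def in_keys_iff)
  then have "lookup (adjoint f) n = \<epsilon> * lookup f (n - m)" for n
    unfolding h by (metis lookup_single_times mult.commute)
  then have "\<And>n. lookup f (- n) = \<epsilon> * lookup f (n - m)"
    by (simp only: lookup_adjoint)
  then show ?thesis by (rule that[OF \<epsilon>])
qed

text \<open>The reflection \<open>n\<close> to \<open>- n - m\<close> permutes the support of
  \<open>f\<close> and negates the shifted frequencies. Hence the value is real for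
  \<open>\<epsilon> = 1\<close> and purely imaginary for \<open>\<epsilon> = - 1\<close>.\<close>

lemma cnj_shifted_eval:
  assumes \<epsilon>: "\<epsilon> = 1 \<or> \<epsilon> = - 1" and sym: "\<And>n. lookup f (- n) = \<epsilon> * lookup f (n - m)"
  shows "shifted_eval m f t = of_int \<epsilon> * cnj (shifted_eval m f t)"
proof -
  have sym': "lookup f (- n - m) = \<epsilon> * lookup f n" for n
  proof -
    have "- n - m = - (n + m)" by simp
    then show ?thesis using sym[of "n + m"] by (simp only: add_diff_cancel)
  qed
  have bij: "bij_betw (\<lambda>n. - n - m) (keys f) (keys f)"
  proof (rule bij_betw_byWitness[where f' = "\<lambda>n. - n - m"])
    show "(\<lambda>n. - n - m) ` keys f \<subseteq> keys f" "(\<lambda>n. - n - m) ` keys f \<subseteq> keys f"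
      using \<epsilon> by (auto simp: in_keys_iff sym')
  qed auto
  have freq: "shifted_freq m (- n - m) \<bullet> t = - (shifted_freq m n \<bullet> t)" for n
    unfolding shifted_freq_def inner_vec_def by (simp add: algebra_simps sum_negf[symmetric])
  have "shifted_eval m f t = (\<Sum>n\<in>keys f.
      of_int (lookup f (- n - m)) * cis (shifted_freq m (- n - m) \<bullet> t))"
    unfolding shifted_eval_def by (rule sum.reindex_bij_betw[OF bij, symmetric])
  also have "\<dots> = of_int \<epsilon> * cnj (shifted_eval m f t)"
    unfolding shifted_eval_def freq sym' by (simp add: cis_cnj sum_distrib_left mult.assoc)
  finally show ?thesis .
qed

text \<open>The partial derivative of \<open>shifted_eval m f\<close> in direction \<open>j\<close>,
  up to the factor \<open>\<i> * pi\<close>. Doubling the half-integral frequency keeps the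
  coefficients integral.\<close>

definition shifted_deriv :: "int ^ 'd \<Rightarrow> 'd \<Rightarrow> 'd::finite laurent \<Rightarrow> 'd laurent"
  where "shifted_deriv m j f = Abs_poly_mapping (\<lambda>n. (2 * n $ j + m $ j) * lookup f n)"

lemma lookup_shifted_deriv:
  "lookup (shifted_deriv m j f) n = (2 * n $ j + m $ j) * lookup f n"
proof -
  have "{n. (2 * n $ j + m $ j) * lookup f n \<noteq> 0} \<subseteq> keys f"
    by (auto simp: in_keys_iff)
  then have "finite {n. (2 * n $ j + m $ j) * lookup f n \<noteq> 0}" by (rule finite_subset) simp
  then show ?thesis unfolding shifted_deriv_def by simp
qed

lemma shifted_eval_shifted_deriv:
  "shifted_eval m (shifted_deriv m j f) t = (\<Sum>n\<in>keys f.
    of_int ((2 * n $ j + m $ j) * lookup f n) * cis (shifted_freq m n \<bullet> t))"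
  unfolding shifted_eval_def
proof (rule sum.mono_neutral_cong_left)
  show "keys (shifted_deriv m j f) \<subseteq> keys f"
    by (auto simp: in_keys_iff lookup_shifted_deriv)
  show "\<forall>n\<in>keys f - keys (shifted_deriv m j f).
      of_int ((2 * n $ j + m $ j) * lookup f n) * cis (shifted_freq m n \<bullet> t) = 0"
  proof
    fix n assume "n \<in> keys f - keys (shifted_deriv m j f)"
    then have "lookup (shifted_deriv m j f) n = 0" by (simp add: in_keys_iff)
    then have "(2 * n $ j + m $ j) * lookup f n = 0" unfolding lookup_shifted_deriv .
    then show "of_int ((2 * n $ j + m $ j) * lookup f n) * cis (shifted_freq m n \<bullet> t) = 0"
      by (simp only: of_int_0 mult_zero_left)
  qed
qed (simp_all add: lookup_shifted_deriv)

lemma multiplier_exists_reciprocal: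
  fixes f :: "'d::finite laurent"
  assumes f0: "f \<noteq> 0" and S: "has_semialgebraic_dim (torus_embed ` unitary_variety f) k" "k + 2 \<le> CARD('d)"
    and t0: "laurent_eval f (torus_point t0) = 0" and recip: "f dvd adjoint f"
  shows "\<exists>g C. \<not> f dvd g \<and> (\<forall>z\<in>torus. norm (laurent_eval g z) ^ 2 \<le> C * norm (laurent_eval f z))"
proof -
  obtain m :: "int ^ 'd" and \<epsilon> :: int where \<epsilon>: "\<epsilon> = 1 \<or> \<epsilon> = - 1"
    and sym: "\<And>n. lookup f (- n) = \<epsilon> * lookup f (n - m)"
    by (rule reciprocal_of_dvd_adjoint[OF f0 recip]) (rule that)
  \<comment> \<open>Rotates the purely imaginary case into the real one.\<close>
  define \<kappa> where "\<kappa> = (if \<epsilon> = 1 then 1 else - \<i>)"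
  have n\<kappa>: "norm \<kappa> = 1" unfolding \<kappa>_def by simp
  have real: "Im (\<kappa> * shifted_eval m f t) = 0" for t
    using \<epsilon>
  proof
    assume 1: "\<epsilon> = 1"
    have "Im (shifted_eval m f t) = 0"
      using arg_cong[OF cnj_shifted_eval[OF \<epsilon> sym, of t], of Im] unfolding 1 by simp
    then show ?thesis unfolding \<kappa>_def 1 by simp
  next
    assume 1: "\<epsilon> = - 1"
    have "Re (shifted_eval m f t) = 0"
      using arg_cong[OF cnj_shifted_eval[OF \<epsilon> sym, of t], of Re] unfolding 1 by simp
    then show ?thesis unfolding \<kappa>_def 1 by simp
  qed
  define c where "c = (\<lambda>n. \<kappa> * of_int (lookup f n))"
  define \<omega> where "\<omega> = shifted_freq m"
  define K where "K = keys f"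
  define T where "T = trig_sum c \<omega> K"
  have T_eq: "T t = Re (\<kappa> * shifted_eval m f t)" for t
    unfolding T_def trig_sum_def c_def \<omega>_def K_def shifted_eval_def by (simp add: sum_distrib_left mult.assoc)
  have T_abs: "\<bar>T t\<bar> = norm (laurent_eval f (torus_point t))" for t
  proof -
    have "\<bar>T t\<bar> = norm (\<kappa> * shifted_eval m f t)" unfolding T_eq using real[of t] by (simp add: cmod_eq_Re)
    then show ?thesis by (simp add: norm_mult n\<kappa> norm_shifted_eval)
  qed
  have "(\<forall>t. T t \<ge> 0) \<or> (\<forall>t. T t \<le> 0)"
    unfolding T_def
  proof (rule trig_sum_constant_sign[OF S(1)])
    show "k + 2 \<le> DIM(real ^ 'd)" using S(2) by simp
    show "torus_point t \<in> torus_embed ` unitary_variety f" if "trig_sum c \<omega> K t = 0" for t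
      using T_abs[of t] that unfolding torus_point_in_variety[symmetric] T_def by simp
  qed (auto intro: continuous_torus_point inj_on_torus_point)
  then obtain \<sigma> :: real where \<sigma>: "\<sigma> = 1 \<or> \<sigma> = - 1" "\<And>t. \<sigma> * T t \<ge> 0"
    by (metis mult_1 mult_minus1 neg_0_le_iff_le)
  define e where "e = (\<lambda>j :: 'd. axis j (1 :: real))"
  define g where "g = (\<lambda>j. shifted_deriv m j f)"
  define T1 where "T1 = (\<lambda>u. trig_sum (diff_coeff \<omega> u 1 c) \<omega> K)"
  have T1_der: "((\<lambda>s. T (t + s *\<^sub>R u)) has_real_derivative T1 u (t + s *\<^sub>R u)) (at s)" for t u s
    using trig_sum_has_derivative[of \<omega> u 0 c K t s] unfolding T_def T1_def by simp
  have \<omega>e: "\<omega> n \<bullet> e j = pi * of_int (2 * n $ j + m $ j)" for n j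
    unfolding \<omega>_def e_def shifted_freq_def by (simp add: inner_axis)
  have T1_eq: "(\<Sum>n\<in>K. diff_coeff \<omega> (e j) 1 c n * cis (\<omega> n \<bullet> t)) = \<i> * of_real pi * \<kappa> * shifted_eval m (g j) t" for j t
    unfolding g_def shifted_eval_shifted_deriv diff_coeff_def \<omega>e c_def K_def sum_distrib_left
    by (intro sum.cong) (simp_all add: \<omega>_def mult_ac)
  \<comment> \<open>The imaginary part of the rotated evaluation is again a trigonometric sum, with
    coefficients \<open>c'\<close>. It vanishes identically, and therefore so does its
    derivative.\<close>
  have T1_im: "Im (\<Sum>n\<in>K. diff_coeff \<omega> (e j) 1 c n * cis (\<omega> n \<bullet> t)) = 0" for j t
  proof -
    define c' where "c' = (\<lambda>n. - \<i> * c n)"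
    have "trig_sum c' \<omega> K t = Im (\<kappa> * shifted_eval m f t)" for t
      unfolding trig_sum_def c'_def c_def \<omega>_def K_def shifted_eval_def
      by (simp add: sum_distrib_left mult.assoc add.commute)
    then have 0: "trig_sum c' \<omega> K t = 0" for t using real by simp
    have "((\<lambda>s. trig_sum c' \<omega> K (t + s *\<^sub>R e j)) has_real_derivative
        trig_sum (diff_coeff \<omega> (e j) 1 c') \<omega> K (t + 0 *\<^sub>R e j)) (at 0)"
      using trig_sum_has_derivative[of \<omega> "e j" 0 c' K t 0] by simp
    then have "trig_sum (diff_coeff \<omega> (e j) 1 c') \<omega> K t = 0"
      unfolding 0 using DERIV_unique[OF _ DERIV_const] by fastforce
    moreover have coeff: "diff_coeff \<omega> (e j) 1 c' n * cis (\<omega> n \<bullet> t) = - \<i> * (diff_coeff \<omega> (e j) 1 c n * cis (\<omega> n \<bullet> t))" for n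
      unfolding diff_coeff_def c'_def by simp
    moreover have re: "Re (- \<i> * X) = Im X" for X by simp
    ultimately show ?thesis unfolding trig_sum_def coeff sum_distrib_left[symmetric] re by blast
  qed
  have T1_abs: "\<bar>T1 (e j) t\<bar> = pi * norm (laurent_eval (g j) (torus_point t))" for j t
  proof -
    have "\<bar>T1 (e j) t\<bar> = norm (\<Sum>n\<in>K. diff_coeff \<omega> (e j) 1 c n * cis (\<omega> n \<bullet> t))"
      unfolding T1_def trig_sum_def using T1_im[of j t] by (simp add: cmod_eq_Re)
    also have "\<dots> = pi * norm (laurent_eval (g j) (torus_point t))"
      unfolding T1_eq by (simp add: norm_mult n\<kappa> norm_shifted_eval)
    finally show ?thesis .
  qed
  \<comment> \<open>If \<open>f\<close> divided all derivatives, the directional derivatives of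
    \<open>T\<close> would be bounded by multiples of \<open>T\<close>. Starting from the zero
    \<open>t0\<close>, Gronwall's argument along lines would give \<open>T = 0\<close>
    everywhere.\<close>
  have "\<exists>j. \<not> f dvd g j"
  proof (rule ccontr)
    assume "\<not> ?thesis"
    then have "\<forall>j. \<exists>h. g j = f * h" by (auto simp: dvd_def)
    then obtain h where h: "\<And>j. g j = f * h j" by metis
    define H where "H = (\<lambda>j. \<Sum>n\<in>keys (h j). \<bar>real_of_int (lookup (h j) n)\<bar>)"
    have T1_le: "\<bar>T1 (e j) t\<bar> \<le> pi * H j * \<bar>T t\<bar>" for j t
    proof -
      have "norm (laurent_eval (h j) (torus_point t)) \<le> H j"
        unfolding H_def by (rule norm_laurent_eval_le[OF torus_point_in_torus])
      then have "\<bar>T t\<bar> * norm (laurent_eval (h j) (torus_point t)) \<le> \<bar>T t\<bar> * H j"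
        by (rule mult_left_mono) simp
      then show ?thesis
        unfolding T1_abs h laurent_eval_mult[OF torus_point_in_torus] norm_mult T_abs[symmetric]
        by (simp add: mult_ac)
    qed
    have T1_sum: "T1 u t = (\<Sum>j\<in>UNIV. u $ j * T1 (e j) t)" for u t
    proof -
      have "\<omega> n \<bullet> u = (\<Sum>j\<in>UNIV. u $ j * (\<omega> n \<bullet> e j))" for n
      proof -
        have "\<omega> n \<bullet> e j = \<omega> n $ j" for j unfolding e_def by (simp add: inner_axis)
        then show ?thesis by (simp only:) (simp add: inner_vec_def mult.commute)
      qed
      then have "diff_coeff \<omega> u 1 c n = (\<Sum>j\<in>UNIV. of_real (u $ j) * diff_coeff \<omega> (e j) 1 c n)" for n
        unfolding diff_coeff_def by (simp add: sum_distrib_left mult_ac)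
      then have "T1 u t = Re (\<Sum>n\<in>K. \<Sum>j\<in>UNIV. of_real (u $ j) * (diff_coeff \<omega> (e j) 1 c n * cis (\<omega> n \<bullet> t)))"
        unfolding T1_def trig_sum_def by (simp add: sum_distrib_right mult.assoc)
      also have "\<dots> = Re (\<Sum>j\<in>UNIV. of_real (u $ j) * (\<Sum>n\<in>K. diff_coeff \<omega> (e j) 1 c n * cis (\<omega> n \<bullet> t)))"
        by (subst sum.swap) (simp only: sum_distrib_left)
      also have "\<dots> = (\<Sum>j\<in>UNIV. u $ j * T1 (e j) t)"
        unfolding T1_def trig_sum_def by (simp only: Re_sum Re_complex_of_real times_complex.simps Im_complex_of_real) simp
      finally show ?thesis .
    qed
    have zero: "T a = 0" for a
    proof -
      define u where "u = a - t0"
      define L where "L = (\<Sum>j\<in>UNIV. \<bar>u $ j\<bar> * (pi * H j))"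
      have "\<bar>T1 u t\<bar> \<le> L * \<bar>T t\<bar>" for t
      proof -
        have "\<bar>T1 u t\<bar> \<le> (\<Sum>j\<in>UNIV. \<bar>u $ j * T1 (e j) t\<bar>)" unfolding T1_sum[of u] by (rule sum_abs)
        also have "\<dots> \<le> (\<Sum>j\<in>UNIV. \<bar>u $ j\<bar> * (pi * H j * \<bar>T t\<bar>))"
          unfolding abs_mult by (intro sum_mono mult_left_mono T1_le) simp
        also have "\<dots> = L * \<bar>T t\<bar>" unfolding L_def by (simp only: sum_distrib_right mult.assoc)
        finally show ?thesis .
      qed
      moreover have "T t0 = 0" using T_abs[of t0] t0 by simp
      ultimately have "T (t0 + 1 *\<^sub>R u) = 0"
        by (intro zero_of_linear_growth[of "\<lambda>s. T (t0 + s *\<^sub>R u)", OF T1_der]) auto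
      then show ?thesis unfolding u_def by simp
    qed
    have "laurent_eval f z = 0" if "z \<in> torus" for z
      using torus_pointE[OF that] zero T_abs by (metis abs_zero norm_eq_zero)
    then have "\<bar>real_of_int (lookup f n)\<bar> \<le> 0" for n by (intro coeff_bound) auto
    then have "f = 0" by (intro poly_mapping_eqI) simp
    then show False using f0 by simp
  qed
  then obtain j where j: "\<not> f dvd g j" by blast
  define T2 where "T2 = trig_sum (diff_coeff \<omega> (e j) 2 c) \<omega> K"
  define M where "M = (\<Sum>n\<in>K. norm (diff_coeff \<omega> (e j) 2 c n)) + 1"
  have M: "M > 0" unfolding M_def by (simp add: add_nonneg_pos sum_nonneg)
  have T2_der: "((\<lambda>s. T1 (e j) (t + s *\<^sub>R e j)) has_real_derivative T2 (t + s *\<^sub>R e j)) (at s)" for t s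
    using trig_sum_has_derivative[of \<omega> "e j" 1 c K t s] unfolding T1_def T2_def by (simp add: numeral_2_eq_2)
  have "norm (laurent_eval (g j) z) ^ 2 \<le> (2 * M / pi\<^sup>2) * norm (laurent_eval f z)" if z: "z \<in> torus" for z
  proof -
    obtain t where t: "torus_point t = z" using torus_pointE[OF z] by blast
    have "(\<sigma> * T1 (e j) (t + 0 *\<^sub>R e j))\<^sup>2 \<le> 2 * M * (\<sigma> * T (t + 0 *\<^sub>R e j))"
    proof (rule derivative_square_le[of "\<lambda>s. \<sigma> * T (t + s *\<^sub>R e j)" "\<lambda>s. \<sigma> * T1 (e j) (t + s *\<^sub>R e j)"
          "\<lambda>s. \<sigma> * T2 (t + s *\<^sub>R e j)"])
      show "\<bar>\<sigma> * T2 (t + s *\<^sub>R e j)\<bar> \<le> M" for s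
        using \<sigma>(1) trig_sum_bound[of "diff_coeff \<omega> (e j) 2 c" \<omega> K "t + s *\<^sub>R e j"] unfolding M_def T2_def by auto
    qed (use M \<sigma>(2) in \<open>auto intro!: DERIV_cmult T1_der T2_der\<close>)
    moreover have "\<sigma> * T t = \<bar>T t\<bar>" using \<sigma>(1) \<sigma>(2)[of t] by auto
    moreover have "(\<sigma> * T1 (e j) t)\<^sup>2 = \<bar>T1 (e j) t\<bar>\<^sup>2" using \<sigma>(1) by auto
    ultimately have "(pi * norm (laurent_eval (g j) z))\<^sup>2 \<le> 2 * M * norm (laurent_eval f z)"
      unfolding T1_abs T_abs t by simp
    then show ?thesis by (simp add: power_mult_distrib pos_le_divide_eq mult.commute)
  qed
  then show ?thesis using j by blast
qed

lemma norm_circle_exp: "norm (circle_exp x) = 1"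
  by transfer simp

lemma multiplier_exists:
  fixes f :: "'d::finite laurent"
  assumes irr: "irreducible f" and at: "atoral f"
  obtains g C where "\<not> f dvd g" "\<And>z. z \<in> torus \<Longrightarrow> norm (laurent_eval g z) ^ 2 \<le> C * norm (laurent_eval f z)"
proof (cases "unitary_variety f = {}")
  case True
  \<comment> \<open>With shift 0 this is the absolute value of \<open>f\<close> in angular
    coordinates, a continuous function that attains its positive minimum on a compact box covering
    the torus.\<close>
  let ?N = "\<lambda>t. norm (shifted_eval 0 f t)"
  define Q :: "(real ^ 'd) set" where "Q = cbox (\<chi> j. - 1) (\<chi> j. 1)"
  have nz: "laurent_eval f (torus_point t) \<noteq> 0" for t
    using torus_point_in_variety[of f t] True by simp
  have "continuous_on Q ?N"
    unfolding shifted_eval_def by (intro continuous_intros)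
  moreover have "Q \<noteq> {}" unfolding Q_def by (simp add: interval_ne_empty_cart)
  moreover have "compact Q" unfolding Q_def by (rule compact_cbox)
  ultimately obtain t1 where t1: "\<And>t. t \<in> Q \<Longrightarrow> ?N t1 \<le> ?N t"
    using continuous_attains_inf[of Q ?N] by blast
  have pos: "?N t1 > 0" unfolding norm_shifted_eval using nz by simp
  show ?thesis
  proof (rule that[of 1 "1 / ?N t1"])
    show "\<not> f dvd 1" using irr by (simp add: irreducible_def)
    fix z :: "complex ^ 'd" assume z: "z \<in> torus"
    obtain t where t: "torus_point t = z" "\<And>j. \<bar>t $ j\<bar> \<le> 1"
      by (rule torus_pointE[OF z], rule that)
    have "t \<in> Q" unfolding Q_def using t(2) by (simp add: mem_box_cart abs_le_iff minus_le_iff)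
    then have "?N t1 \<le> norm (laurent_eval f z)" using t1[of t] t(1) by (simp add: norm_shifted_eval)
    then show "norm (laurent_eval 1 z) ^ 2 \<le> 1 / ?N t1 * norm (laurent_eval f z)"
      using pos by (simp add: laurent_eval_1)
  qed
next
  case False
  have f0: "f \<noteq> 0" using irr by (simp add: irreducible_def)
  show ?thesis
  proof (cases "f dvd adjoint f")
    case True
    obtain k where k: "has_semialgebraic_dim (torus_embed ` unitary_variety f) k" "k + 2 \<le> CARD('d)"
      using at False unfolding atoral_def by blast
    obtain u where u: "u \<in> unitary_variety f" using False by blast
    have "torus_embed u \<in> torus"
      unfolding torus_embed_def torus_def by (simp add: norm_circle_exp)
    then obtain t0 where "torus_point t0 = torus_embed u" using torus_pointE by blast
    then have "laurent_eval f (torus_point t0) = 0" using u unfolding unitary_variety_def by simp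
    then show ?thesis using multiplier_exists_reciprocal[OF f0 k _ True] that by blast
  next
    case False
    define C where "C = (\<Sum>n\<in>keys f. \<bar>real_of_int (lookup f n)\<bar>)"
    have "norm (laurent_eval (adjoint f) z) ^ 2 \<le> C * norm (laurent_eval f z)" if "z \<in> torus" for z
      using norm_laurent_eval_le[OF that, of f] that
      unfolding C_def laurent_eval_adjoint[OF that] by (simp add: power2_eq_square mult_right_mono)
    then show ?thesis using that False by blast
  qed
qed

section \<open>Summable perturbations\<close>

lemma to_circle_add: "to_circle (x + y) = to_circle x + to_circle y"
  by (simp add: plus_add_circle.abs_eq)

lemma to_circle_minus: "to_circle (- x) = - to_circle x"
  by (simp add: uminus_add_circle.abs_eq)

lemma to_circle_0: "to_circle 0 = 0"
  by (simp add: zero_add_circle.abs_eq)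

lemma to_circle_eq_0_iff: "to_circle x = 0 \<longleftrightarrow> x \<in> \<int>"
  by (simp add: add_circle.abs_eq_iff flip: to_circle_0)

lemma to_circle_sum: "to_circle (\<Sum>i\<in>I. h i) = (\<Sum>i\<in>I. to_circle (h i))"
  by (induction I rule: infinite_finite_induct) (simp_all add: to_circle_0 to_circle_add)

lemma zmult_to_circle: "zmult k (to_circle x) = to_circle (of_int k * x)"
  by (simp add: zmult.abs_eq)

lemma circle_lift: "\<exists>r. to_circle r = x \<and> \<bar>r\<bar> \<le> 1"
proof -
  obtain s where s: "to_circle s = x" using surj_to_circle by (metis surjD)
  have "to_circle (frac s) = to_circle s"
    by (simp add: add_circle.abs_eq_iff frac_def)
  moreover have "\<bar>frac s\<bar> \<le> 1" using frac_ge_0[of s] frac_lt_1[of s] by simp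
  ultimately show ?thesis using s by blast
qed

text \<open>The error is a real number and not an element of the circle, so that several errors can
  be added and compared by absolute value.\<close>

lemma open_sequence_neighbourhood:
  fixes u :: "int ^ 'd::finite \<Rightarrow> add_circle"
  assumes U: "open U" "u \<in> U"
  shows "\<exists>(a::nat) (\<epsilon>::real). \<epsilon> > 0 \<and>
    (\<forall>y. (\<forall>m\<in>int_box (int a). \<exists>e. \<bar>e\<bar> \<le> \<epsilon> \<and> y m + to_circle e = u m) \<longrightarrow> y \<in> U)"
proof -
  have "openin (product_topology (\<lambda>_. euclidean) UNIV) U"
    using U(1) by (simp add: euclidean_product_topology)
  then obtain V where V: "u \<in> PiE UNIV V" "\<And>i. open (V i)" "finite {i. V i \<noteq> UNIV}" "PiE UNIV V \<subseteq> U"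
    using product_topology_open_contains_basis[of "\<lambda>_. euclidean" UNIV U u] U(2) by auto
  define I where "I = {i. V i \<noteq> UNIV}"
  have "\<exists>\<epsilon>>0. \<forall>e. \<bar>e\<bar> \<le> \<epsilon> \<longrightarrow> u i - to_circle e \<in> V i" for i
  proof -
    obtain r where r: "to_circle r = u i" using circle_lift by blast
    have "open (to_circle -` V i)" using V(2) by (simp add: open_add_circle_def)
    moreover have "r \<in> to_circle -` V i" using r V(1) by auto
    ultimately obtain \<epsilon> where \<epsilon>: "\<epsilon> > 0" "cball r \<epsilon> \<subseteq> to_circle -` V i"
      using open_contains_cball by metis
    have "u i - to_circle e \<in> V i" if "\<bar>e\<bar> \<le> \<epsilon>" for e
    proof -
      have "r - e \<in> cball r \<epsilon>" using that by (simp add: dist_real_def)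
      then have "to_circle (r - e) \<in> V i" using subsetD[OF \<epsilon>(2)] by simp
      then show ?thesis using to_circle_add[of r "- e"] by (simp add: to_circle_minus r)
    qed
    then show ?thesis using \<epsilon>(1) by blast
  qed
  then obtain \<epsilon> where \<epsilon>: "\<And>i. \<epsilon> i > 0" "\<And>i e. \<bar>e\<bar> \<le> \<epsilon> i \<Longrightarrow> u i - to_circle e \<in> V i" by metis
  define \<epsilon>0 where "\<epsilon>0 = Min (insert 1 (\<epsilon> ` I))"
  have fI: "finite I" unfolding I_def by (rule V)
  have \<epsilon>0: "\<epsilon>0 > 0" "\<And>i. i \<in> I \<Longrightarrow> \<epsilon>0 \<le> \<epsilon> i"
    unfolding \<epsilon>0_def using fI \<epsilon>(1) by auto
  obtain a :: nat where a: "I \<subseteq> int_box (int a)" using finite_subset_int_box[OF fI] .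
  show ?thesis
  proof (intro exI[of _ a] exI[of _ \<epsilon>0] conjI allI impI \<epsilon>0(1))
    fix y assume y: "\<forall>m\<in>int_box (int a). \<exists>e. \<bar>e\<bar> \<le> \<epsilon>0 \<and> y m + to_circle e = u m"
    have "y i \<in> V i" for i
    proof (cases "i \<in> I")
      case True
      then obtain e where e: "\<bar>e\<bar> \<le> \<epsilon>0" "y i + to_circle e = u i" using y a by blast
      have "y i = u i - to_circle e" using e(2) by (metis add_diff_cancel)
      then show ?thesis using \<epsilon>(2)[of e i] \<epsilon>0(2)[OF True] e(1) by simp
    qed (simp add: I_def)
    then show "y \<in> U" using V(4) by auto
  qed
qed

text \<open>A finite set whose sum comes within \<open>\<epsilon>\<close> of the supremum of all
  finite sums leaves at most \<open>\<epsilon>\<close> for any finite set disjoint from it.\<close>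

lemma summable_tail:
  fixes w :: "int ^ 'd::finite \<Rightarrow> real"
  assumes W: "\<And>F. finite F \<Longrightarrow> (\<Sum>n\<in>F. \<bar>w n\<bar>) \<le> W" and \<epsilon>: "\<epsilon> > 0"
  obtains r :: nat where "\<And>F. finite F \<Longrightarrow> F \<inter> int_box (int r) = {} \<Longrightarrow> (\<Sum>n\<in>F. \<bar>w n\<bar>) \<le> \<epsilon>"
proof -
  define S where "S = (\<lambda>F. \<Sum>n\<in>F. \<bar>w n\<bar>) ` {F. finite F}"
  have S: "S \<noteq> {}" "bdd_above S" unfolding S_def using W by (auto intro!: bdd_aboveI2)
  obtain x where "x \<in> S" "Sup S - \<epsilon> < x" using less_cSup_iff[OF S, of "Sup S - \<epsilon>"] \<epsilon> by auto
  then obtain F0 where F0: "finite F0" "Sup S - \<epsilon> < (\<Sum>n\<in>F0. \<bar>w n\<bar>)" unfolding S_def by blast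
  obtain r :: nat where r: "F0 \<subseteq> int_box (int r)" using finite_subset_int_box[OF F0(1)] .
  have "(\<Sum>n\<in>F. \<bar>w n\<bar>) \<le> \<epsilon>" if F: "finite F" "F \<inter> int_box (int r) = {}" for F
  proof -
    have "(\<Sum>n\<in>F0 \<union> F. \<bar>w n\<bar>) \<le> Sup S"
      by (rule cSup_upper[OF _ S(2)]) (use F(1) F0(1) in \<open>auto simp: S_def\<close>)
    moreover have "(\<Sum>n\<in>F0 \<union> F. \<bar>w n\<bar>) = (\<Sum>n\<in>F0. \<bar>w n\<bar>) + (\<Sum>n\<in>F. \<bar>w n\<bar>)"
      using F F0(1) r by (intro sum.union_disjoint) auto
    ultimately show ?thesis using F0(2) by linarith
  qed
  then show ?thesis using that by blast
qed

text \<open>A correlation, with \<open>w\<close> at \<open>n - m\<close>, because a polynomial acts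
  on configurations through \<open>t (m + n)\<close>; with this sign, the action of \<open>f\<close>
  reproduces the identity that turns \<open>f\<close> and \<open>w\<close> into \<open>G\<close>.
  The values of \<open>v\<close> outside the box do not enter.\<close>

definition box_conv :: "(int ^ 'd \<Rightarrow> real) \<Rightarrow> int \<Rightarrow> (int ^ 'd \<Rightarrow> int) \<Rightarrow> int ^ 'd::finite \<Rightarrow> real"
  where "box_conv w \<rho> v m = (\<Sum>n\<in>int_box \<rho>. w (n - m) * of_int (v n))"

text \<open>Applying \<open>f\<close> to the real configuration gives integer combinations of the
  coefficients of \<open>G\<close>, which vanish modulo 1.\<close>

lemma box_conv_in_principal_group:
  fixes f G :: "'d::finite laurent"
  assumes eq: "\<And>l. (\<Sum>m\<in>keys f. of_int (lookup f m) * w (l - m)) = of_int (lookup G l)"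
  shows "(\<lambda>m. to_circle (box_conv w \<rho> v m)) \<in> principal_group f"
proof -
  have "(\<Sum>k\<in>keys f. zmult (lookup f k) (to_circle (box_conv w \<rho> v (m + k)))) = 0" for m
  proof -
    have "(\<Sum>k\<in>keys f. of_int (lookup f k) * box_conv w \<rho> v (m + k)) =
        (\<Sum>n\<in>int_box \<rho>. of_int (v n) * (\<Sum>k\<in>keys f. of_int (lookup f k) * w (n - m - k)))"
      unfolding box_conv_def sum_distrib_left
      by (subst sum.swap) (simp add: mult_ac diff_diff_eq)
    also have "\<dots> = of_int (\<Sum>n\<in>int_box \<rho>. v n * lookup G (n - m))"
      unfolding eq by simp
    finally have "(\<Sum>k\<in>keys f. of_int (lookup f k) * box_conv w \<rho> v (m + k)) \<in> \<int>"
      by (simp only: Ints_of_int)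
    then show ?thesis unfolding zmult_to_circle to_circle_sum[symmetric] to_circle_eq_0_iff .
  qed
  then show ?thesis unfolding principal_group_def by simp
qed

lemma sum_diff_abs_le:
  fixes h :: "'a \<Rightarrow> real"
  assumes "finite A" "finite B"
  shows "\<bar>sum h A - sum h B\<bar> \<le> (\<Sum>x\<in>(A - B) \<union> (B - A). \<bar>h x\<bar>)"
proof -
  have "sum h A = sum h (A \<inter> B) + sum h (A - B)" using assms(1) by (rule sum.Int_Diff)
  moreover have "sum h B = sum h (A \<inter> B) + sum h (B - A)"
    using sum.Int_Diff[OF assms(2), of h A] by (simp add: Int_commute)
  ultimately have "sum h A - sum h B = sum h (A - B) - sum h (B - A)" by simp
  also have "\<bar>\<dots>\<bar> \<le> (\<Sum>x\<in>A - B. \<bar>h x\<bar>) + (\<Sum>x\<in>B - A. \<bar>h x\<bar>)"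
    using sum_abs[of h "A - B"] sum_abs[of h "B - A"] by linarith
  also have "\<dots> = (\<Sum>x\<in>(A - B) \<union> (B - A). \<bar>h x\<bar>)"
    using assms by (intro sum.union_disjoint[symmetric]) auto
  finally show ?thesis .
qed

lemma int_box_mono: "r \<le> s \<Longrightarrow> int_box r \<subseteq> int_box s"
  by (auto simp: int_box_def intro: order_trans)

lemma int_box_minus: "n \<in> int_box r \<Longrightarrow> - n \<in> int_box r"
  unfolding int_box_def by simp

text \<open>Lifting a solution \<open>z\<close> of \<open>G \<cdot> z = u - x\<close> to a bounded real configuration, \<open>f\<close> maps the
  lift to a bounded integer configuration \<open>v\<close>, and \<open>w \<cdot> v = G \<cdot> z\<close>; truncating \<open>v\<close> to a large
  box costs a tail of \<open>w\<close>.\<close>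

lemma perturbation_exists:
  fixes f G :: "'d::finite laurent" and w :: "int ^ 'd \<Rightarrow> real" and a :: nat
  assumes W: "\<And>F. finite F \<Longrightarrow> (\<Sum>n\<in>F. \<bar>w n\<bar>) \<le> W"
    and eq: "\<And>l. (\<Sum>m\<in>keys f. of_int (lookup f m) * w (l - m)) = of_int (lookup G l)"
    and surj: "\<And>y. y \<in> principal_group f \<Longrightarrow> \<exists>z\<in>principal_group f. \<forall>m.
      (\<Sum>n\<in>keys G. zmult (lookup G n) (z (m + n))) = y m"
    and \<epsilon>: "\<epsilon> > 0"
  shows "\<exists>(\<rho>::nat) (c::nat). \<forall>y\<in>principal_group f. \<exists>v\<in>PiE (int_box (int \<rho>)) (\<lambda>_. {- int c..int c}).
    \<forall>m\<in>int_box (int a). \<exists>e. \<bar>e\<bar> \<le> \<epsilon> \<and> to_circle (box_conv w (int \<rho>) v m) + to_circle e = y m"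
proof -
  define c where "c = coeff_norm f"
  obtain r1 :: nat where r1: "keys f \<subseteq> int_box (int r1)" using finite_subset_int_box[OF finite_keys] .
  obtain r2 :: nat where r2: "keys G \<subseteq> int_box (int r2)" using finite_subset_int_box[OF finite_keys] .
  \<comment> \<open>The tail error is multiplied by the absolute coefficients of \<open>f\<close>,
    whose sum is \<open>c\<close>; adding 1 keeps the denominator positive.\<close>
  define \<epsilon>' where "\<epsilon>' = \<epsilon> / (real c + 1)"
  have \<epsilon>': "\<epsilon>' > 0" "real c * \<epsilon>' \<le> \<epsilon>" unfolding \<epsilon>'_def using \<epsilon> by (simp_all add: field_simps)
  obtain r3 :: nat where r3: "\<And>F. finite F \<Longrightarrow> F \<inter> int_box (int r3) = {} \<Longrightarrow> (\<Sum>n\<in>F. \<bar>w n\<bar>) \<le> \<epsilon>'"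
    using summable_tail[OF W \<epsilon>'(1)] by blast
  \<comment> \<open>\<open>a + r2\<close> makes room for the support of \<open>G\<close> around the
    observed box; \<open>a + r1 + r3\<close> keeps the truncation boundary at distance more than
    \<open>r3\<close> after the translations by \<open>m\<close> and \<open>k\<close>.\<close>
  define \<rho> where "\<rho> = r1 + r2 + r3 + a"
  have c_sum: "(\<Sum>k\<in>keys f. \<bar>real_of_int (lookup f k)\<bar>) = real c"
    unfolding c_def coeff_norm_def by simp
  show ?thesis
  proof (rule exI[of _ \<rho>], rule exI[of _ c], rule ballI)
    fix y assume "y \<in> principal_group f"
    then obtain z where z: "z \<in> principal_group f"
      "\<And>m. (\<Sum>n\<in>keys G. zmult (lookup G n) (z (m + n))) = y m"
      using surj by blast
    have "\<forall>n. \<exists>r. to_circle r = z n \<and> \<bar>r\<bar> \<le> 1" using circle_lift by blast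
    then obtain zr where zr: "\<And>n. to_circle (zr n) = z n" "\<And>n. \<bar>zr n\<bar> \<le> 1" by metis
    define vr where "vr = (\<lambda>n. \<Sum>k\<in>keys f. of_int (lookup f k) * zr (n + k))"
    have "vr n \<in> \<int>" for n
    proof -
      have "to_circle (vr n) = 0"
        unfolding vr_def to_circle_sum zmult_to_circle[symmetric] zr(1)
        using z(1) by (simp add: principal_group_def)
      then show ?thesis by (simp add: to_circle_eq_0_iff)
    qed
    then have vr_floor: "real_of_int \<lfloor>vr n\<rfloor> = vr n" for n by (metis Ints_cases floor_of_int)
    have vr_le: "\<bar>vr n\<bar> \<le> real c" for n
    proof -
      have "\<bar>vr n\<bar> \<le> (\<Sum>k\<in>keys f. \<bar>of_int (lookup f k) * zr (n + k)\<bar>)"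
        unfolding vr_def by (rule sum_abs)
      also have "\<dots> \<le> (\<Sum>k\<in>keys f. \<bar>real_of_int (lookup f k)\<bar> * 1)"
        unfolding abs_mult by (intro sum_mono mult_left_mono zr(2)) simp
      finally show ?thesis using c_sum by simp
    qed
    define v where "v = restrict (\<lambda>n. \<lfloor>vr n\<rfloor>) (int_box (int \<rho>))"
    have v: "v \<in> PiE (int_box (int \<rho>)) (\<lambda>_. {- int c..int c})"
    proof (unfold v_def, rule restrict_PiE_iff[THEN iffD2], rule ballI)
      fix n
      have "\<bar>real_of_int \<lfloor>vr n\<rfloor>\<bar> \<le> real c" unfolding vr_floor by (rule vr_le)
      then show "\<lfloor>vr n\<rfloor> \<in> {- int c..int c}" by (simp add: abs_le_iff)
    qed
    have "\<exists>e. \<bar>e\<bar> \<le> \<epsilon> \<and> to_circle (box_conv w (int \<rho>) v m) + to_circle e = y m" if m: "m \<in> int_box (int a)" for m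
    proof -
      define Gz where "Gz = (\<Sum>n\<in>keys G. of_int (lookup G n) * zr (m + n))"
      have Gz: "to_circle Gz = y m"
        unfolding Gz_def to_circle_sum zmult_to_circle[symmetric] zr(1) by (rule z(2))
      have Gz_eq: "Gz = (\<Sum>l\<in>int_box (int \<rho>). of_int (lookup G (l - m)) * zr l)"
      proof -
        have "Gz = (\<Sum>l\<in>(+) m ` keys G. of_int (lookup G (l - m)) * zr l)"
          unfolding Gz_def by (subst sum.reindex) auto
        also have "\<dots> = (\<Sum>l\<in>int_box (int \<rho>). of_int (lookup G (l - m)) * zr l)"
        proof (rule sum.mono_neutral_left)
          have "m + n \<in> int_box (int \<rho>)" if "n \<in> keys G" for n
            using int_box_add[OF m subsetD[OF r2 that]] int_box_mono[of "int a + int r2" "int \<rho>"]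
            unfolding \<rho>_def by auto
          then show "(+) m ` keys G \<subseteq> int_box (int \<rho>)" by blast
          show "\<forall>l\<in>int_box (int \<rho>) - (+) m ` keys G. of_int (lookup G (l - m)) * zr l = 0"
          proof
            fix l assume l: "l \<in> int_box (int \<rho>) - (+) m ` keys G"
            have "l - m \<notin> keys G"
            proof
              assume "l - m \<in> keys G"
              then have "m + (l - m) \<in> (+) m ` keys G" by blast
              then show False using l by simp
            qed
            then show "of_int (lookup G (l - m)) * zr l = 0" by (simp add: in_keys_iff)
          qed
        qed simp
        finally show ?thesis .
      qed
      define h where "h = (\<lambda>k l. w (l - m - k) * zr l)"
      have Gz_h: "Gz = (\<Sum>k\<in>keys f. of_int (lookup f k) * sum (h k) (int_box (int \<rho>)))"
        unfolding Gz_eq eq[symmetric] h_def sum_distrib_left sum_distrib_right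
        by (subst sum.swap) (simp add: mult_ac)
      \<comment> \<open>The exact value \<open>Gz\<close> and the truncated one apply the same
        weights to sums of \<open>h k\<close>, over the box and over its translate by
        \<open>k\<close>. They differ only near the boundary of the box, where \<open>w\<close> is
        evaluated outside \<open>int_box (int r3)\<close>.\<close>
      have conv_h: "box_conv w (int \<rho>) v m =
          (\<Sum>k\<in>keys f. of_int (lookup f k) * sum (h k) ((\<lambda>n. n + k) ` int_box (int \<rho>)))"
      proof -
        have "box_conv w (int \<rho>) v m = (\<Sum>n\<in>int_box (int \<rho>). w (n - m) * vr n)"
          unfolding box_conv_def v_def by (intro sum.cong) (simp_all add: vr_floor)
        also have "\<dots> = (\<Sum>k\<in>keys f. of_int (lookup f k) * (\<Sum>n\<in>int_box (int \<rho>). w (n - m) * zr (n + k)))"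
          unfolding vr_def sum_distrib_left by (subst sum.swap) (simp add: mult_ac)
        moreover have "(\<Sum>n\<in>int_box (int \<rho>). w (n - m) * zr (n + k)) = sum (h k) ((\<lambda>n. n + k) ` int_box (int \<rho>))" for k
          by (subst sum.reindex) (auto simp: h_def algebra_simps)
        ultimately show ?thesis by simp
      qed
      have tail: "\<bar>sum (h k) (int_box (int \<rho>)) - sum (h k) ((\<lambda>n. n + k) ` int_box (int \<rho>))\<bar> \<le> \<epsilon>'"
        if k: "k \<in> keys f" for k
      proof -
        define E where "E = (int_box (int \<rho>) - (\<lambda>n. n + k) ` int_box (int \<rho>)) \<union> ((\<lambda>n. n + k) ` int_box (int \<rho>) - int_box (int \<rho>))"
        have kr: "k \<in> int_box (int r1)" using k r1 by blast
        have "\<bar>sum (h k) (int_box (int \<rho>)) - sum (h k) ((\<lambda>n. n + k) ` int_box (int \<rho>))\<bar> \<le> (\<Sum>l\<in>E. \<bar>h k l\<bar>)"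
          unfolding E_def by (rule sum_diff_abs_le) auto
        also have "\<dots> \<le> (\<Sum>l\<in>E. \<bar>w (l - m - k)\<bar>)"
          unfolding h_def abs_mult
        proof (rule sum_mono)
          show "\<bar>w (l - m - k)\<bar> * \<bar>zr l\<bar> \<le> \<bar>w (l - m - k)\<bar>" for l
            using mult_left_mono[OF zr(2)[of l], of "\<bar>w (l - m - k)\<bar>"] by simp
        qed
        also have "\<dots> = (\<Sum>n\<in>(\<lambda>l. l - m - k) ` E. \<bar>w n\<bar>)"
          by (subst sum.reindex) (auto simp: inj_on_def)
        also have "\<dots> \<le> \<epsilon>'"
        proof (rule r3)
          show "finite ((\<lambda>l. l - m - k) ` E)" unfolding E_def by simp
          have False if l: "l \<in> E" "l - m - k \<in> int_box (int r3)" for l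
          proof -
            have "l - k = (l - m - k) + m" by simp
            then have 1: "l - k \<in> int_box (int r3 + int a)" using int_box_add[OF l(2) m] by simp
            have "l = (l - k) + k" by simp
            then have 2: "l \<in> int_box (int r3 + int a + int r1)" using int_box_add[OF 1 kr] by simp
            have "l - k \<in> int_box (int \<rho>)" "l \<in> int_box (int \<rho>)"
              using 1 2 int_box_mono[of "int r3 + int a" "int \<rho>"] int_box_mono[of "int r3 + int a + int r1" "int \<rho>"]
              unfolding \<rho>_def by auto
            moreover have "l = (l - k) + k" by simp
            ultimately show False using l(1) unfolding E_def by blast
          qed
          then show "(\<lambda>l. l - m - k) ` E \<inter> int_box (int r3) = {}" by blast
        qed
        finally show ?thesis .
      qed
      define e where "e = Gz - box_conv w (int \<rho>) v m"
      have "\<bar>e\<bar> \<le> (\<Sum>k\<in>keys f. \<bar>real_of_int (lookup f k)\<bar> *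
          \<bar>sum (h k) (int_box (int \<rho>)) - sum (h k) ((\<lambda>n. n + k) ` int_box (int \<rho>))\<bar>)"
        unfolding e_def Gz_h conv_h sum_subtractf[symmetric] right_diff_distrib[symmetric] abs_mult[symmetric]
        by (rule sum_abs)
      also have "\<dots> \<le> (\<Sum>k\<in>keys f. \<bar>real_of_int (lookup f k)\<bar> * \<epsilon>')"
        by (intro sum_mono mult_left_mono tail) auto
      also have "\<dots> = real c * \<epsilon>'" unfolding c_sum[symmetric] by (simp add: sum_distrib_right)
      finally have "\<bar>e\<bar> \<le> \<epsilon>" using \<epsilon>'(2) by simp
      moreover have "to_circle (box_conv w (int \<rho>) v m) + to_circle e = y m"
        unfolding to_circle_add[symmetric] e_def using Gz by simp
      ultimately show ?thesis by blast
    qed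
    then show "\<exists>v\<in>PiE (int_box (int \<rho>)) (\<lambda>_. {- int c..int c}).
        \<forall>m\<in>int_box (int a). \<exists>e. \<bar>e\<bar> \<le> \<epsilon> \<and> to_circle (box_conv w (int \<rho>) v m) + to_circle e = y m"
      using v by blast
  qed
qed

section \<open>Independent perturbations along a sparse lattice\<close>

definition scale_vec :: "int \<Rightarrow> int ^ 'd \<Rightarrow> int ^ 'd::finite"
  where "scale_vec L k = (\<chi> j. L * k $ j)"

definition lattice_box :: "nat \<Rightarrow> nat \<Rightarrow> (int ^ 'd::finite) set"
  where "lattice_box L R = scale_vec (int L) ` int_box (int (R div L))"

lemma finite_lattice_box [simp]: "finite (lattice_box L R)"
  unfolding lattice_box_def by simp

lemma lattice_box_subset: "lattice_box L R \<subseteq> int_box (int R)"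
proof -
  have "\<bar>int L * x\<bar> \<le> int R" if "\<bar>x\<bar> \<le> int (R div L)" for x
  proof -
    have "\<bar>int L * x\<bar> \<le> int L * int (R div L)" using that by (simp add: abs_mult mult_left_mono)
    also have "\<dots> \<le> int R" by (metis mult.commute div_times_less_eq_dividend of_nat_le_iff of_nat_mult)
    finally show ?thesis .
  qed
  then show ?thesis unfolding lattice_box_def scale_vec_def int_box_def by auto
qed

lemma lattice_box_separated:
  assumes "n \<in> lattice_box L R" "n' \<in> lattice_box L R" "n \<noteq> n'" "s < int L"
  shows "n - n' \<notin> int_box s"
proof
  assume H: "n - n' \<in> int_box s"
  obtain k k' where k: "n = scale_vec (int L) k" "n' = scale_vec (int L) k'"
    using assms(1,2) unfolding lattice_box_def by blast
  have "k \<noteq> k'" using assms(3) k by auto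
  then obtain j where "k $ j \<noteq> k' $ j" by (auto simp: vec_eq_iff)
  then have "1 \<le> \<bar>k $ j - k' $ j\<bar>" by linarith
  then have "int L * 1 \<le> int L * \<bar>k $ j - k' $ j\<bar>" by (intro mult_left_mono) auto
  also have "\<dots> = \<bar>(n - n') $ j\<bar>" unfolding k scale_vec_def by (simp add: abs_mult flip: right_diff_distrib)
  also have "\<dots> \<le> s" using H unfolding int_box_def by blast
  finally show False using assms(4) by simp
qed

lemma card_lattice_box:
  assumes "0 < L"
  shows "card (lattice_box L R :: (int ^ 'd::finite) set) = (2 * (R div L) + 1) ^ CARD('d)"
proof -
  have "inj_on (scale_vec (int L)) (int_box (int (R div L)) :: (int ^ 'd) set)"
    using assms by (auto simp: inj_on_def scale_vec_def vec_eq_iff)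
  then have "card (lattice_box L R :: (int ^ 'd) set) = nat (2 * int (R div L) + 1) ^ CARD('d)"
    unfolding lattice_box_def by (simp add: card_image card_int_box)
  also have "nat (2 * int (R div L) + 1) = 2 * (R div L) + 1" by linarith
  finally show ?thesis .
qed

text \<open>Since \<open>R < L * (R div L) + L\<close>, each side of the box is at most
  \<open>2 * L\<close> times the number of lattice points on an axis. So the lattice fills a fixed
  proportion of the box.\<close>

lemma card_int_box_le:
  assumes "0 < L"
  shows "card (int_box (int R) :: (int ^ 'd::finite) set) \<le>
    (2 * L) ^ CARD('d) * card (lattice_box L R :: (int ^ 'd) set)"
proof -
  have "R < L * (R div L) + L" using assms mod_less_divisor[OF assms, of R] by (metis mult_div_mod_eq nat_add_left_cancel_less)
  then have "2 * R + 1 \<le> 2 * L * (R div L) + 2 * L" by simp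
  also have "\<dots> \<le> 2 * L * (2 * (R div L) + 1)" by (simp add: algebra_simps)
  finally have "(2 * R + 1) ^ CARD('d) \<le> (2 * L * (2 * (R div L) + 1)) ^ CARD('d)" by (rule power_mono) simp
  moreover have "nat (2 * int R + 1) = 2 * R + 1" by linarith
  ultimately show ?thesis
    unfolding card_int_box card_lattice_box[OF assms]
    by (simp only: power_mult_distrib[of "2 * L" "2 * (R div L) + 1"])
qed

lemma index_box_eq: "index_box R = int_box (int R)"
  unfolding index_box_def int_box_def supnorm_def by (auto simp: Max_le_iff)

definition lattice_perturbation ::
    "(int ^ 'd \<Rightarrow> real) \<Rightarrow> int \<Rightarrow> (int ^ 'd) set \<Rightarrow> (int ^ 'd \<Rightarrow> int ^ 'd \<Rightarrow> int) \<Rightarrow> int ^ 'd::finite \<Rightarrow> add_circle"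
  where "lattice_perturbation w \<rho> \<Lambda> s = (\<lambda>m. \<Sum>n\<in>\<Lambda>. to_circle (box_conv w \<rho> (s n) (m - n)))"

lemma principal_group_add: "x \<in> principal_group f \<Longrightarrow> y \<in> principal_group f \<Longrightarrow> x + y \<in> principal_group f"
  by (simp add: principal_group_def zmult_add sum.distrib)

lemma principal_group_uminus: "x \<in> principal_group f \<Longrightarrow> - x \<in> principal_group f"
  by (simp add: principal_group_def zmult_minus sum_negf)

lemma principal_group_shift: "x \<in> principal_group f \<Longrightarrow> shift n x \<in> principal_group f"
proof -
  assume x: "x \<in> principal_group f"
  have "(\<Sum>k\<in>keys f. zmult (lookup f k) (x ((m + n) + k))) = 0" for m
    using x unfolding principal_group_def by blast
  moreover have "(m + n) + k = (m + k) + n" for m k by (simp add: add_ac)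
  ultimately show ?thesis unfolding principal_group_def shift_def by simp
qed

lemma lattice_perturbation_in_principal_group:
  assumes "\<And>v. (\<lambda>m. to_circle (box_conv w \<rho> v m)) \<in> principal_group f"
  shows "lattice_perturbation w \<rho> \<Lambda> s \<in> principal_group f"
proof -
  have 1: "(\<lambda>m. to_circle (box_conv w \<rho> (s n) (m - n))) \<in> principal_group f" for n
    using principal_group_shift[OF assms[of "s n"], of "- n"] unfolding shift_def by simp
  have "lattice_perturbation w \<rho> \<Lambda> s = (\<Sum>n\<in>\<Lambda>. (\<lambda>m. to_circle (box_conv w \<rho> (s n) (m - n))))"
  proof
    fix m
    have "(\<Sum>n\<in>\<Lambda>. h n) m = (\<Sum>n\<in>\<Lambda>. h n m)" for h :: "int ^ 'a \<Rightarrow> int ^ 'a \<Rightarrow> add_circle"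
      by (induction \<Lambda> rule: infinite_finite_induct) simp_all
    then show "lattice_perturbation w \<rho> \<Lambda> s m = (\<Sum>n\<in>\<Lambda>. (\<lambda>m. to_circle (box_conv w \<rho> (s n) (m - n)))) m"
      unfolding lattice_perturbation_def by simp
  qed
  also have "\<dots> \<in> principal_group f"
  proof (induction \<Lambda> rule: infinite_finite_induct)
    case (insert n \<Lambda>)
    show ?case by (simp only: sum.insert[OF insert(1,2)]) (rule principal_group_add[OF 1 insert(3)])
  qed (simp_all add: principal_group_def zmult_0)
  finally show ?thesis .
qed

text \<open>Near \<open>n\<close>, the configurations placed at other lattice points are felt only
  through a tail of \<open>w\<close>. The spacing serves two purposes: more than
  \<open>2 * \<rho>\<close> makes the indices of \<open>w\<close> that occur distinct, and more than
  \<open>r + a + \<rho>\<close> puts all of them outside \<open>int_box (int r)\<close>.\<close>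

lemma lattice_perturbation_local:
  fixes w :: "int ^ 'd::finite \<Rightarrow> real" and \<rho> a r L c :: nat
  assumes tail: "\<And>F. finite F \<Longrightarrow> F \<inter> int_box (int r) = {} \<Longrightarrow> (\<Sum>n\<in>F. \<bar>w n\<bar>) \<le> \<epsilon>"
    and L: "2 * \<rho> + r + a < L"
    and s: "\<And>n. n \<in> lattice_box L R \<Longrightarrow> s n \<in> PiE (int_box (int \<rho>)) (\<lambda>_. {- int c..int c})"
    and n: "n \<in> lattice_box L R" and m: "m \<in> int_box (int a)"
  shows "\<exists>e. \<bar>e\<bar> \<le> real c * \<epsilon> \<and>
    lattice_perturbation w (int \<rho>) (lattice_box L R) s (m + n) = to_circle (box_conv w (int \<rho>) (s n) m) + to_circle e"
proof -
  let ?\<Lambda> = "lattice_box L R :: (int ^ 'd) set"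
  define e where "e = (\<Sum>n'\<in>?\<Lambda> - {n}. box_conv w (int \<rho>) (s n') (m + n - n'))"
  have "lattice_perturbation w (int \<rho>) ?\<Lambda> s (m + n) =
      to_circle (box_conv w (int \<rho>) (s n) m) + to_circle e"
    unfolding lattice_perturbation_def e_def to_circle_sum using n by (subst sum.remove[of _ n]) auto
  moreover have "\<bar>e\<bar> \<le> real c * \<epsilon>"
  proof -
    let ?P = "(?\<Lambda> - {n}) \<times> (int_box (int \<rho>) :: (int ^ 'd) set)"
    \<comment> \<open>The index at which \<open>w\<close> is evaluated for the entry
      \<open>l\<close> of the configuration at \<open>n'\<close>.\<close>
    define \<phi> where "\<phi> = (\<lambda>(n', l). l - (m + n - n'))"
    have sl: "\<bar>real_of_int (s n' l)\<bar> \<le> real c" if "n' \<in> ?\<Lambda>" "l \<in> int_box (int \<rho>)" for n' l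
    proof -
      have "s n' l \<in> {- int c..int c}" using s[OF that(1)] that(2) by (rule PiE_mem)
      then show ?thesis by (simp add: abs_le_iff)
    qed
    have "\<bar>e\<bar> \<le> (\<Sum>n'\<in>?\<Lambda> - {n}. \<Sum>l\<in>int_box (int \<rho>). \<bar>w (l - (m + n - n')) * of_int (s n' l)\<bar>)"
      unfolding e_def box_conv_def by (rule order_trans[OF sum_abs]) (intro sum_mono sum_abs)
    also have "\<dots> \<le> (\<Sum>n'\<in>?\<Lambda> - {n}. \<Sum>l\<in>int_box (int \<rho>). \<bar>w (l - (m + n - n'))\<bar> * real c)"
      unfolding abs_mult by (intro sum_mono mult_left_mono sl) auto
    also have "\<dots> = real c * (\<Sum>p\<in>?P. \<bar>w (\<phi> p)\<bar>)"
      unfolding \<phi>_def sum.cartesian_product by (simp add: sum_distrib_left case_prod_unfold mult.commute)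
    also have "(\<Sum>p\<in>?P. \<bar>w (\<phi> p)\<bar>) = (\<Sum>i\<in>\<phi> ` ?P. \<bar>w i\<bar>)"
    proof (rule sum.reindex_cong[of \<phi>, symmetric])
      show "inj_on \<phi> ?P"
      proof (rule inj_onI)
        fix p p' assume pp: "p \<in> ?P" "p' \<in> ?P" "\<phi> p = \<phi> p'"
        obtain n1 l1 n2 l2 where p: "p = (n1, l1)" "p' = (n2, l2)" by (metis surj_pair)
        have H: "n1 \<in> ?\<Lambda>" "n2 \<in> ?\<Lambda>" "l1 \<in> int_box (int \<rho>)" "l2 \<in> int_box (int \<rho>)"
          "l1 - (m + n - n1) = l2 - (m + n - n2)"
          using pp unfolding p \<phi>_def by auto
        have "n1 - n2 = l2 + - l1" using H(5) by (simp add: algebra_simps)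
        then have "n1 - n2 \<in> int_box (int \<rho> + int \<rho>)"
          using int_box_add[OF H(4) int_box_minus[OF H(3)]] by simp
        moreover have "int \<rho> + int \<rho> < int L" using L by simp
        ultimately have "n1 = n2" using lattice_box_separated[OF H(1,2)] by blast
        then show "p = p'" using H(5) unfolding p by simp
      qed
    qed auto
    also have "real c * (\<Sum>i\<in>\<phi> ` ?P. \<bar>w i\<bar>) \<le> real c * \<epsilon>"
    proof (intro mult_left_mono tail)
      show "\<phi> ` ?P \<inter> int_box (int r) = {}"
      proof (rule equals0I)
        fix i assume "i \<in> \<phi> ` ?P \<inter> int_box (int r)"
        then obtain n' l where H: "n' \<in> ?\<Lambda>" "n' \<noteq> n" "l \<in> int_box (int \<rho>)" "l - (m + n - n') \<in> int_box (int r)"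
          unfolding \<phi>_def by auto
        have "n' - n = (l - (m + n - n')) + (m + - l)" by simp
        then have "n' - n \<in> int_box (int r + (int a + int \<rho>))"
          using int_box_add[OF H(4) int_box_add[OF m int_box_minus[OF H(3)]]] by simp
        moreover have "int r + (int a + int \<rho>) < int L" using L by simp
        ultimately show False using lattice_box_separated[OF H(1) n H(2)] by blast
      qed
    qed auto
    finally show ?thesis .
  qed
  ultimately show ?thesis by blast
qed

text \<open>The sum is the integral of the number of sets \<open>B i\<close> that contain a given
  point.\<close>

lemma measure_sum_le_multiplicity:
  assumes "prob_space \<mu>" "finite I" "\<And>i. i \<in> I \<Longrightarrow> B i \<in> sets \<mu>"
    and count: "\<And>x. x \<in> space \<mu> \<Longrightarrow> card {i\<in>I. x \<in> B i} \<le> N"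
  shows "(\<Sum>i\<in>I. measure \<mu> (B i)) \<le> real N"
proof -
  interpret prob_space \<mu> by (rule assms(1))
  have "(\<Sum>i\<in>I. emeasure \<mu> (B i)) = (\<integral>\<^sup>+x. (\<Sum>i\<in>I. indicator (B i) x) \<partial>\<mu>)"
    using assms(3) by (simp add: nn_integral_sum)
  also have "\<dots> \<le> (\<integral>\<^sup>+x. of_nat N \<partial>\<mu>)"
  proof (rule nn_integral_mono)
    fix x assume x: "x \<in> space \<mu>"
    have "(\<Sum>i\<in>I. indicator (B i) x :: ennreal) = of_nat (card {i\<in>I. x \<in> B i})"
      using assms(2) by (simp add: indicator_def sum.If_cases Int_def)
    also have "\<dots> \<le> of_nat N" using count[OF x] by (simp only: of_nat_le_iff)
    finally show "(\<Sum>i\<in>I. indicator (B i) x) \<le> (of_nat N :: ennreal)" .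
  qed
  also have "\<dots> = ennreal (real N)" by (simp add: emeasure_space_1 ennreal_of_nat_eq_real_of_nat)
  finally have "ennreal (\<Sum>i\<in>I. measure \<mu> (B i)) \<le> ennreal (real N)"
    by (simp add: emeasure_eq_measure sum_ennreal)
  then show ?thesis by (simp add: ennreal_le_iff)
qed

text \<open>Averaging over all choices of perturbations at the lattice points: for every \<open>x\<close>, each lattice
  point admits a choice that moves the orbit into the complement of \<open>K\<close>, independently of the choices
  at the other lattice points.\<close>

lemma exponentially_recurrent_of_summable_fraction:
  fixes f G :: "'d::finite laurent" and w :: "int ^ 'd \<Rightarrow> real" and \<mu> :: "(int ^ 'd \<Rightarrow> add_circle) measure"
  assumes W: "\<And>F. finite F \<Longrightarrow> (\<Sum>n\<in>F. \<bar>w n\<bar>) \<le> W"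
    and eq: "\<And>l. (\<Sum>m\<in>keys f. of_int (lookup f m) * w (l - m)) = of_int (lookup G l)"
    and surj: "\<And>y. y \<in> principal_group f \<Longrightarrow> \<exists>z\<in>principal_group f. \<forall>m.
      (\<Sum>n\<in>keys G. zmult (lookup G n) (z (m + n))) = y m"
    and haar: "normalized_haar (principal_group f) \<mu>"
  shows "exponentially_recurrent (principal_group f) (principal_action f) \<mu>"
  unfolding exponentially_recurrent_def
proof (intro conjI allI impI)
  show "algebraic_action (principal_group f) (principal_action f)" by (rule algebraic_action_principal)
  show "normalized_haar (principal_group f) \<mu>" by (rule haar)
  let ?X = "principal_group f"
  have prob: "prob_space \<mu>" and space: "space \<mu> = ?X" and sets: "sets \<mu> = sets (restrict_space borel ?X)"
    and inv: "\<And>x A. x \<in> ?X \<Longrightarrow> A \<in> sets \<mu> \<Longrightarrow> emeasure \<mu> ((+) x ` A) = emeasure \<mu> A"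
    using haar unfolding normalized_haar_def by blast+
  fix K assume "closedin (top_of_set ?X) K \<and> K \<noteq> ?X"
  then have K: "closed K" "K \<subseteq> ?X" "K \<noteq> ?X"
    using closedin_closed_trans[OF _ closed_principal_group] closedin_subset[of "top_of_set ?X" K] by auto
  then obtain u where u: "u \<in> ?X" "u \<in> - K" by blast
  obtain a :: nat and \<epsilon> :: real where \<epsilon>: "\<epsilon> > 0" and nbhd:
    "\<forall>y. (\<forall>m\<in>int_box (int a). \<exists>e. \<bar>e\<bar> \<le> \<epsilon> \<and> y m + to_circle e = u m) \<longrightarrow> y \<in> - K"
    using open_sequence_neighbourhood[OF open_Compl[OF K(1)] u(2)] by (elim exE conjE) (rule that)
  \<comment> \<open>One half of the tolerance is for the approximation at a lattice point itself,
    the other for the influence of all other lattice points.\<close>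
  have \<epsilon>2: "\<epsilon> / 2 > 0" using \<epsilon> by simp
  have "\<exists>(\<rho>::nat) (c::nat). \<forall>y\<in>?X. \<exists>v\<in>PiE (int_box (int \<rho>)) (\<lambda>_. {- int c..int c}).
    \<forall>m\<in>int_box (int a). \<exists>e. \<bar>e\<bar> \<le> \<epsilon> / 2 \<and> to_circle (box_conv w (int \<rho>) v m) + to_circle e = y m"
    by (rule perturbation_exists[OF W eq surj \<epsilon>2])
  then obtain \<rho> c :: nat where pert: "\<forall>y\<in>?X. \<exists>v\<in>PiE (int_box (int \<rho>)) (\<lambda>_. {- int c..int c}).
    \<forall>m\<in>int_box (int a). \<exists>e. \<bar>e\<bar> \<le> \<epsilon> / 2 \<and> to_circle (box_conv w (int \<rho>) v m) + to_circle e = y m"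
    by (elim exE) (rule that)
  define V where "V = PiE (int_box (int \<rho>) :: (int ^ 'd) set) (\<lambda>_. {- int c..int c})"
  have finV: "finite V" unfolding V_def by (intro finite_PiE) auto
  have "V \<noteq> {}" unfolding V_def by (simp add: PiE_eq_empty_iff)
  then have cV: "card V > 0" using finV by (simp add: card_gt_0_iff)
  define \<epsilon>' where "\<epsilon>' = \<epsilon> / 2 / (real c + 1)"
  have \<epsilon>': "\<epsilon>' > 0" "real c * \<epsilon>' \<le> \<epsilon> / 2" unfolding \<epsilon>'_def using \<epsilon> by (simp_all add: field_simps)
  obtain r :: nat where r: "\<And>F. finite F \<Longrightarrow> F \<inter> int_box (int r) = {} \<Longrightarrow> (\<Sum>n\<in>F. \<bar>w n\<bar>) \<le> \<epsilon>'"
    using summable_tail[OF W \<epsilon>'(1)] by blast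
  define L where "L = 2 * \<rho> + r + a + 1"
  have L: "0 < L" "2 * \<rho> + r + a < L" unfolding L_def by simp_all
  \<comment> \<open>Slightly larger than the ratio \<open>(card V - 1) / card V\<close> that the
    counting gives, in order to stay positive when \<open>V\<close> has a single element.\<close>
  define \<beta> where "\<beta> = real (card V) / (real (card V) + 1)"
  have \<beta>: "0 < \<beta>" "\<beta> < 1" unfolding \<beta>_def using cV by (simp_all add: field_simps)
  have main: "measure \<mu> (\<Inter>n\<in>index_box R. principal_action f n ` K) \<le> \<beta> ^ card (lattice_box L R :: (int ^ 'd) set)" for R
  proof -
    let ?\<Lambda> = "lattice_box L R :: (int ^ 'd) set"
    define A where "A = (\<Inter>n\<in>index_box R. principal_action f n ` K)"
    \<comment> \<open>The image of \<open>K\<close> under the action of \<open>n\<close> is a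
      preimage under the shift by \<open>- n\<close>; the sign disappears because the box is
      symmetric.\<close>
    have A_iff: "x \<in> A \<longleftrightarrow> (\<forall>n\<in>int_box (int R). shift n x \<in> K)" for x
    proof -
      have "x \<in> principal_action f n ` K \<longleftrightarrow> shift (- n) x \<in> K" for n
      proof
        assume "x \<in> principal_action f n ` K"
        then obtain y where "y \<in> K" "x = shift n y" using K(2) by (auto simp: principal_action_def)
        then show "shift (- n) x \<in> K" by (simp add: shift_def)
      next
        assume H: "shift (- n) x \<in> K"
        then have "principal_action f n (shift (- n) x) = x"
          using K(2) by (auto simp: principal_action_def shift_def)
        then show "x \<in> principal_action f n ` K" using H by (metis imageI)
      qed
      then have "x \<in> A \<longleftrightarrow> (\<forall>n\<in>int_box (int R). shift (- n) x \<in> K)"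
        unfolding A_def index_box_eq by blast
      also have "\<dots> \<longleftrightarrow> (\<forall>n\<in>int_box (int R). shift n x \<in> K)"
        using int_box_minus by (metis minus_minus)
      finally show ?thesis .
    qed
    have "0 \<in> (int_box (int R) :: (int ^ 'd) set)" unfolding int_box_def by simp
    then have AK: "A \<subseteq> K" using A_iff by (fastforce simp: shift_def)
    have shift_cont: "continuous_on UNIV (shift n :: (int ^ 'd \<Rightarrow> add_circle) \<Rightarrow> _)" for n
      unfolding shift_def
      by (rule continuous_on_coordinatewise_then_product)
        (rule continuous_on_product_then_coordinatewise[OF continuous_on_id])
    have "A = (\<Inter>n\<in>int_box (int R). shift n -` K)" using A_iff by auto
    then have "closed A" using closed_vimage[OF K(1) shift_cont] by auto
    define S where "S = PiE ?\<Lambda> (\<lambda>_. V)"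
    have finS: "finite S" unfolding S_def using finV by (intro finite_PiE) auto
    define \<Delta> where "\<Delta> = (\<lambda>s. lattice_perturbation w (int \<rho>) ?\<Lambda> s)"
    have \<Delta>X: "\<Delta> s \<in> ?X" for s
      unfolding \<Delta>_def by (rule lattice_perturbation_in_principal_group[OF box_conv_in_principal_group[OF eq]])
    \<comment> \<open>All these translates of \<open>A\<close> have the measure of \<open>A\<close>,
      while a given point lies in only a small fraction of them.\<close>
    define B where "B = (\<lambda>s. {x\<in>?X. x + \<Delta> s \<in> A})"
    have A_sets: "A \<in> sets \<mu>"
      unfolding sets sets_restrict_space using borel_closed[OF \<open>closed A\<close>] AK K(2) by (intro image_eqI[of _ _ A]) auto
    have B_sets: "B s \<in> sets \<mu>" for s
    proof -
      have "continuous_on UNIV (\<lambda>x. x + \<Delta> s)"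
        unfolding plus_fun_def
        by (rule continuous_on_coordinatewise_then_product, rule continuous_circle_add)
          (auto intro: continuous_on_product_then_coordinatewise[OF continuous_on_id])
      from closed_vimage[OF \<open>closed A\<close> this] have "closed ((\<lambda>x. x + \<Delta> s) -` A)" .
      then show ?thesis
        unfolding sets sets_restrict_space B_def by (intro image_eqI[OF _ borel_closed]) auto
    qed
    have B_measure: "measure \<mu> (B s) = measure \<mu> A" for s
    proof -
      have "B s = (+) (- \<Delta> s) ` A"
      proof
        show "B s \<subseteq> (+) (- \<Delta> s) ` A"
        proof
          fix x assume "x \<in> B s"
          then have "x + \<Delta> s \<in> A" unfolding B_def by blast
          moreover have "x = - \<Delta> s + (x + \<Delta> s)" by simp
          ultimately show "x \<in> (+) (- \<Delta> s) ` A" by blast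
        qed
        show "(+) (- \<Delta> s) ` A \<subseteq> B s"
          unfolding B_def using AK K(2) principal_group_add[OF principal_group_uminus[OF \<Delta>X]] by auto
      qed
      then show ?thesis
        using inv[OF principal_group_uminus[OF \<Delta>X] A_sets] by (simp add: measure_def)
    qed
    have count: "card {s\<in>S. x \<in> B s} \<le> (card V - 1) ^ card ?\<Lambda>" if x: "x \<in> space \<mu>" for x
    proof -
      have xX: "x \<in> ?X" using x space by simp
      have "\<exists>v\<in>V. \<forall>m\<in>int_box (int a). \<exists>e. \<bar>e\<bar> \<le> \<epsilon> / 2 \<and> to_circle (box_conv w (int \<rho>) v m) + to_circle e = (u + - shift n x) m" for n
        unfolding V_def by (intro pert[rule_format] principal_group_add u(1) principal_group_uminus principal_group_shift xX)
      \<comment> \<open>A symbol whose perturbation nearly equals the difference between the target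
        \<open>u\<close> and the orbit point at \<open>n\<close>. A choice \<open>s\<close> with
        \<open>s n = good n\<close> moves that orbit point out of \<open>K\<close>, so
        \<open>x\<close> lies outside \<open>B s\<close>.\<close>
      then obtain good where good: "\<And>n. good n \<in> V"
        "\<And>n m. m \<in> int_box (int a) \<Longrightarrow> \<exists>e. \<bar>e\<bar> \<le> \<epsilon> / 2 \<and> to_circle (box_conv w (int \<rho>) (good n) m) + to_circle e = (u + - shift n x) m"
        by metis
      have "s n \<noteq> good n" if s: "s \<in> S" "x \<in> B s" and n: "n \<in> ?\<Lambda>" for s n
      proof
        assume sg: "s n = good n"
        have "shift n (x + \<Delta> s) \<in> - K"
        proof (rule nbhd[rule_format])
          fix m :: "int ^ 'd" assume m: "m \<in> int_box (int a)"
          obtain e where e: "\<bar>e\<bar> \<le> \<epsilon> / 2" "to_circle (box_conv w (int \<rho>) (s n) m) + to_circle e = u m - x (m + n)"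
            using good(2)[OF m, of n] sg by (auto simp: shift_def)
          have sPiE: "s n' \<in> PiE (int_box (int \<rho>)) (\<lambda>_. {- int c..int c})" if "n' \<in> ?\<Lambda>" for n'
            using s(1) that unfolding S_def V_def by (rule PiE_mem)
          have "\<exists>e. \<bar>e\<bar> \<le> real c * \<epsilon>' \<and>
              \<Delta> s (m + n) = to_circle (box_conv w (int \<rho>) (s n) m) + to_circle e"
            unfolding \<Delta>_def by (rule lattice_perturbation_local[OF r L(2) sPiE n m])
          then obtain e' where e': "\<bar>e'\<bar> \<le> real c * \<epsilon>'"
            "\<Delta> s (m + n) = to_circle (box_conv w (int \<rho>) (s n) m) + to_circle e'" by blast
          have "\<bar>e - e'\<bar> \<le> \<epsilon>" using e(1) e'(1) \<epsilon>'(2) by linarith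
          moreover have "shift n (x + \<Delta> s) m + to_circle (e - e') = u m"
          proof -
            have "to_circle (e - e') = to_circle e - to_circle e'"
              using to_circle_add[of e "- e'"] by (simp add: to_circle_minus)
            then have "shift n (x + \<Delta> s) m + to_circle (e - e') =
                x (m + n) + (to_circle (box_conv w (int \<rho>) (s n) m) + to_circle e)"
              unfolding shift_def plus_fun_def e'(2) by (simp add: algebra_simps)
            then show ?thesis unfolding e(2) by simp
          qed
          ultimately show "\<exists>e. \<bar>e\<bar> \<le> \<epsilon> \<and> shift n (x + \<Delta> s) m + to_circle e = u m" by blast
        qed
        moreover have "shift n (x + \<Delta> s) \<in> K"
          using s(2) n lattice_box_subset[of L R] A_iff unfolding B_def by blast
        ultimately show False by blast
      qed
      then have "{s\<in>S. x \<in> B s} \<subseteq> PiE ?\<Lambda> (\<lambda>n. V - {good n})"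
        unfolding S_def by (auto simp: PiE_iff extensional_def)
      then have "card {s\<in>S. x \<in> B s} \<le> card (PiE ?\<Lambda> (\<lambda>n. V - {good n}))"
        using finV by (intro card_mono finite_PiE) auto
      also have "\<dots> = (card V - 1) ^ card ?\<Lambda>"
        using good(1) by (simp add: card_PiE card_Diff_singleton)
      finally show ?thesis .
    qed
    have "(\<Sum>s\<in>S. measure \<mu> (B s)) \<le> real ((card V - 1) ^ card ?\<Lambda>)"
      by (rule measure_sum_le_multiplicity[OF prob finS B_sets count])
    then have le: "real (card V) ^ card ?\<Lambda> * measure \<mu> A \<le> real (card V - 1) ^ card ?\<Lambda>"
      unfolding B_measure by (simp add: S_def card_PiE)
    have "real (card V - 1) \<le> \<beta> * real (card V)"
    proof -
      have "(real (card V) - 1) * (real (card V) + 1) \<le> real (card V) * real (card V)" by (simp add: algebra_simps)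
      then have "real (card V) - 1 \<le> real (card V) * real (card V) / (real (card V) + 1)"
        by (subst pos_le_divide_eq) auto
      then show ?thesis unfolding \<beta>_def using cV by (simp add: of_nat_diff)
    qed
    then have "real (card V - 1) ^ card ?\<Lambda> \<le> (\<beta> * real (card V)) ^ card ?\<Lambda>" by (rule power_mono) simp
    with le have "real (card V) ^ card ?\<Lambda> * measure \<mu> A \<le> real (card V) ^ card ?\<Lambda> * \<beta> ^ card ?\<Lambda>"
      by (simp add: power_mult_distrib mult.commute)
    then show ?thesis unfolding A_def using cV by (simp add: mult_le_cancel_left_pos)
  qed
  define D where "D = (2 * L) ^ CARD('d)"
  have D: "D > 0" unfolding D_def using L(1) by simp
  \<comment> \<open>The box has at most \<open>D\<close> times as many points as the lattice in it,
    so a \<open>D\<close>-th root converts the lattice rate into a rate per point of the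
    box.\<close>
  define \<theta> where "\<theta> = root D \<beta>"
  have \<theta>: "0 < \<theta>" "\<theta> < 1" "\<theta> ^ D = \<beta>"
    unfolding \<theta>_def using D \<beta> by (simp_all add: real_root_gt_zero)
  have "measure \<mu> (\<Inter>n\<in>index_box R. principal_action f n ` K) \<le> 1 * \<theta> ^ card (index_box R :: (int ^ 'd) set)" for R
  proof -
    have "\<beta> ^ card (lattice_box L R :: (int ^ 'd) set) = \<theta> ^ (D * card (lattice_box L R :: (int ^ 'd) set))"
      unfolding power_mult \<theta>(3) ..
    also have "\<dots> \<le> \<theta> ^ card (index_box R :: (int ^ 'd) set)"
      unfolding index_box_eq using card_int_box_le[OF L(1)] \<theta>(1,2) unfolding D_def
      by (intro power_decreasing) auto
    finally show ?thesis using main[of R] by simp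
  qed
  then show "\<exists>c \<theta>. 0 < c \<and> 0 < \<theta> \<and> \<theta> < 1 \<and> (\<forall>R\<ge>1. measure \<mu> (\<Inter>n\<in>index_box R. principal_action f n ` K)
      \<le> c * \<theta> ^ card (index_box R :: (int ^ 'd) set))"
    using \<theta>(1,2) zero_less_one by blast
qed

section \<open>Exponential recurrence of atoral principal actions\<close>

theorem theorem4p2:
  fixes f :: "'d::finite laurent"
    and \<mu> :: "(int ^ 'd \<Rightarrow> add_circle) measure"
  assumes "irreducible f"
    and "atoral f"
    and "normalized_haar (principal_group f) \<mu>"
  shows "exponentially_recurrent (principal_group f) (principal_action f) \<mu>"
proof -
  have f0: "f \<noteq> 0" using assms(1) by (simp add: irreducible_def)
  have prime: "prime_elem f" by (rule irreducible_imp_prime_laurent[OF assms(1)])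
  obtain g C where g: "\<not> f dvd g"
    "\<And>z. z \<in> torus \<Longrightarrow> norm (laurent_eval g z) ^ 2 \<le> C * norm (laurent_eval f z)"
    using multiplier_exists[OF assms(1,2)] by blast
  show ?thesis
  proof (rule summable_fraction[OF f0])
    show "norm (laurent_eval g z) ^ 2 \<le> C * norm (laurent_eval f z)" if "z \<in> torus" for z
      using g(2)[OF that] .
    fix q :: nat and w :: "int ^ 'd \<Rightarrow> real" and W
    assume w: "\<And>F. finite F \<Longrightarrow> (\<Sum>n\<in>F. \<bar>w n\<bar>) \<le> W"
      "\<And>l. (\<Sum>m\<in>keys f. of_int (lookup f m) * w (l - m)) =
        of_int (lookup (g ^ q) l)"
    \<comment> \<open>Primality of \<open>f\<close> is needed for the passage from \<open>g\<close>
      to its power.\<close>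
    have "\<not> f dvd g ^ q" using g(1) prime_elem_dvd_power[OF prime] by blast
    then have surj: "\<exists>z\<in>principal_group f. \<forall>m. (\<Sum>n\<in>keys (g ^ q).
        zmult (lookup (g ^ q) n) (z (m + n))) = y m" if "y \<in> principal_group f" for y
      using principal_group_surjective[OF prime _ that] by metis
    show "exponentially_recurrent (principal_group f) (principal_action f) \<mu>"
      by (rule exponentially_recurrent_of_summable_fraction[OF w surj assms(3)])
  qed
qed

end
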